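(* Let $n,k\ge1$, $\alpha>0$, let $\mathcal{A}$ be an $\alpha$-stretch correlated sampling algorithm for $\Delta_{n,k}$, and let $\mathrm{ALG}$ be the composed algorithm built from $\mathcal{A}$ as described in the context. Then for all $\mathbf{x},\mathbf{y}\in\Delta_{n,k}$, the sets $X=\mathrm{ALG}(\mathbf{x})$ and $Y=\mathrm{ALG}(\mathbf{y})$ (computed with the same shared randomness) satisfy $\mathbb{E}[|X\oplus Y|]=O(\log k+\log\alpha)\cdot\|\mathbf{x}-\mathbf{y}\|_1$, with an absolute implied constant.
   Context: $\Delta_{n,k}=\{\mathbf{x}\in[0,1]^n:\|\mathbf{x}\|_1\le k\}$. A correlated sampling algorithm for $\Delta_{n,k}$ is a distribution over deterministic maps $\Delta_{n,k}\to2^{[n]}$, drawn once and applied to all inputs; it is $\alpha$-stretch if for all $\mathbf{x},\mathbf{y}$: (P1) output size is $\lfloor\|\mathbf{x}\|_1\rfloor$ or $\lceil\|\mathbf{x}\|_1\rceil$; (P2) $\Pr[i\in\text{output}(\mathbf{x})]=x_i$; (P3) $\mathbb{E}|\text{output}(\mathbf{x})\oplus\text{output}(\mathbf{y})|\le\alpha\|\mathbf{x}-\mathbf{y}\|_1$. Logs base 2. Composed algorithm. Put $m=2^5k^5\alpha^5$ (number of buckets) and $d=m^3$. Subroutine $\mathcal{A}_1$ (exponential clocks): draw i.i.d. $E_1,\dots,E_n\sim\mathrm{Exp}(1)$; on a probability vector $\mathbf{p}\in[0,1]^n$ output $\{\arg\min_{i:p_i>0}E_i/p_i\}$. Subroutine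 $\mathcal{A}_k$ (tree pivotal sampling on $[d]$): fix a binary tree of depth $\lceil\log d\rceil$ with leaves $1,\dots,d$; draw independent $\theta_z\sim\mathrm{Uni}[0,1]$ for each internal node $z$ and an extra $\theta_{root}\sim\mathrm{Uni}[0,1]$. On $\mathbf{z}\in\Delta_{d,k}$, each leaf $i$ passes $(i,z_i)$ upward; bottom-up, an internal node receiving $(i,a),(j,b)$ does: if $a+b\le1$, then if $\theta_z\le a/(a+b)$ set values $(a+b,0)$ for $(i,j)$ and fix $j$, else set $(0,a+b)$ and fix $i$; if $a+b>1$, then if $\theta_z\le(1-b)/(2-a-b)$ set $(1,a+b-1)$ and fix $i$, else set $(a+b-1,1)$ and fix $j$; fixed coordinates keep their value and the non-fixed one is passed up with its new value. At the root the remaining coordinate with value $\gamma$ gets value $1$ if $\theta_{root}<\gamma$, else $0$. Output: coordinates with final value 1. Shared randomness (drawn once, independently, used for all inputs): randomness of $\mathcal{A},\mathcal{A}_1,\mathcal{A}_k$; $R_b\sim\mathrm{Uni}([d])$ for $b\in[m]$; $C_i\sim\mathrm{Uni}([d])$ and a uniform bucket $\beta(i)\in[m]$ for $i\in[n]$, with $\mathcal{B}_b=\{i:\beta(i)=b\}$; $\sigma,\tau\sim\mathrm{Uni}[0,1/10]$. $\mathrm{ALG}(\mathbf{x})$: let $S=\{i:0<x_i\le1/10+\sigma\}$, $L=\{i:x_i>1/10+\sigma\}$. (a) If two distinct elements among $\{C_i:i\in L\}\cup\{R_b:b\in[m]\}$ (indexed as a family) coincide, return $\mathcal{A}(\mathbf{x})$.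 (b) Else if some $b$ has $\sum_{i\in S\cap\mathcal{B}_b}x_i>1-\tau$, return $\mathcal{A}(\mathbf{x})$. (c) Else for each $b$ with $s_b=\sum_{i\in S\cap\mathcal{B}_b}x_i>0$ let $REP_b=\mathcal{A}_1(\mathbf{p}^b)$ with $p^b_i=x_i/s_b$ for $i\in S\cap\mathcal{B}_b$ and $0$ otherwise; define $\hat{\mathbf{x}}\in[0,1]^d$ by $\hat x_{R_b}=s_b$ for such $b$, $\hat x_{C_i}=x_i$ for $i\in L$, all other entries $0$; let $T=\mathcal{A}_k(\hat{\mathbf{x}})$ and return $\{i\in L:C_i\in T\}\cup\bigcup_{b:s_b>0,R_b\in T}REP_b$.
   Formalization: The bound is proved with max(1, log k + log α) in place of log k + log α, since at n = k = α = 1 the stated bound is 0 and fails for threshold sampling; m is 2^5 k^5 α^5 rounded up to an integer. *)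

theory Defs
  imports "HOL-Probability.Probability"
begin

text \<open>Vectors of length \<open>n\<close> are functions on \<open>{1..n}\<close>, made extensional so that a map with domain
  \<open>Delta n k\<close> sees nothing but the \<open>n\<close> entries.\<close>

definition l1_norm :: "nat \<Rightarrow> (nat \<Rightarrow> real) \<Rightarrow> real" where
  "l1_norm n x = (\<Sum>i\<in>{1..n}. \<bar>x i\<bar>)"

definition l1_dist :: "nat \<Rightarrow> (nat \<Rightarrow> real) \<Rightarrow> (nat \<Rightarrow> real) \<Rightarrow> real" where
  "l1_dist n x y = l1_norm n (\<lambda>i. x i - y i)"

definition Delta :: "nat \<Rightarrow> nat \<Rightarrow> (nat \<Rightarrow> real) set" where
  "Delta n k = {x \<in> {1..n} \<rightarrow>\<^sub>E {0..1}. l1_norm n x \<le> real k}"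

text \<open>A distribution over maps from \<open>Delta n k\<close> to the subsets of \<open>{1..n}\<close>, with the product
  \<open>\<sigma>\<close>-algebra, i.e. the smallest one making every evaluation \<open>f \<mapsto> f x\<close> a random set.\<close>

type_synonym map_distr = "((nat \<Rightarrow> real) \<Rightarrow> nat set) measure"

definition correlated_sampling :: "nat \<Rightarrow> nat \<Rightarrow> map_distr \<Rightarrow> bool" where
  "correlated_sampling n k A \<longleftrightarrow>
     prob_space A \<and> sets A = sets (\<Pi>\<^sub>M x\<in>Delta n k. count_space (Pow {1..n}))"

text \<open>The size condition is only required almost surely for each fixed input; this is the weakest
  reading, and it includes algorithms that satisfy it for every map.\<close>

definition stretch :: "nat \<Rightarrow> nat \<Rightarrow> real \<Rightarrow> map_distr \<Rightarrow> bool" where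
  "stretch n k \<alpha> A \<longleftrightarrow>
     (\<forall>x\<in>Delta n k.
        AE f in A. int (card (f x)) \<in> {\<lfloor>l1_norm n x\<rfloor>, \<lceil>l1_norm n x\<rceil>}) \<and>
     (\<forall>x\<in>Delta n k. \<forall>i\<in>{1..n}. measure A {f \<in> space A. i \<in> f x} = x i) \<and>
     (\<forall>x\<in>Delta n k. \<forall>y\<in>Delta n k.
        (\<integral>f. real (card (sym_diff (f x) (f y))) \<partial>A) \<le> \<alpha> * l1_dist n x y)"

definition uniform_real :: "real \<Rightarrow> real \<Rightarrow> real measure" where
  "uniform_real a b = uniform_measure lborel {a..b}"

definition exponential_measure :: "real \<Rightarrow> real measure" where
  "exponential_measure l = density lborel (\<lambda>x. ennreal (exponential_density l x))"

definition clock_sample :: "nat \<Rightarrow> (nat \<Rightarrow> real) \<Rightarrow> (nat \<Rightarrow> real) \<Rightarrow> nat set" where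
  "clock_sample n E p = {arg_min_on (\<lambda>i. E i / p i) {i \<in> {1..n}. p i > 0}}"

datatype btree = Leaf nat | Node btree btree

primrec leaves :: "btree \<Rightarrow> nat list" where
  "leaves (Leaf i) = [i]"
| "leaves (Node l r) = leaves l @ leaves r"

primrec depth :: "btree \<Rightarrow> nat" where
  "depth (Leaf i) = 0"
| "depth (Node l r) = Suc (max (depth l) (depth r))"

text \<open>Internal nodes are addressed by the path leading to them from the root
  (\<open>False\<close> = left, \<open>True\<close> = right).\<close>

primrec inner_nodes :: "btree \<Rightarrow> bool list set" where
  "inner_nodes (Leaf i) = {}"
| "inner_nodes (Node l r) =
     insert [] (Cons False ` inner_nodes l \<union> Cons True ` inner_nodes r)"

definition sampling_tree :: "nat \<Rightarrow> btree \<Rightarrow> bool" where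
  "sampling_tree d t \<longleftrightarrow>
     distinct (leaves t) \<and> set (leaves t) = {1..d} \<and> int (depth t) = \<lceil>log 2 (real d)\<rceil>"

text \<open>\<open>pass_up \<theta> t v\<close> processes the subtree \<open>t\<close> bottom-up, starting from the current values \<open>v\<close>; it
  returns the one leaf of \<open>t\<close> that is not yet fixed together with the updated values. In the
  degenerate cases \<open>a = b = 0\<close> and \<open>a = b = 1\<close> the threshold is \<open>0 / 0 = 0\<close>, and both outcomes assign
  the same values.\<close>

primrec pass_up :: "(bool list \<Rightarrow> real) \<Rightarrow> btree \<Rightarrow> (nat \<Rightarrow> real) \<Rightarrow> nat \<times> (nat \<Rightarrow> real)" where
  "pass_up \<theta> (Leaf i) v = (i, v)"
| "pass_up \<theta> (Node l r) v =
    (let (i, v') = pass_up (\<lambda>z. \<theta> (False # z)) l v;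
         (j, w) = pass_up (\<lambda>z. \<theta> (True # z)) r v';
         a = w i; b = w j
     in if a + b \<le> 1 then
          if \<theta> [] \<le> a / (a + b) then (i, w(i := a + b, j := 0))
          else (j, w(i := 0, j := a + b))
        else
          if \<theta> [] \<le> (1 - b) / (2 - a - b) then (j, w(i := 1, j := a + b - 1))
          else (i, w(i := a + b - 1, j := 1)))"

definition tree_sample :: "btree \<Rightarrow> (bool list \<Rightarrow> real) \<Rightarrow> real \<Rightarrow> (nat \<Rightarrow> real) \<Rightarrow> nat set" where
  "tree_sample t \<theta> \<theta>root z =
    (let (i, v) = pass_up \<theta> t z;
         final = v(i := if \<theta>root < v i then 1 else 0)
     in {c \<in> set (leaves t). final c = 1})"

text \<open>\<open>2\<^sup>5k\<^sup>5\<alpha>\<^sup>5\<close> has to be rounded to an integer, since \<open>\<alpha>\<close> is real.\<close>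

definition num_buckets :: "nat \<Rightarrow> real \<Rightarrow> nat" where
  "num_buckets k \<alpha> = nat \<lceil>2 ^ 5 * real k ^ 5 * \<alpha> ^ 5\<rceil>"

definition num_slots :: "nat \<Rightarrow> real \<Rightarrow> nat" where
  "num_slots k \<alpha> = num_buckets k \<alpha> ^ 3"

text \<open>The components are: a map \<open>f\<close> drawn from \<open>A\<close>, the clocks \<open>E\<close>, the tree randomness \<open>\<theta>\<close> and
  \<open>\<theta>root\<close>, the slots \<open>R\<close> of the buckets and \<open>C\<close> of the elements, the bucket assignment \<open>\<beta>\<close>, and the
  threshold shifts \<open>\<sigma>\<close> and \<open>\<tau>\<close>.\<close>

type_synonym randomness =
  "((nat \<Rightarrow> real) \<Rightarrow> nat set) \<times> (nat \<Rightarrow> real) \<times> (bool list \<Rightarrow> real) \<times> real \<times>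
   (nat \<Rightarrow> nat) \<times> (nat \<Rightarrow> nat) \<times> (nat \<Rightarrow> nat) \<times> real \<times> real"

definition shared_randomness ::
  "nat \<Rightarrow> nat \<Rightarrow> real \<Rightarrow> map_distr \<Rightarrow> btree \<Rightarrow> randomness measure" where
  "shared_randomness n k \<alpha> A t =
    (let m = num_buckets k \<alpha>; d = num_slots k \<alpha> in
     A
     \<Otimes>\<^sub>M (\<Pi>\<^sub>M i\<in>{1..n}. exponential_measure 1)
     \<Otimes>\<^sub>M (\<Pi>\<^sub>M z\<in>inner_nodes t. uniform_real 0 1)
     \<Otimes>\<^sub>M uniform_real 0 1
     \<Otimes>\<^sub>M (\<Pi>\<^sub>M b\<in>{1..m}. uniform_count_measure {1..d})
     \<Otimes>\<^sub>M (\<Pi>\<^sub>M i\<in>{1..n}. uniform_count_measure {1..d})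
     \<Otimes>\<^sub>M (\<Pi>\<^sub>M i\<in>{1..n}. uniform_count_measure {1..m})
     \<Otimes>\<^sub>M uniform_real 0 (1/10)
     \<Otimes>\<^sub>M uniform_real 0 (1/10))"

definition small_set :: "nat \<Rightarrow> real \<Rightarrow> (nat \<Rightarrow> real) \<Rightarrow> nat set" where
  "small_set n \<sigma> x = {i \<in> {1..n}. 0 < x i \<and> x i \<le> 1/10 + \<sigma>}"

definition large_set :: "nat \<Rightarrow> real \<Rightarrow> (nat \<Rightarrow> real) \<Rightarrow> nat set" where
  "large_set n \<sigma> x = {i \<in> {1..n}. x i > 1/10 + \<sigma>}"

text \<open>In \<open>xhat\<close> at most one of the summands is present whenever there is no collision, i.e. in the
  only case where \<open>xhat\<close> is used.\<close>

definition ALG ::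
  "nat \<Rightarrow> nat \<Rightarrow> real \<Rightarrow> btree \<Rightarrow> randomness \<Rightarrow> (nat \<Rightarrow> real) \<Rightarrow> nat set" where
  "ALG n k \<alpha> t \<omega> x =
    (let (f, E, \<theta>, \<theta>root, R, C, \<beta>, \<sigma>, \<tau>) = \<omega>;
         m = num_buckets k \<alpha>;
         d = num_slots k \<alpha>;
         S = small_set n \<sigma> x;
         L = large_set n \<sigma> x;
         bucket = (\<lambda>b. {i \<in> S. \<beta> i = b});
         s = (\<lambda>b. \<Sum>i\<in>bucket b. x i)
     in if \<not> inj_on (case_sum C R) (L <+> {1..m}) then f x
        else if \<exists>b\<in>{1..m}. s b > 1 - \<tau> then f x
        else
          let REP = (\<lambda>b. clock_sample n E
                       (\<lambda>i\<in>{1..n}. if i \<in> bucket b then x i / s b else 0));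
              xhat = (\<lambda>l\<in>{1..d}. (\<Sum>b | b \<in> {1..m} \<and> s b > 0 \<and> R b = l. s b)
                               + (\<Sum>i | i \<in> L \<and> C i = l. x i));
              T = tree_sample t \<theta> \<theta>root xhat
          in {i \<in> L. C i \<in> T} \<union> (\<Union>b\<in>{b \<in> {1..m}. s b > 0 \<and> R b \<in> T}. REP b))"

end

theory Submission
  imports Defs
begin

text \<open>The expected symmetric difference is a pseudometric in the inputs, so it suffices to raise a single
  coordinate \<open>j\<close> by \<open>\<delta>\<close> (any two inputs are joined through their pointwise minimum).
  The status of \<open>j\<close> (small or large) changes with probability at most \<open>10\<delta>\<close> over \<open>\<sigma>\<close>, and a bucket
  load crosses \<open>1 - \<tau>\<close> with probability at most \<open>10\<delta>\<close> over \<open>\<tau>\<close>. Independently of both, a slot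
  collision has probability \<open>O(1/m)\<close>, and an overflowing bucket, which contains many pairs of small
  elements, has probability \<open>O(k\<^sup>2/m)\<close>. Since \<open>m \<ge> 32 k\<^sup>5 \<alpha>\<^sup>5\<close>, this pays both for the factor \<open>\<alpha>\<close> when
  both inputs use the given algorithm and for the trivial bound \<open>2k\<close> when only one of them does.

  In the main case the input of the tree sampler moves by \<open>\<delta>\<close>, or by \<open>O(1)\<close> if \<open>j\<close> changes its status,
  and the representative of the bucket of \<open>j\<close>, of load \<open>s\<close>, changes with probability at most \<open>\<delta>/s\<close>, which
  matters only if its slot is selected, an event of probability \<open>s\<close>.

  Tree pivotal sampling is \<open>O(depth)\<close>-stretch: read top-down, it decides for every subtree whether the
  number of selected leaves is the sum of the values rounded down or up. Raising one leaf raises the counts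
  on its path monotonically, and by the marginal property each of them by \<open>\<delta>\<close> in expectation; the counts of
  the subtrees hanging off the path are differences of counts on the path.\<close>

subsection \<open>Tree pivotal sampling as a top-down process\<close>

text \<open>The logarithm is the depth of the tree: it has \<open>num_slots k \<alpha>\<close>
  leaves, a number polynomial in k and \<alpha>, so its depth is O(log k + log \<alpha>). This
  estimate rests on \<alpha> \<ge> 1, which the size and distance conditions force; it also gives m
  \<ge> 32. The obstacle is that the rare events share their randomness: the set of large elements
  depends on \<sigma>, the loads on \<sigma> and \<beta>, and the point where a load crosses 1 -
  \<tau> on all of these. To multiply the probability of a status change or of a crossing by that of
  a collision or an overflow, the latter two are replaced by majorants that are free of both shifts:
  \<open>collision_count\<close> runs over all elements above 1/10 and \<open>pair_mass\<close> over
  all pairs of elements. For fixed R, C, \<beta> these are constants while \<tau> and then \<sigma>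
  are averaged, and only afterwards is their own expectation taken.\<close>

text \<open>The leaf passed up by \<open>t\<close> is random, but its value \<open>tree_val t z\<close> is not; \<open>tree_base t z\<close> is the number
  of leaves already fixed to 1. In \<open>tree_out \<theta> t z \<beta>\<close> the bit \<open>\<beta>\<close> is the final value of the leaf passed up.\<close>

primrec tree_val :: "btree \<Rightarrow> (nat \<Rightarrow> real) \<Rightarrow> real" where
  "tree_val (Leaf i) z = z i"
| "tree_val (Node l r) z =
     (let s = tree_val l z + tree_val r z in if s \<le> 1 then s else s - 1)"

primrec tree_base :: "btree \<Rightarrow> (nat \<Rightarrow> real) \<Rightarrow> nat" where
  "tree_base (Leaf i) z = 0"
| "tree_base (Node l r) z =
     tree_base l z + tree_base r z + (if tree_val l z + tree_val r z \<le> 1 then 0 else 1)"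

text \<open>In both regimes this is the probability that the left child wins: it takes the whole
  mass if the sum is at most 1, and the fixed 1 otherwise. The common reading allows one
  monotonicity statement across the regimes.\<close>

definition threshold :: "real \<Rightarrow> real \<Rightarrow> real" where
  "threshold a b = (if a + b \<le> 1 then a / (a + b) else (1 - b) / (2 - a - b))"

text \<open>If the sum is at most 1, the loser is fixed to 0 and the winner inherits
  \<open>\<beta>\<close>, a conjunction. Otherwise the winner is fixed to 1 and the loser inherits
  \<open>\<beta>\<close>, a disjunction.\<close>

definition left_bit :: "real \<Rightarrow> real \<Rightarrow> real \<Rightarrow> bool \<Rightarrow> bool" where
  "left_bit a b u \<beta> = (if a + b \<le> 1 then \<beta> \<and> u \<le> threshold a b else \<beta> \<or> u \<le> threshold a b)"

definition right_bit :: "real \<Rightarrow> real \<Rightarrow> real \<Rightarrow> bool \<Rightarrow> bool" where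
  "right_bit a b u \<beta> = (if a + b \<le> 1 then \<beta> \<and> \<not> u \<le> threshold a b else \<beta> \<or> \<not> u \<le> threshold a b)"

primrec tree_out :: "(bool list \<Rightarrow> real) \<Rightarrow> btree \<Rightarrow> (nat \<Rightarrow> real) \<Rightarrow> bool \<Rightarrow> nat set" where
  "tree_out \<theta> (Leaf i) z \<beta> = (if \<beta> then {i} else {})"
| "tree_out \<theta> (Node l r) z \<beta> =
     tree_out (\<lambda>p. \<theta> (False # p)) l z (left_bit (tree_val l z) (tree_val r z) (\<theta> []) \<beta>) \<union>
     tree_out (\<lambda>p. \<theta> (True # p)) r z (right_bit (tree_val l z) (tree_val r z) (\<theta> []) \<beta>)"

lemma tree_val_cong: "(\<And>c. c \<in> set (leaves t) \<Longrightarrow> z c = z' c) \<Longrightarrow> tree_val t z = tree_val t z'"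
  by (induction t) (auto simp: Let_def)

lemma tree_base_cong: "(\<And>c. c \<in> set (leaves t) \<Longrightarrow> z c = z' c) \<Longrightarrow> tree_base t z = tree_base t z'"
proof (induction t)
  case (Node l r)
  have "tree_val l z = tree_val l z'" "tree_val r z = tree_val r z'"
    using Node.prems by (auto intro!: tree_val_cong)
  with Node show ?case by auto
qed auto

lemma tree_out_cong:
  "(\<And>c. c \<in> set (leaves t) \<Longrightarrow> z c = z' c) \<Longrightarrow> tree_out \<theta> t z \<beta> = tree_out \<theta> t z' \<beta>"
proof (induction t arbitrary: \<theta> \<beta>)
  case (Node l r)
  have "tree_val l z = tree_val l z'" "tree_val r z = tree_val r z'"
    using Node.prems by (auto intro!: tree_val_cong)
  moreover have "tree_out \<theta> l z \<beta> = tree_out \<theta> l z' \<beta>" "tree_out \<theta> r z \<beta> = tree_out \<theta> r z' \<beta>" for \<theta> \<beta>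
    using Node by auto
  ultimately show ?case by simp
qed auto

lemma tree_out_subset: "tree_out \<theta> t z \<beta> \<subseteq> set (leaves t)"
proof (induction t arbitrary: \<theta> \<beta>)
  case (Node l r)
  then show ?case unfolding tree_out.simps leaves.simps set_append by (intro Un_mono)
qed auto

lemma finite_tree_out [simp]: "finite (tree_out \<theta> t z \<beta>)"
  by (rule finite_subset[OF tree_out_subset]) simp

lemma tree_val_range:
  "z ` set (leaves t) \<subseteq> {0..1} \<Longrightarrow> 0 \<le> tree_val t z \<and> tree_val t z \<le> 1"
  by (induction t) (auto simp: Let_def image_subset_iff)

text \<open>A node either keeps its sum or splits off a fixed 1, so mass is conserved. For values in
  [0,1], \<open>tree_val\<close> is thus the fractional part of the sum, except that a positive
  integer sum has the value 1.\<close>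

lemma tree_base_val_sum:
  "distinct (leaves t) \<Longrightarrow> real (tree_base t z) + tree_val t z = (\<Sum>c\<in>set (leaves t). z c)"
proof (induction t)
  case (Node l r)
  have "(\<Sum>c\<in>set (leaves (Node l r)). z c) = (\<Sum>c\<in>set (leaves l). z c) + (\<Sum>c\<in>set (leaves r). z c)"
    using Node.prems by (simp add: sum.union_disjoint)
  with Node show ?case by (auto simp: Let_def)
qed auto

text \<open>The test \<open>s \<le> 1\<close> keeps a sum equal to 1 whole, so the value 0 arises
  only if both children have the value 0. This removes the ambiguity between base 1 with value 0 and
  base 0 with value 1.\<close>

lemma tree_val_zero:
  "z ` set (leaves t) \<subseteq> {0..1} \<Longrightarrow> tree_val t z = 0 \<Longrightarrow> tree_base t z = 0"
proof (induction t)
  case (Node l r)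
  have "0 \<le> tree_val l z" "0 \<le> tree_val r z"
    using Node.prems tree_val_range[of z l] tree_val_range[of z r] by auto
  with Node show ?case by (auto simp: Let_def split: if_splits)
qed auto

lemma bits_sum:
  "of_bool (left_bit a b u \<beta>) + of_bool (right_bit a b u \<beta>) =
     of_bool \<beta> + (if a + b \<le> 1 then 0 else (1::nat))"
  by (auto simp: left_bit_def right_bit_def)

text \<open>By \<open>bits_sum\<close> each node hands down exactly its own bit plus the 1 it may
  have fixed, so the size depends on the randomness through \<open>\<beta>\<close> only.\<close>

lemma card_tree_out:
  "distinct (leaves t) \<Longrightarrow> card (tree_out \<theta> t z \<beta>) = tree_base t z + of_bool \<beta>"
proof (induction t arbitrary: \<theta> \<beta>)
  case (Node l r)
  let ?A = "tree_out (\<lambda>p. \<theta> (False # p)) l z (left_bit (tree_val l z) (tree_val r z) (\<theta> []) \<beta>)"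
  let ?B = "tree_out (\<lambda>p. \<theta> (True # p)) r z (right_bit (tree_val l z) (tree_val r z) (\<theta> []) \<beta>)"
  have "?A \<inter> ?B = {}"
    using tree_out_subset Node.prems by fastforce
  then have "card (?A \<union> ?B) = card ?A + card ?B"
    by (simp add: card_Un_disjoint)
  with Node bits_sum[of "tree_val l z" "tree_val r z" "\<theta> []" \<beta>] show ?case
    by auto
qed auto

section \<open>Monotonicity of thresholds and bits\<close>

lemma threshold_range:
  assumes "0 \<le> a" "a \<le> 1" "0 \<le> b" "b \<le> 1"
  shows "0 \<le> threshold a b" "threshold a b \<le> 1"
  using assms by (auto simp: threshold_def divide_simps)

lemma threshold_mono_left:
  assumes "0 \<le> a" "a \<le> a'" "a' \<le> 1" "0 \<le> b" "b \<le> 1"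
  shows "threshold a b \<le> threshold a' b"
proof -
  consider "a' + b \<le> 1" | "a + b \<le> 1" "a' + b > 1" | "a + b > 1" using assms by linarith
  then show ?thesis
  proof cases
    case 1
    show ?thesis
    proof (cases "a + b = 0")
      case True then show ?thesis using assms 1 by (auto simp: threshold_def)
    next
      case False
      have "a * b \<le> a' * b" using assms by (simp add: mult_right_mono)
      then show ?thesis using assms 1 False by (simp add: threshold_def divide_simps) (simp add: algebra_simps)
    qed
  next
    case 2
    \<comment> \<open>Both formulas take the value 1 - b where the sum is exactly 1, so the crossing
      case goes through this common value.\<close>
    have "a / (a + b) \<le> 1 - b"
    proof (cases "a + b = 0")
      case True then show ?thesis using assms by auto
    next
      case False
      have "b * (1 - (a + b)) \<ge> 0" using assms 2 by (intro mult_nonneg_nonneg) auto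
      then show ?thesis using False assms by (simp add: divide_simps) (simp add: algebra_simps)
    qed
    also have "1 - b \<le> (1 - b) / (2 - a' - b)"
    proof (cases "2 - a' - b = 0")
      case True then have "b = 1" using assms by auto
      then show ?thesis by auto
    next
      case False
      then have "2 - a' - b > 0" "2 - a' - b \<le> 1" using 2 assms by auto
      then show ?thesis using assms by (simp add: pos_le_divide_eq mult_left_le)
    qed
    finally show ?thesis using 2 by (simp add: threshold_def)
  next
    case 3
    show ?thesis
    proof (cases "2 - a' - b = 0")
      case True then have "b = 1" using assms by auto
      then show ?thesis using 3 assms by (auto simp: threshold_def)
    next
      case False
      then have "2 - a' - b > 0" using assms by auto
      moreover have "2 - a - b \<ge> 2 - a' - b" using assms by auto
      ultimately show ?thesis using 3 assms by (auto simp: threshold_def intro!: divide_left_mono mult_pos_pos)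
    qed
  qed
qed

lemma threshold_swap:
  assumes "0 \<le> a" "a \<le> 1" "0 \<le> b" "b \<le> 1" "a + b \<noteq> 0" "a + b \<noteq> 2"
  shows "threshold b a = 1 - threshold a b"
proof (cases "a + b \<le> 1")
  case True
  have "b / (a + b) + a / (a + b) = 1"
    using assms by (simp add: add_divide_distrib[symmetric] add.commute)
  then show ?thesis using True by (simp add: threshold_def add.commute)
next
  case False
  have "(1 - a) / (2 - a - b) + (1 - b) / (2 - a - b) = 1"
    using assms by (simp add: add_divide_distrib[symmetric])
  moreover have "2 - b - a = 2 - a - b" by simp
  ultimately show ?thesis using False by (simp only: threshold_def add.commute) simp
qed

text \<open>The mirror image of \<open>threshold_mono_left\<close> under
  \<open>threshold_swap\<close>. The convention 0 / 0 = 0 breaks the reflection in two corners;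
  there \<open>threshold a b'\<close> is 0 and the claim is trivial.\<close>

lemma threshold_antimono_right:
  assumes "0 \<le> b" "b \<le> b'" "b' \<le> 1" "0 \<le> a" "a \<le> 1"
  shows "threshold a b' \<le> threshold a b"
proof (cases "a + b = 0 \<or> a + b' = 2")
  case True
  then have "threshold a b' = 0" using assms by (auto simp: threshold_def)
  then show ?thesis using threshold_range assms by auto
next
  case False
  have "threshold a b' = 1 - threshold b' a" "threshold a b = 1 - threshold b a"
    using False assms by (auto intro!: threshold_swap simp: add.commute)
  with threshold_mono_left[of b b' a] assms show ?thesis by auto
qed

text \<open>When the sum crosses 1, the conjunction turns into a disjunction: the old bit requires a
  win of the left child and the new one follows from it. Hence the bits have to be comparable only
  within one regime.\<close>

lemma left_bit_mono:
  assumes "0 \<le> a" "a \<le> a'" "a' \<le> 1" "0 \<le> b" "b \<le> 1"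
    and "a' + b \<le> 1 \<or> a + b > 1 \<Longrightarrow> \<beta> \<le> \<beta>'"
  shows "left_bit a b u \<beta> \<le> left_bit a' b u \<beta>'"
proof -
  have "threshold a b \<le> threshold a' b" using assms(1-5) by (rule threshold_mono_left)
  then show ?thesis using assms by (auto simp: left_bit_def)
qed

lemma right_bit_mono:
  assumes "0 \<le> b" "b \<le> b'" "b' \<le> 1" "0 \<le> a" "a \<le> 1"
    and "a + b' \<le> 1 \<or> a + b > 1 \<Longrightarrow> \<beta> \<le> \<beta>'"
  shows "right_bit a b u \<beta> \<le> right_bit a b' u \<beta>'"
proof -
  have "threshold a b' \<le> threshold a b" using assms(1-5) by (rule threshold_antimono_right)
  then show ?thesis using assms by (auto simp: right_bit_def)
qed

text \<open>A failure with \<open>A' < A\<close> would force \<open>a = 0\<close> and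
  \<open>a' = 1\<close>, and then the last hypothesis gives \<open>A = 0\<close>, a
  contradiction.\<close>

lemma base_val_cases:
  assumes "real A + a \<le> real A' + a'" "0 \<le> a" "a \<le> 1" "0 \<le> a'" "a' \<le> 1" "a = 0 \<Longrightarrow> A = 0"
  shows "A < A' \<or> (A = A' \<and> a \<le> a')"
proof (cases "A' < A")
  case True
  then have "real A' + 1 \<le> real A" by auto
  with assms True show ?thesis by auto
next
  case False
  with assms show ?thesis by (cases "A = A'") auto
qed

definition tree_count :: "btree \<Rightarrow> (nat \<Rightarrow> real) \<Rightarrow> bool \<Rightarrow> nat" where
  "tree_count t z \<beta> = tree_base t z + of_bool \<beta>"

text \<open>Counts are compared rather than bits: when the sum at a node passes an integer, the bit of the node
  drops while its count does not.\<close>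

lemma tree_count_left_mono:
  assumes z: "z ` set (leaves (Node l r)) \<subseteq> {0..1}" "z' ` set (leaves (Node l r)) \<subseteq> {0..1}"
    and dist: "distinct (leaves (Node l r))"
    and le: "(\<Sum>c\<in>set (leaves l). z c) \<le> (\<Sum>c\<in>set (leaves l). z' c)"
    and eq: "\<And>c. c \<in> set (leaves r) \<Longrightarrow> z c = z' c"
    and N: "tree_count (Node l r) z \<beta> \<le> tree_count (Node l r) z' \<beta>'"
  shows "tree_count l z (left_bit (tree_val l z) (tree_val r z) u \<beta>)
       \<le> tree_count l z' (left_bit (tree_val l z') (tree_val r z') u \<beta>')"
proof -
  have v: "tree_val r z' = tree_val r z" "tree_base r z' = tree_base r z"
    using eq tree_val_cong[of r z z'] tree_base_cong[of r z z'] by auto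
  have rg: "0 \<le> tree_val l z" "tree_val l z \<le> 1" "0 \<le> tree_val l z'" "tree_val l z' \<le> 1"
       "0 \<le> tree_val r z" "tree_val r z \<le> 1"
    using tree_val_range[of z l] tree_val_range[of z' l] tree_val_range[of z r] z by auto
  have "tree_base l z < tree_base l z' \<or> tree_base l z = tree_base l z' \<and> tree_val l z \<le> tree_val l z'"
  proof (rule base_val_cases)
    show "real (tree_base l z) + tree_val l z \<le> real (tree_base l z') + tree_val l z'"
      using le dist by (simp add: tree_base_val_sum)
    show "tree_val l z = 0 \<Longrightarrow> tree_base l z = 0" using z by (intro tree_val_zero) auto
  qed (use rg in auto)
  then show ?thesis
  proof
    \<comment> \<open>A larger base absorbs any drop of the bit, which is worth at most 1.\<close>
    assume "tree_base l z < tree_base l z'"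
    then show ?thesis by (auto simp: tree_count_def of_bool_def)
  next
    assume *: "tree_base l z = tree_base l z' \<and> tree_val l z \<le> tree_val l z'"
    have "left_bit (tree_val l z) (tree_val r z) u \<beta> \<le> left_bit (tree_val l z') (tree_val r z) u \<beta>'"
      using * rg N v by (intro left_bit_mono) (auto simp: tree_count_def split: if_splits)
    with * v show ?thesis by (auto simp: tree_count_def)
  qed
qed

lemma tree_count_right_mono:
  assumes z: "z ` set (leaves (Node l r)) \<subseteq> {0..1}" "z' ` set (leaves (Node l r)) \<subseteq> {0..1}"
    and dist: "distinct (leaves (Node l r))"
    and le: "(\<Sum>c\<in>set (leaves r). z c) \<le> (\<Sum>c\<in>set (leaves r). z' c)"
    and eq: "\<And>c. c \<in> set (leaves l) \<Longrightarrow> z c = z' c"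
    and N: "tree_count (Node l r) z \<beta> \<le> tree_count (Node l r) z' \<beta>'"
  shows "tree_count r z (right_bit (tree_val l z) (tree_val r z) u \<beta>)
       \<le> tree_count r z' (right_bit (tree_val l z') (tree_val r z') u \<beta>')"
proof -
  have v: "tree_val l z' = tree_val l z" "tree_base l z' = tree_base l z"
    using eq tree_val_cong[of l z z'] tree_base_cong[of l z z'] by auto
  have rg: "0 \<le> tree_val l z" "tree_val l z \<le> 1" "0 \<le> tree_val r z'" "tree_val r z' \<le> 1"
       "0 \<le> tree_val r z" "tree_val r z \<le> 1"
    using tree_val_range[of z l] tree_val_range[of z' r] tree_val_range[of z r] z by auto
  have "tree_base r z < tree_base r z' \<or> tree_base r z = tree_base r z' \<and> tree_val r z \<le> tree_val r z'"
  proof (rule base_val_cases)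
    show "real (tree_base r z) + tree_val r z \<le> real (tree_base r z') + tree_val r z'"
      using le dist by (simp add: tree_base_val_sum)
    show "tree_val r z = 0 \<Longrightarrow> tree_base r z = 0" using z by (intro tree_val_zero) auto
  qed (use rg in auto)
  then show ?thesis
  proof
    assume "tree_base r z < tree_base r z'"
    then show ?thesis by (auto simp: tree_count_def of_bool_def)
  next
    assume *: "tree_base r z = tree_base r z' \<and> tree_val r z \<le> tree_val r z'"
    have "right_bit (tree_val l z) (tree_val r z) u \<beta> \<le> right_bit (tree_val l z) (tree_val r z') u \<beta>'"
      using * rg N v by (intro right_bit_mono) (auto simp: tree_count_def split: if_splits)
    with * v show ?thesis by (auto simp: tree_count_def)
  qed
qed

text \<open>With equal values and equal \<theta>, exactly one child of each node inherits a
  difference of the bits: the winner if the sum is at most 1, the loser otherwise. The difference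
  travels down a single path and reaches a single leaf.\<close>

lemma card_sym_diff_tree_out_bits:
  assumes "distinct (leaves t)"
  shows "card (sym_diff (tree_out \<theta> t z \<beta>) (tree_out \<theta> t z \<beta>')) = of_bool (\<beta> \<noteq> \<beta>')"
  using assms
proof (induction t arbitrary: \<theta> \<beta> \<beta>')
  case (Node l r)
  define a b q where "a = tree_val l z" and "b = tree_val r z" and "q = threshold a b"
  let ?A = "\<lambda>\<beta>. tree_out (\<lambda>p. \<theta> (False # p)) l z (left_bit a b (\<theta> []) \<beta>)"
  let ?B = "\<lambda>\<beta>. tree_out (\<lambda>p. \<theta> (True # p)) r z (right_bit a b (\<theta> []) \<beta>)"
  have sub: "?A \<beta> \<subseteq> set (leaves l)" "?B \<beta> \<subseteq> set (leaves r)" for \<beta>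
    by (rule tree_out_subset)+
  have "sym_diff (?A \<beta> \<union> ?B \<beta>) (?A \<beta>' \<union> ?B \<beta>') = sym_diff (?A \<beta>) (?A \<beta>') \<union> sym_diff (?B \<beta>) (?B \<beta>')"
    using sub[of \<beta>] sub[of \<beta>'] Node.prems by auto
  moreover have "sym_diff (?A \<beta>) (?A \<beta>') \<inter> sym_diff (?B \<beta>) (?B \<beta>') = {}"
    using sub[of \<beta>] sub[of \<beta>'] Node.prems by auto
  ultimately have "card (sym_diff (?A \<beta> \<union> ?B \<beta>) (?A \<beta>' \<union> ?B \<beta>'))
      = card (sym_diff (?A \<beta>) (?A \<beta>')) + card (sym_diff (?B \<beta>) (?B \<beta>'))"
    by (simp add: card_Un_disjoint)
  also have "\<dots> = of_bool (left_bit a b (\<theta> []) \<beta> \<noteq> left_bit a b (\<theta> []) \<beta>')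
                + of_bool (right_bit a b (\<theta> []) \<beta> \<noteq> right_bit a b (\<theta> []) \<beta>')"
    using Node by simp
  also have "\<dots> = of_bool (\<beta> \<noteq> \<beta>')"
    by (auto simp: left_bit_def right_bit_def)
  finally show ?case by (simp add: a_def b_def)
qed auto

text \<open>The root is left out: in the bound below its count has the coefficient 1, while the
  counts of these sets have the coefficient 2.\<close>

primrec below_path :: "btree \<Rightarrow> nat \<Rightarrow> nat set list" where
  "below_path (Leaf i) c = []"
| "below_path (Node l r) c =
     (if c \<in> set (leaves l) then set (leaves l) # below_path l c
      else set (leaves r) # below_path r c)"

lemma length_below_path: "length (below_path t c) \<le> depth t"
  by (induction t) auto

lemma below_path_subset: "U \<in> set (below_path t c) \<Longrightarrow> U \<subseteq> set (leaves t)"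
  by (induction t) (auto split: if_splits)

lemma below_path_mem: "c \<in> set (leaves t) \<Longrightarrow> U \<in> set (below_path t c) \<Longrightarrow> c \<in> U"
  by (induction t) (auto split: if_splits)

text \<open>Let N be the increase of the count at a node and M \<ge> 0 that at its child on the
  path. The sibling sees equal values, so it changes by |N - M| \<le> N + M leaves; the child itself
  contributes M plus its own sum by induction. The total is N + 2M plus the sum, which explains the
  factor 2.\<close>

lemma card_sym_diff_tree_out:
  assumes "distinct (leaves t)" "c \<in> set (leaves t)" "z c \<le> v" "v \<le> 1"
    and "z ` set (leaves t) \<subseteq> {0..1}"
    and "tree_count t z \<beta> \<le> tree_count t (z(c := v)) \<beta>'"
  shows "int (card (sym_diff (tree_out \<theta> t z \<beta>) (tree_out \<theta> t (z(c := v)) \<beta>')))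
     \<le> int (card (tree_out \<theta> t (z(c := v)) \<beta>')) - int (card (tree_out \<theta> t z \<beta>))
     + 2 * (\<Sum>U\<leftarrow>below_path t c. int (card (tree_out \<theta> t (z(c := v)) \<beta>' \<inter> U))
         - int (card (tree_out \<theta> t z \<beta> \<inter> U)))"
  using assms
proof (induction t arbitrary: \<theta> \<beta> \<beta>')
  case (Leaf i)
  then show ?case by (auto simp: tree_count_def)
next
  case (Node l r)
  define z' where "z' = z(c := v)"
  have z': "z' ` set (leaves (Node l r)) \<subseteq> {0..1}"
  proof -
    have "0 \<le> z c" using Node.prems by (auto simp: image_subset_iff)
    then have "0 \<le> v" using Node.prems by linarith
    then show ?thesis using Node.prems unfolding z'_def by (auto simp: image_subset_iff)
  qed
  define bl br where "bl = left_bit (tree_val l z) (tree_val r z) (\<theta> []) \<beta>"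
    and "br = right_bit (tree_val l z) (tree_val r z) (\<theta> []) \<beta>"
  define bl' br' where "bl' = left_bit (tree_val l z') (tree_val r z') (\<theta> []) \<beta>'"
    and "br' = right_bit (tree_val l z') (tree_val r z') (\<theta> []) \<beta>'"
  define A B where "A = tree_out (\<lambda>p. \<theta> (False # p)) l z bl" and "B = tree_out (\<lambda>p. \<theta> (True # p)) r z br"
  define A' B' where "A' = tree_out (\<lambda>p. \<theta> (False # p)) l z' bl'" and "B' = tree_out (\<lambda>p. \<theta> (True # p)) r z' br'"
  have out: "tree_out \<theta> (Node l r) z \<beta> = A \<union> B" "tree_out \<theta> (Node l r) z' \<beta>' = A' \<union> B'"
    by (simp_all add: A_def B_def A'_def B'_def bl_def br_def bl'_def br'_def)
  have dist: "distinct (leaves l)" "distinct (leaves r)" "set (leaves l) \<inter> set (leaves r) = {}"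
    using Node.prems by auto
  have sub: "A \<subseteq> set (leaves l)" "A' \<subseteq> set (leaves l)" "B \<subseteq> set (leaves r)" "B' \<subseteq> set (leaves r)"
    unfolding A_def A'_def B_def B'_def by (rule tree_out_subset)+
  have fin: "finite A" "finite A'" "finite B" "finite B'"
    unfolding A_def A'_def B_def B'_def by auto
  have "sym_diff (A \<union> B) (A' \<union> B') = sym_diff A A' \<union> sym_diff B B'"
    using sub dist by auto
  moreover have "sym_diff A A' \<inter> sym_diff B B' = {}"
    using sub dist by auto
  ultimately have sd: "card (sym_diff (A \<union> B) (A' \<union> B')) = card (sym_diff A A') + card (sym_diff B B')"
    using fin by (simp add: card_Un_disjoint)
  have "A \<inter> B = {}" "A' \<inter> B' = {}" using sub dist by auto
  then have cu: "card (A \<union> B) = card A + card B" "card (A' \<union> B') = card A' + card B'"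
    using fin by (simp_all add: card_Un_disjoint)
  have N: "card (A \<union> B) \<le> card (A' \<union> B')"
    using Node.prems(6) unfolding out[symmetric] z'_def card_tree_out[OF Node.prems(1)] tree_count_def .
  have cA: "card A = tree_count l z bl" "card A' = tree_count l z' bl'"
    "card B = tree_count r z br" "card B' = tree_count r z' br'"
    using dist by (simp_all add: A_def A'_def B_def B'_def card_tree_out tree_count_def)
  have "int (card (sym_diff (A \<union> B) (A' \<union> B'))) \<le> int (card (A' \<union> B')) - int (card (A \<union> B))
     + 2 * (\<Sum>U\<leftarrow>below_path (Node l r) c. int (card ((A' \<union> B') \<inter> U)) - int (card ((A \<union> B) \<inter> U)))"
  proof (cases "c \<in> set (leaves l)")
    case True
    then have cr: "c \<notin> set (leaves r)" using dist by auto
    have eq: "z x = z' x" if "x \<in> set (leaves r)" for x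
      using that cr by (auto simp: z'_def)
    have "tree_out (\<lambda>p. \<theta> (True # p)) r z br = tree_out (\<lambda>p. \<theta> (True # p)) r z' br"
      using eq by (intro tree_out_cong) auto
    then have sB: "card (sym_diff B B') = of_bool (br \<noteq> br')"
      unfolding B_def B'_def using dist by (simp add: card_sym_diff_tree_out_bits)
    have "tree_base r z = tree_base r z'" using eq by (intro tree_base_cong) auto
    then have sB2: "int (card (sym_diff B B')) = \<bar>int (card B') - int (card B)\<bar>"
      unfolding sB cA tree_count_def by auto
    have le: "(\<Sum>c\<in>set (leaves l). z c) \<le> (\<Sum>c\<in>set (leaves l). z' c)"
      using Node.prems by (intro sum_mono) (auto simp: z'_def)
    have NA: "card A \<le> card A'"
      unfolding cA bl_def bl'_def
      by (rule tree_count_left_mono[OF Node.prems(5) z' Node.prems(1) le eq Node.prems(6)[folded z'_def]])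
    have IH: "int (card (sym_diff A A')) \<le> int (card A') - int (card A)
     + 2 * (\<Sum>U\<leftarrow>below_path l c. int (card (A' \<inter> U)) - int (card (A \<inter> U)))"
      unfolding A_def A'_def z'_def
      by (rule Node.IH(1)[OF dist(1) True Node.prems(3,4) _ NA[unfolded cA z'_def]])
         (use Node.prems(5) in auto)
    have eqU: "(A' \<union> B') \<inter> U = A' \<inter> U" "(A \<union> B) \<inter> U = A \<inter> U" if "U \<subseteq> set (leaves l)" for U
      using that sub dist by auto
    have "(\<Sum>U\<leftarrow>below_path (Node l r) c. int (card ((A' \<union> B') \<inter> U)) - int (card ((A \<union> B) \<inter> U)))
       = (int (card A') - int (card A)) + (\<Sum>U\<leftarrow>below_path l c. int (card (A' \<inter> U)) - int (card (A \<inter> U)))"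
      using True sub by (auto simp: eqU below_path_subset Int_absorb2 cong: map_cong)
    with IH sB2 sd cu N NA show ?thesis by simp
  next
    case False
    then have cr: "c \<in> set (leaves r)" using Node.prems by auto
    have eq: "z x = z' x" if "x \<in> set (leaves l)" for x
      using that False by (auto simp: z'_def)
    have "tree_out (\<lambda>p. \<theta> (False # p)) l z bl = tree_out (\<lambda>p. \<theta> (False # p)) l z' bl"
      using eq by (intro tree_out_cong) auto
    then have sB: "card (sym_diff A A') = of_bool (bl \<noteq> bl')"
      unfolding A_def A'_def using dist by (simp add: card_sym_diff_tree_out_bits)
    have "tree_base l z = tree_base l z'" using eq by (intro tree_base_cong) auto
    then have sB2: "int (card (sym_diff A A')) = \<bar>int (card A') - int (card A)\<bar>"
      unfolding sB cA tree_count_def by auto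
    have le: "(\<Sum>c\<in>set (leaves r). z c) \<le> (\<Sum>c\<in>set (leaves r). z' c)"
      using Node.prems by (intro sum_mono) (auto simp: z'_def)
    have NA: "card B \<le> card B'"
      unfolding cA br_def br'_def
      by (rule tree_count_right_mono[OF Node.prems(5) z' Node.prems(1) le eq Node.prems(6)[folded z'_def]])
    have IH: "int (card (sym_diff B B')) \<le> int (card B') - int (card B)
     + 2 * (\<Sum>U\<leftarrow>below_path r c. int (card (B' \<inter> U)) - int (card (B \<inter> U)))"
      unfolding B_def B'_def z'_def
      by (rule Node.IH(2)[OF dist(2) cr Node.prems(3,4) _ NA[unfolded cA z'_def]])
         (use Node.prems(5) in auto)
    have eqU: "(A' \<union> B') \<inter> U = B' \<inter> U" "(A \<union> B) \<inter> U = B \<inter> U" if "U \<subseteq> set (leaves r)" for U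
      using that sub dist by auto
    have "(\<Sum>U\<leftarrow>below_path (Node l r) c. int (card ((A' \<union> B') \<inter> U)) - int (card ((A \<union> B) \<inter> U)))
       = (int (card B') - int (card B)) + (\<Sum>U\<leftarrow>below_path r c. int (card (B' \<inter> U)) - int (card (B \<inter> U)))"
      using False sub by (auto simp: eqU below_path_subset Int_absorb2 cong: map_cong)
    with IH sB2 sd cu N NA show ?thesis by simp
  qed
  then show ?case unfolding out[symmetric] z'_def .
qed

text \<open>The statement is about every bit \<open>\<beta>\<close> because the leaf passed up by a
  child may be fixed at its parent or stay undecided. In either case \<open>left_bit\<close> and
  \<open>right_bit\<close> say which final value each child has to be instantiated with.\<close>

lemma pass_up_tree_out:
  assumes "distinct (leaves t)" "pass_up \<theta> t v = (i, w)"
  shows "i \<in> set (leaves t)" "w i = tree_val t v" "\<And>c. c \<notin> set (leaves t) \<Longrightarrow> w c = v c"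
    "\<And>\<beta>. {c \<in> set (leaves t). (w(i := of_bool \<beta>)) c = 1} = tree_out \<theta> t v \<beta>"
proof -
  have "i \<in> set (leaves t) \<and> w i = tree_val t v \<and> (\<forall>c. c \<notin> set (leaves t) \<longrightarrow> w c = v c) \<and>
    (\<forall>\<beta>. {c \<in> set (leaves t). (w(i := of_bool \<beta>)) c = 1} = tree_out \<theta> t v \<beta>)"
    using assms
  proof (induction t arbitrary: \<theta> v i w)
    case (Node l r)
    obtain i1 v1 where L: "pass_up (\<lambda>p. \<theta> (False # p)) l v = (i1, v1)" by force
    obtain i2 v2 where R: "pass_up (\<lambda>p. \<theta> (True # p)) r v1 = (i2, v2)" by force
    have dist: "distinct (leaves l)" "distinct (leaves r)" "set (leaves l) \<inter> set (leaves r) = {}"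
      using Node.prems by auto
    note IL = Node.IH(1)[OF dist(1) L] and IR = Node.IH(2)[OF dist(2) R]
    have eq: "v1 c = v c" if "c \<in> set (leaves r)" for c using that dist IL by auto
    have vr: "tree_val r v1 = tree_val r v" "tree_out \<theta>' r v1 \<beta> = tree_out \<theta>' r v \<beta>" for \<theta>' \<beta>
      using eq by (auto intro!: tree_val_cong tree_out_cong)
    define a b where "a = tree_val l v" and "b = tree_val r v"
    have mem: "i1 \<in> set (leaves l)" "i2 \<in> set (leaves r)" "i1 \<notin> set (leaves r)" "i2 \<notin> set (leaves l)" "i1 \<noteq> i2"
      using IL IR dist by auto
    have ab: "v2 i1 = a" "v2 i2 = b"
      using IL IR mem vr by (auto simp: a_def b_def)
    have v2l: "v2 c = v1 c" if "c \<in> set (leaves l)" for c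
      using IR that dist by auto
    have outl: "tree_out (\<lambda>p. \<theta> (False # p)) l v \<beta> = {c \<in> set (leaves l). (v1(i1 := of_bool \<beta>)) c = 1}"
      and outr: "tree_out (\<lambda>p. \<theta> (True # p)) r v \<beta> = {c \<in> set (leaves r). (v2(i2 := of_bool \<beta>)) c = 1}" for \<beta>
      using IL IR vr by auto
    have pu: "pass_up \<theta> (Node l r) v =
      (if a + b \<le> 1 then
          if \<theta> [] \<le> a / (a + b) then (i1, v2(i1 := a + b, i2 := 0))
          else (i2, v2(i1 := 0, i2 := a + b))
        else
          if \<theta> [] \<le> (1 - b) / (2 - a - b) then (i2, v2(i1 := 1, i2 := a + b - 1))
          else (i1, v2(i1 := a + b - 1, i2 := 1)))"
      using L R ab by (simp add: Let_def)
    have merge: "{c \<in> set (leaves (Node l r)). (w(i := of_bool \<beta>)) c = 1} =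
       {c \<in> set (leaves l). (v1(i1 := of_bool b1)) c = 1} \<union> {c \<in> set (leaves r). (v2(i2 := of_bool b2)) c = 1}"
      if "w(i := of_bool \<beta>) = v2(i1 := of_bool b1, i2 := of_bool b2)" for \<beta> b1 b2
      unfolding that using mem dist v2l by auto
    have iw: "i \<in> {i1, i2} \<and> w i = tree_val (Node l r) v \<and> (\<forall>c. c \<notin> {i1, i2} \<longrightarrow> w c = v2 c)"
      using Node.prems(2) mem unfolding pu
      by (auto simp: Let_def a_def[symmetric] b_def[symmetric] split: if_splits)
    have "w(i := of_bool \<beta>) = v2(i1 := of_bool (left_bit a b (\<theta> []) \<beta>), i2 := of_bool (right_bit a b (\<theta> []) \<beta>))" for \<beta>
      using Node.prems(2) mem unfolding pu
      by (auto simp: left_bit_def right_bit_def threshold_def fun_eq_iff split: if_splits)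
    from merge[OF this] have "{c \<in> set (leaves (Node l r)). (w(i := of_bool \<beta>)) c = 1} = tree_out \<theta> (Node l r) v \<beta>" for \<beta>
      by (simp add: outl outr a_def b_def)
    moreover have "w c = v c" if "c \<notin> set (leaves (Node l r))" for c
    proof -
      have "c \<notin> {i1, i2}" using that mem by auto
      then show ?thesis using that iw IL IR by auto
    qed
    ultimately show ?case using mem iw by auto
  qed auto
  then show "i \<in> set (leaves t)" "w i = tree_val t v" "\<And>c. c \<notin> set (leaves t) \<Longrightarrow> w c = v c"
    "\<And>\<beta>. {c \<in> set (leaves t). (w(i := of_bool \<beta>)) c = 1} = tree_out \<theta> t v \<beta>" by auto
qed

lemma tree_sample_eq:
  assumes "distinct (leaves t)"
  shows "tree_sample t \<theta> u z = tree_out \<theta> t z (u < tree_val t z)"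
proof -
  obtain i w where p: "pass_up \<theta> t z = (i, w)" by force
  have "tree_sample t \<theta> u z = {c \<in> set (leaves t). (w(i := of_bool (u < tree_val t z))) c = 1}"
    using pass_up_tree_out(2)[OF assms p] by (simp add: tree_sample_def p of_bool_def)
  then show ?thesis
    using pass_up_tree_out(4)[OF assms p] by simp
qed

subsection \<open>Marginals and stability of tree pivotal sampling\<close>

lemma space_uniform_real [simp]: "space (uniform_real a b) = UNIV"
  and sets_uniform_real [simp, measurable_cong]: "sets (uniform_real a b) = sets borel"
  by (simp_all add: uniform_real_def)

lemma prob_space_uniform_real: "a < b \<Longrightarrow> prob_space (uniform_real a b)"
  unfolding uniform_real_def by (intro prob_space_uniform_measure) auto

lemma AE_uniform_real: "a < b \<Longrightarrow> AE u in uniform_real a b. a \<le> u \<and> u \<le> b"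
  unfolding uniform_real_def by (intro AE_uniform_measureI) auto

lemma emeasure_uniform_real_Icc:
  assumes "a < b" "a \<le> c" "c \<le> d" "d \<le> b"
  shows "emeasure (uniform_real a b) {c..d} = ennreal ((d - c) / (b - a))"
proof -
  have "{a..b} \<inter> {c..d} = {c..d}" using assms by auto
  then show ?thesis using assms
    by (simp add: uniform_real_def divide_ennreal)
qed

lemma emeasure_uniform_real_le:
  assumes "a < b" "c \<le> d" "A \<subseteq> {c..d}"
  shows "emeasure (uniform_real a b) A \<le> ennreal ((d - c) / (b - a))"
proof -
  have "emeasure (uniform_real a b) A \<le> emeasure (uniform_real a b) {c..d}"
    using assms by (intro emeasure_mono) auto
  also have "\<dots> = emeasure lborel ({a..b} \<inter> {c..d}) / ennreal (b - a)"
    using assms by (simp add: uniform_real_def)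
  also have "\<dots> \<le> emeasure lborel {c..d} / ennreal (b - a)"
    by (intro divide_right_mono_ennreal emeasure_mono) auto
  also have "\<dots> = ennreal ((d - c) / (b - a))"
    using assms by (simp add: divide_ennreal)
  finally show ?thesis .
qed

lemma nn_integral_uniform_threshold:
  assumes "0 \<le> q" "q \<le> 1" "0 \<le> A" "0 \<le> B"
  shows "(\<integral>\<^sup>+u. ennreal (if u \<le> q then A else B) \<partial>uniform_real 0 1) = ennreal (q * A + (1 - q) * B)"
proof -
  interpret prob_space "uniform_real 0 1" by (rule prob_space_uniform_real) simp
  have "emeasure (uniform_real 0 1) {..q} = emeasure (uniform_real 0 1) {0..q}"
    using AE_uniform_real[of 0 1] by (intro emeasure_eq_AE) auto
  also have "\<dots> = ennreal q"
    using assms by (simp add: emeasure_uniform_real_Icc)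
  finally have 1: "emeasure (uniform_real 0 1) {..q} = ennreal q" .
  have 2: "emeasure (uniform_real 0 1) {q<..} = ennreal (1 - q)"
    using emeasure_compl[of "{..q}" "uniform_real 0 1"] 1 emeasure_space_1 assms
    by (simp add: Compl_eq_Diff_UNIV[symmetric] ennreal_minus flip: ennreal_1)
  have "(\<integral>\<^sup>+u. ennreal (if u \<le> q then A else B) \<partial>uniform_real 0 1)
      = (\<integral>\<^sup>+u. ennreal A * indicator {..q} u + ennreal B * indicator {q<..} u \<partial>uniform_real 0 1)"
    by (intro nn_integral_cong) (auto split: split_indicator)
  also have "\<dots> = ennreal A * ennreal q + ennreal B * ennreal (1 - q)"
    by (subst nn_integral_add) (auto simp: nn_integral_cmult 1 2)
  finally show ?thesis
    using assms by (simp add: ennreal_mult[symmetric] mult.commute)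
qed

lemma nn_integral_uniform_less:
  assumes "0 \<le> q" "q \<le> 1" "0 \<le> A" "0 \<le> B"
  shows "(\<integral>\<^sup>+u. ennreal (if u < q then A else B) \<partial>uniform_real 0 1) = ennreal (q * A + (1 - q) * B)"
proof -
  have "AE u in lborel. u \<noteq> q"
    by (rule AE_lborel_singleton)
  then have "AE u in uniform_real 0 1. u \<noteq> q"
    unfolding uniform_real_def by (intro AE_uniform_measureI) auto
  then show ?thesis
    unfolding nn_integral_uniform_threshold[OF assms, symmetric]
    by (intro nn_integral_cong_AE) auto
qed

section \<open>Random variables with finitely many values\<close>

lemma measurable_finite_range:
  assumes "finite P" "\<And>\<omega>. \<omega> \<in> space M \<Longrightarrow> F \<omega> \<in> P" "\<And>A. A \<in> P \<Longrightarrow> Measurable.pred M (\<lambda>\<omega>. F \<omega> = A)"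
  shows "F \<in> measurable M (count_space UNIV)"
proof -
  have "F \<in> measurable M (count_space P)"
  proof (subst measurable_count_space_eq2[OF assms(1)], intro conjI ballI funcsetI)
    fix A assume "A \<in> P"
    have "F -` {A} \<inter> space M = {\<omega> \<in> space M. F \<omega> = A}" by auto
    also have "\<dots> \<in> sets M" using assms(3)[OF \<open>A \<in> P\<close>] by measurable
    finally show "F -` {A} \<inter> space M \<in> sets M" .
  qed (use assms(2) in auto)
  from measurable_compose[OF this, of "\<lambda>x. x" "count_space UNIV"] show ?thesis by simp
qed

lemma measurable_set_valued:
  assumes "finite U" "\<And>\<omega>. \<omega> \<in> space M \<Longrightarrow> F \<omega> \<subseteq> U" "\<And>c. c \<in> U \<Longrightarrow> Measurable.pred M (\<lambda>\<omega>. c \<in> F \<omega>)"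
  shows "F \<in> measurable M (count_space UNIV)"
proof (rule measurable_finite_range[of "Pow U"])
  fix A assume A: "A \<in> Pow U"
  have "Measurable.pred M (\<lambda>\<omega>. \<forall>c\<in>U. c \<in> F \<omega> \<longleftrightarrow> c \<in> A)"
    using assms by (intro pred_intros_finite pred_intros_logic) auto
  also have "(\<lambda>\<omega>. \<forall>c\<in>U. c \<in> F \<omega> \<longleftrightarrow> c \<in> A) \<in> measurable M (count_space UNIV) \<longleftrightarrow>
     (\<lambda>\<omega>. F \<omega> = A) \<in> measurable M (count_space UNIV)"
    using A assms(2) by (intro measurable_cong) blast
  finally show "Measurable.pred M (\<lambda>\<omega>. F \<omega> = A)" .
qed (use assms in auto)

text \<open>A product of discrete sigma-algebras on uncountable types need not be discrete, so an
  arbitrary \<open>h\<close> of two random sets is handled through their finite ranges.\<close>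

lemma measurable_pair_finite_range:
  fixes F :: "'a \<Rightarrow> 'b" and G :: "'a \<Rightarrow> 'c" and h :: "'b \<Rightarrow> 'c \<Rightarrow> 'd"
  assumes "F \<in> measurable M (count_space UNIV)" "finite P" "\<And>\<omega>. \<omega> \<in> space M \<Longrightarrow> F \<omega> \<in> P"
    and "G \<in> measurable M (count_space UNIV)" "finite Q" "\<And>\<omega>. \<omega> \<in> space M \<Longrightarrow> G \<omega> \<in> Q"
  shows "(\<lambda>\<omega>. h (F \<omega>) (G \<omega>)) \<in> measurable M (count_space UNIV)"
proof -
  have "(\<lambda>\<omega>. (F \<omega>, G \<omega>)) \<in> measurable M (count_space UNIV)"
  proof (rule measurable_finite_range[of "P \<times> Q"])
    fix AB assume "AB \<in> P \<times> Q"
    note [measurable] = assms(1,4)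
    show "Measurable.pred M (\<lambda>\<omega>. (F \<omega>, G \<omega>) = AB)"
      by (cases AB) (simp, measurable)
  qed (use assms in auto)
  from measurable_compose[OF this, of "\<lambda>(A, B). h A B" "count_space UNIV"] show ?thesis by simp
qed

lemma finite_inner_nodes [simp]: "finite (inner_nodes t)"
  by (induction t) auto

lemma measurable_tree_out:
  assumes "\<And>p. p \<in> inner_nodes t \<Longrightarrow> (\<lambda>\<omega>. \<theta> \<omega> p) \<in> borel_measurable M"
  shows "Measurable.pred M (\<lambda>\<omega>. c \<in> tree_out (\<theta> \<omega>) t z \<beta>)"
  using assms
proof (induction t arbitrary: \<theta> \<beta>)
  case (Node l r)
  have [measurable]: "(\<lambda>\<omega>. \<theta> \<omega> []) \<in> borel_measurable M"
    using Node.prems by auto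
  have [measurable]: "Measurable.pred M (\<lambda>\<omega>. c \<in> tree_out (\<lambda>p. \<theta> \<omega> (False # p)) l z \<beta>)"
    "Measurable.pred M (\<lambda>\<omega>. c \<in> tree_out (\<lambda>p. \<theta> \<omega> (True # p)) r z \<beta>)" for \<beta>
    using Node.prems by (auto intro!: Node.IH)
  have [measurable]: "Measurable.pred M (\<lambda>\<omega>. left_bit a b (\<theta> \<omega> []) \<beta>)"
    "Measurable.pred M (\<lambda>\<omega>. right_bit a b (\<theta> \<omega> []) \<beta>)" for a b \<beta>
    unfolding left_bit_def right_bit_def by measurable
  \<comment> \<open>The bit handed to a child is random; splitting on it leaves constant bits, to
    which the induction hypothesis applies.\<close>
  have split: "c \<in> tree_out \<theta>' t z \<beta> \<longleftrightarrow> \<beta> \<and> c \<in> tree_out \<theta>' t z True \<or> \<not> \<beta> \<and> c \<in> tree_out \<theta>' t z False" for \<theta>' t \<beta>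
    by (cases \<beta>) auto
  show ?case
    unfolding tree_out.simps Un_iff
    by (subst (1 2) split) measurable
qed auto

lemma measurable_tree_sample:
  assumes "distinct (leaves t)" and [measurable]: "\<theta>r \<in> borel_measurable M"
    and "\<And>p. p \<in> inner_nodes t \<Longrightarrow> (\<lambda>\<omega>. \<theta> \<omega> p) \<in> borel_measurable M"
  shows "Measurable.pred M (\<lambda>\<omega>. c \<in> tree_sample t (\<theta> \<omega>) (\<theta>r \<omega>) z)"
proof -
  have [measurable]: "Measurable.pred M (\<lambda>\<omega>. c \<in> tree_out (\<theta> \<omega>) t z \<beta>)" for \<beta>
    using assms by (intro measurable_tree_out)
  have "(c \<in> tree_sample t (\<theta> \<omega>) (\<theta>r \<omega>) z) \<longleftrightarrow>
     (\<theta>r \<omega> < tree_val t z \<and> c \<in> tree_out (\<theta> \<omega>) t z True) \<or>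
     (\<not> \<theta>r \<omega> < tree_val t z \<and> c \<in> tree_out (\<theta> \<omega>) t z False)" for \<omega>
    by (cases "\<theta>r \<omega> < tree_val t z") (auto simp: tree_sample_eq[OF assms(1)])
  then show ?thesis by simp
qed

text \<open>The selection probability of a leaf \<open>c\<close> conditional on the bit of the root,
  with all \<theta> averaged out.\<close>

primrec leaf_prob :: "btree \<Rightarrow> (nat \<Rightarrow> real) \<Rightarrow> nat \<Rightarrow> bool \<Rightarrow> real" where
  "leaf_prob (Leaf i) z c \<beta> = of_bool (\<beta> \<and> c = i)"
| "leaf_prob (Node l r) z c \<beta> =
    (let a = tree_val l z; b = tree_val r z; q = threshold a b in
     if c \<in> set (leaves l) then
       q * leaf_prob l z c (if a + b \<le> 1 then \<beta> else True)
       + (1 - q) * leaf_prob l z c (if a + b \<le> 1 then False else \<beta>)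
     else
       q * leaf_prob r z c (if a + b \<le> 1 then False else \<beta>)
       + (1 - q) * leaf_prob r z c (if a + b \<le> 1 then \<beta> else True))"

lemma leaf_prob_nonneg: "z ` set (leaves t) \<subseteq> {0..1} \<Longrightarrow> 0 \<le> leaf_prob t z c \<beta>"
proof (induction t arbitrary: \<beta>)
  case (Node l r)
  have "0 \<le> threshold (tree_val l z) (tree_val r z)" "threshold (tree_val l z) (tree_val r z) \<le> 1"
    using Node.prems tree_val_range[of z l] tree_val_range[of z r] threshold_range[of "tree_val l z" "tree_val r z"] by auto
  then show ?case using Node by (auto simp: Let_def intro!: add_nonneg_nonneg mult_nonneg_nonneg)
qed auto

text \<open>The prefix \<open>\<pi>\<close> of the addresses makes the two subtrees live in the same product space, so that the
  induction needs no reindexing.\<close>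

lemma nn_integral_tree_out:
  assumes "finite I" "(\<lambda>p. \<pi> @ p) ` inner_nodes t \<subseteq> I" "distinct (leaves t)" "c \<in> set (leaves t)"
    and "z ` set (leaves t) \<subseteq> {0..1}"
  shows "(\<integral>\<^sup>+\<theta>. of_bool (c \<in> tree_out (\<lambda>p. \<theta> (\<pi> @ p)) t z \<beta>) \<partial>(\<Pi>\<^sub>M p\<in>I. uniform_real 0 1))
       = ennreal (leaf_prob t z c \<beta>)"
  using assms
proof (induction t arbitrary: \<pi> I \<beta>)
  case (Leaf i)
  interpret prob_space "uniform_real 0 1" by (rule prob_space_uniform_real) simp
  interpret P: prob_space "\<Pi>\<^sub>M p\<in>I. uniform_real 0 1" by (intro prob_space_PiM) unfold_locales
  show ?case using Leaf P.emeasure_space_1 by simp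
next
  case (Node l r)
  interpret U: prob_space "uniform_real 0 1" by (rule prob_space_uniform_real) simp
  interpret product_prob_space "\<lambda>_. uniform_real 0 1" by unfold_locales
  define a b q where "a = tree_val l z" and "b = tree_val r z" and "q = threshold a b"
  have q: "0 \<le> q" "q \<le> 1"
    using Node.prems tree_val_range[of z l] tree_val_range[of z r] threshold_range[of a b]
    unfolding a_def b_def q_def by auto
  \<comment> \<open>The \<theta> of the root of this subtree is split off and integrated last. For a
    fixed value of it the child's bit is a constant, and the addresses of both children lie in
    \<open>J\<close>.\<close>
  define J where "J = I - {\<pi>}"
  have I: "I = insert \<pi> J" "\<pi> \<notin> J" "finite J"
    using Node.prems by (auto simp: J_def)
  have JL: "(\<lambda>p. (\<pi> @ [False]) @ p) ` inner_nodes l \<subseteq> J" "(\<lambda>p. (\<pi> @ [True]) @ p) ` inner_nodes r \<subseteq> J"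
    using Node.prems(2) by (auto simp: J_def)
  have dist: "distinct (leaves l)" "distinct (leaves r)" "set (leaves l) \<inter> set (leaves r) = {}"
    using Node.prems by auto
  have zr: "z ` set (leaves l) \<subseteq> {0..1}" "z ` set (leaves r) \<subseteq> {0..1}"
    using Node.prems by auto
  have lp: "0 \<le> leaf_prob l z c \<beta>" "0 \<le> leaf_prob r z c \<beta>" for \<beta>
    using leaf_prob_nonneg zr by auto
  define f :: "(bool list \<Rightarrow> real) \<Rightarrow> ennreal"
    where "f = (\<lambda>\<theta>. of_bool (c \<in> tree_out (\<lambda>p. \<theta> (\<pi> @ p)) (Node l r) z \<beta>))"
  have [measurable]: "Measurable.pred (\<Pi>\<^sub>M p\<in>I. uniform_real 0 1) (\<lambda>\<theta>. c \<in> tree_out (\<lambda>p. \<theta> (\<pi> @ p)) (Node l r) z \<beta>)"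
  proof (rule measurable_tree_out)
    fix p assume "p \<in> inner_nodes (Node l r)"
    then have "\<pi> @ p \<in> I" using Node.prems(2) by blast
    then show "(\<lambda>\<theta>. \<theta> (\<pi> @ p)) \<in> borel_measurable (\<Pi>\<^sub>M p\<in>I. uniform_real 0 1)"
      using measurable_component_singleton[of "\<pi> @ p" I "\<lambda>_. uniform_real 0 1"]
      by (simp cong: measurable_cong_sets)
  qed
  have f [measurable]: "f \<in> borel_measurable (\<Pi>\<^sub>M p\<in>insert \<pi> J. uniform_real 0 1)"
    unfolding I(1)[symmetric] f_def of_bool_def by measurable
  have "(\<integral>\<^sup>+\<theta>. f \<theta> \<partial>(\<Pi>\<^sub>M p\<in>I. uniform_real 0 1)) =
    (\<integral>\<^sup>+y. (\<integral>\<^sup>+x. f (x(\<pi> := y)) \<partial>(\<Pi>\<^sub>M p\<in>J. uniform_real 0 1)) \<partial>uniform_real 0 1)"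
    unfolding I(1) by (intro product_nn_integral_insert_rev I f)
  also have "\<dots> = ennreal (leaf_prob (Node l r) z c \<beta>)"
  proof (cases "c \<in> set (leaves l)")
    case True
    then have cr: "c \<notin> set (leaves r)" using dist by auto
    have ff: "f (x(\<pi> := y)) = of_bool (c \<in> tree_out (\<lambda>p. x ((\<pi> @ [False]) @ p)) l z (left_bit a b y \<beta>))" for x y
      using cr tree_out_subset[of _ r] unfolding f_def by (auto simp: a_def b_def)
    have "(\<integral>\<^sup>+y. (\<integral>\<^sup>+x. f (x(\<pi> := y)) \<partial>(\<Pi>\<^sub>M p\<in>J. uniform_real 0 1)) \<partial>uniform_real 0 1)
      = (\<integral>\<^sup>+y. ennreal (leaf_prob l z c (left_bit a b y \<beta>)) \<partial>uniform_real 0 1)"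
      unfolding ff by (intro nn_integral_cong Node.IH(1) I JL dist True zr)
    also have "\<dots> = (\<integral>\<^sup>+y. ennreal (if y \<le> q then leaf_prob l z c (if a + b \<le> 1 then \<beta> else True)
           else leaf_prob l z c (if a + b \<le> 1 then False else \<beta>)) \<partial>uniform_real 0 1)"
      by (intro nn_integral_cong) (auto simp: left_bit_def q_def)
    also have "\<dots> = ennreal (leaf_prob (Node l r) z c \<beta>)"
      using True q lp by (simp add: nn_integral_uniform_threshold Let_def a_def[symmetric] b_def[symmetric] q_def[symmetric])
    finally show ?thesis .
  next
    case False
    then have cr: "c \<in> set (leaves r)" using Node.prems by auto
    have ff: "f (x(\<pi> := y)) = of_bool (c \<in> tree_out (\<lambda>p. x ((\<pi> @ [True]) @ p)) r z (right_bit a b y \<beta>))" for x y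
      using False tree_out_subset[of _ l] unfolding f_def by (auto simp: a_def b_def)
    have "(\<integral>\<^sup>+y. (\<integral>\<^sup>+x. f (x(\<pi> := y)) \<partial>(\<Pi>\<^sub>M p\<in>J. uniform_real 0 1)) \<partial>uniform_real 0 1)
      = (\<integral>\<^sup>+y. ennreal (leaf_prob r z c (right_bit a b y \<beta>)) \<partial>uniform_real 0 1)"
      unfolding ff by (intro nn_integral_cong Node.IH(2) I JL dist cr zr)
    also have "\<dots> = (\<integral>\<^sup>+y. ennreal (if y \<le> q then leaf_prob r z c (if a + b \<le> 1 then False else \<beta>)
           else leaf_prob r z c (if a + b \<le> 1 then \<beta> else True)) \<partial>uniform_real 0 1)"
      by (intro nn_integral_cong) (auto simp: right_bit_def q_def)
    also have "\<dots> = ennreal (leaf_prob (Node l r) z c \<beta>)"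
      using False q lp by (simp add: nn_integral_uniform_threshold Let_def a_def[symmetric] b_def[symmetric] q_def[symmetric])
    finally show ?thesis .
  qed
  finally show ?case unfolding f_def .
qed

text \<open>A martingale property: if the bit of a node is true with probability equal to its value,
  then so are the bits of its children. The facts \<open>left\<close> and \<open>right\<close> say
  this for an arbitrary function with value P on true and N on false.\<close>

lemma leaf_prob_mean:
  assumes "z ` set (leaves t) \<subseteq> {0..1}" "c \<in> set (leaves t)"
  shows "tree_val t z * leaf_prob t z c True + (1 - tree_val t z) * leaf_prob t z c False = z c"
  using assms
proof (induction t)
  case (Node l r)
  define a b q where "a = tree_val l z" and "b = tree_val r z" and "q = threshold a b"
  have ab: "0 \<le> a" "a \<le> 1" "0 \<le> b" "b \<le> 1"
    using Node.prems tree_val_range[of z l] tree_val_range[of z r] unfolding a_def b_def by auto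
  \<comment> \<open>Cleared of the denominator, this and \<open>large\<close> survive the degenerate
    sums 0 and 2, where q is 0.\<close>
  have small: "(a + b) * q = a" if "a + b \<le> 1"
    using that ab by (auto simp: q_def threshold_def)
  have large: "(2 - a - b) * q = 1 - b" if "a + b > 1"
    using that ab by (auto simp: q_def threshold_def)
  define s where "s = (if a + b \<le> 1 then a + b else a + b - 1)"
  have s: "tree_val (Node l r) z = s" by (simp add: s_def a_def b_def Let_def)
  have left: "s * (q * P + (1 - q) * (if a + b \<le> 1 then N else P))
    + (1 - s) * (q * (if a + b \<le> 1 then N else P) + (1 - q) * N) = a * P + (1 - a) * N" for P N
  proof (cases "a + b \<le> 1")
    case True
    have "(a + b) * (q * P + (1 - q) * N) + (1 - (a + b)) * (q * N + (1 - q) * N)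
        = ((a + b) * q) * (P - N) + N" by algebra
    also have "\<dots> = a * P + (1 - a) * N" unfolding small[OF True] by algebra
    finally show ?thesis using True by (simp add: s_def)
  next
    case False
    then have "a + b > 1" by simp
    have "(a + b - 1) * (q * P + (1 - q) * P) + (1 - (a + b - 1)) * (q * P + (1 - q) * N)
        = (a + b - 1) * P + (2 - a - b) * N + ((2 - a - b) * q) * (P - N)" by algebra
    also have "\<dots> = a * P + (1 - a) * N" unfolding large[OF \<open>a + b > 1\<close>] by algebra
    finally show ?thesis using False by (simp add: s_def)
  qed
  have right: "s * (q * (if a + b \<le> 1 then N else P) + (1 - q) * P)
    + (1 - s) * (q * N + (1 - q) * (if a + b \<le> 1 then N else P)) = b * P + (1 - b) * N" for P N
  proof (cases "a + b \<le> 1")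
    case True
    have "(a + b) * (q * N + (1 - q) * P) + (1 - (a + b)) * (q * N + (1 - q) * N)
        = ((a + b) * q) * (N - P) + (a + b) * P + (1 - (a + b)) * N" by algebra
    also have "\<dots> = b * P + (1 - b) * N" unfolding small[OF True] by algebra
    finally show ?thesis using True by (simp add: s_def)
  next
    case False
    then have "a + b > 1" by simp
    have "(a + b - 1) * (q * P + (1 - q) * P) + (1 - (a + b - 1)) * (q * N + (1 - q) * P)
        = P + ((2 - a - b) * q) * (N - P)" by algebra
    also have "\<dots> = b * P + (1 - b) * N" unfolding large[OF \<open>a + b > 1\<close>] by algebra
    finally show ?thesis using False by (simp add: s_def)
  qed
  show ?case
  proof (cases "c \<in> set (leaves l)")
    case True
    have "a * leaf_prob l z c True + (1 - a) * leaf_prob l z c False = z c"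
      using Node True unfolding a_def by auto
    then show ?thesis
      using left[of "leaf_prob l z c True" "leaf_prob l z c False"] True
      by (simp only: leaf_prob.simps s Let_def a_def[symmetric] b_def[symmetric] q_def[symmetric])
         (simp split: if_splits)
  next
    case False
    then have "b * leaf_prob r z c True + (1 - b) * leaf_prob r z c False = z c"
      using Node unfolding b_def by auto
    then show ?thesis
      using right[of "leaf_prob r z c False" "leaf_prob r z c True"] False
      by (simp only: leaf_prob.simps s Let_def a_def[symmetric] b_def[symmetric] q_def[symmetric])
         (simp split: if_splits)
  qed
qed auto

abbreviation tree_nodes :: "btree \<Rightarrow> (bool list \<Rightarrow> real) measure" where
  "tree_nodes t \<equiv> \<Pi>\<^sub>M p\<in>inner_nodes t. uniform_real 0 1"

text \<open>The threshold of the root comes first: as the outer variable of integration it fixes the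
  bit of the whole tree before the nodes are averaged.\<close>

definition tree_space :: "btree \<Rightarrow> (real \<times> (bool list \<Rightarrow> real)) measure" where
  "tree_space t = uniform_real 0 1 \<Otimes>\<^sub>M (tree_nodes t)"

abbreviation tree_sel :: "btree \<Rightarrow> (nat \<Rightarrow> real) \<Rightarrow> real \<times> (bool list \<Rightarrow> real) \<Rightarrow> nat set" where
  "tree_sel t z \<equiv> \<lambda>\<omega>. tree_sample t (snd \<omega>) (fst \<omega>) z"

lemma prob_space_tree_nodes: "prob_space (tree_nodes t)"
  by (intro prob_space_PiM prob_space_uniform_real) simp

lemma prob_space_tree_space: "prob_space (tree_space t)"
proof -
  interpret U: prob_space "uniform_real 0 1" by (rule prob_space_uniform_real) simp
  interpret T: prob_space "tree_nodes t" by (rule prob_space_tree_nodes)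
  interpret pair_prob_space "uniform_real 0 1" "tree_nodes t" ..
  show ?thesis unfolding tree_space_def by unfold_locales
qed

lemma nn_integral_tree_space:
  assumes "f \<in> borel_measurable (tree_space t)"
  shows "(\<integral>\<^sup>+u. \<integral>\<^sup>+\<theta>. f (u, \<theta>) \<partial>tree_nodes t \<partial>uniform_real 0 1) = integral\<^sup>N (tree_space t) f"
proof -
  interpret P: prob_space "tree_nodes t" by (rule prob_space_tree_nodes)
  show ?thesis using assms unfolding tree_space_def by (rule P.nn_integral_fst)
qed

lemma measurable_tree_sel [measurable]:
  assumes "distinct (leaves t)"
  shows "Measurable.pred (tree_space t) (\<lambda>\<omega>. c \<in> tree_sel t z \<omega>)"
proof (rule measurable_tree_sample[OF assms])
  show "fst \<in> borel_measurable (tree_space t)"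
    unfolding tree_space_def by measurable
  fix p assume [measurable]: "p \<in> inner_nodes t"
  show "(\<lambda>\<omega>. snd \<omega> p) \<in> borel_measurable (tree_space t)"
    unfolding tree_space_def by measurable
qed

lemma tree_sel_subset: "tree_sel t z \<omega> \<subseteq> set (leaves t)"
  by (auto simp: tree_sample_def Let_def split: prod.splits)

lemma finite_tree_sel [simp]: "finite (tree_sel t z \<omega>)"
  by (rule finite_subset[OF tree_sel_subset]) simp

lemma measurable_tree_sel_count_space:
  assumes "distinct (leaves t)"
  shows "tree_sel t z \<in> measurable (tree_space t) (count_space UNIV)"
  using measurable_tree_sel[OF assms]
  by (intro measurable_set_valued[of "set (leaves t)"] tree_sel_subset) auto

lemma prob_tree_sel:
  assumes "distinct (leaves t)" "c \<in> set (leaves t)" "z ` set (leaves t) \<subseteq> {0..1}"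
  shows "emeasure (tree_space t) {\<omega> \<in> space (tree_space t). c \<in> tree_sel t z \<omega>} = ennreal (z c)"
proof -
  interpret U: prob_space "uniform_real 0 1" by (rule prob_space_uniform_real) simp
  have v: "0 \<le> tree_val t z" "tree_val t z \<le> 1" using tree_val_range[OF assms(3)] by auto
  note [measurable] = measurable_tree_sel[OF assms(1)]
  have "emeasure (tree_space t) {\<omega> \<in> space (tree_space t). c \<in> tree_sel t z \<omega>}
      = (\<integral>\<^sup>+\<omega>. of_bool (c \<in> tree_sel t z \<omega>) \<partial>tree_space t)"
    by (subst nn_integral_indicator[symmetric], measurable)
       (auto intro!: nn_integral_cong simp del: nn_integral_indicator split: split_indicator)
  also have "\<dots> = (\<integral>\<^sup>+u. \<integral>\<^sup>+\<theta>. of_bool (c \<in> tree_sel t z (u, \<theta>)) \<partial>tree_nodes t \<partial>uniform_real 0 1)"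
    by (rule nn_integral_tree_space[symmetric]) (unfold of_bool_def, measurable)
  also have "\<dots> = (\<integral>\<^sup>+u. ennreal (leaf_prob t z c (u < tree_val t z)) \<partial>uniform_real 0 1)"
    using nn_integral_tree_out[of "inner_nodes t" "[]" t c z] assms
    by (simp add: tree_sample_eq)
  also have "\<dots> = (\<integral>\<^sup>+u. ennreal (if u < tree_val t z then leaf_prob t z c True else leaf_prob t z c False) \<partial>uniform_real 0 1)"
    by (intro nn_integral_cong) auto
  also have "\<dots> = ennreal (z c)"
    using v assms by (subst nn_integral_uniform_less) (auto simp: leaf_prob_nonneg leaf_prob_mean)
  finally show ?thesis .
qed

lemma integrable_tree_sel:
  fixes h :: "nat set \<Rightarrow> nat set \<Rightarrow> real"
  assumes "distinct (leaves t)"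
  shows "integrable (tree_space t) (\<lambda>\<omega>. h (tree_sel t z \<omega>) (tree_sel t z' \<omega>))"
proof -
  interpret prob_space "tree_space t" by (rule prob_space_tree_space)
  note [measurable] = measurable_tree_sel_count_space[OF assms]
  define P where "P = Pow (set (leaves t)) \<times> Pow (set (leaves t))"
  have P: "finite P" by (simp add: P_def)
  show ?thesis
  proof (rule integrable_const_bound)
    show "AE \<omega> in tree_space t. norm (h (tree_sel t z \<omega>) (tree_sel t z' \<omega>)) \<le> Max ((\<lambda>(A, B). \<bar>h A B\<bar>) ` P)"
    proof (rule AE_I2)
      fix \<omega>
      have "(tree_sel t z \<omega>, tree_sel t z' \<omega>) \<in> P"
        unfolding P_def by (intro SigmaI PowI tree_sel_subset)
      then show "norm (h (tree_sel t z \<omega>) (tree_sel t z' \<omega>)) \<le> Max ((\<lambda>(A, B). \<bar>h A B\<bar>) ` P)"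
        using P by (intro Max_ge) (auto intro!: rev_image_eqI)
    qed
    have "(\<lambda>\<omega>. h (tree_sel t z \<omega>) (tree_sel t z' \<omega>)) \<in> measurable (tree_space t) (count_space UNIV)"
      by (rule measurable_pair_finite_range[where F = "tree_sel t z" and G = "tree_sel t z'" and h = h
            and P = "Pow (set (leaves t))" and Q = "Pow (set (leaves t))"])
         (use measurable_tree_sel_count_space[OF assms] tree_sel_subset in auto)
    from measurable_compose[OF this, of "\<lambda>x. x" borel]
    show "(\<lambda>\<omega>. h (tree_sel t z \<omega>) (tree_sel t z' \<omega>)) \<in> borel_measurable (tree_space t)" by simp
  qed
qed

section \<open>Expected counts and the stretch of the tree sampler\<close>

lemma expectation_card_tree_sel:
  assumes "distinct (leaves t)" "U \<subseteq> set (leaves t)" "z ` set (leaves t) \<subseteq> {0..1}"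
  shows "(\<integral>\<omega>. real (card (tree_sel t z \<omega> \<inter> U)) \<partial>tree_space t) = (\<Sum>c\<in>U. z c)"
proof -
  interpret prob_space "tree_space t" by (rule prob_space_tree_space)
  have fin: "finite U" by (rule finite_subset[OF assms(2)]) simp
  note [measurable] = measurable_tree_sel[OF assms(1)]
  have "(\<integral>\<omega>. real (card (tree_sel t z \<omega> \<inter> U)) \<partial>tree_space t)
      = (\<integral>\<omega>. (\<Sum>c\<in>U. indicator {\<omega> \<in> space (tree_space t). c \<in> tree_sel t z \<omega>} \<omega>) \<partial>tree_space t)"
  proof (rule Bochner_Integration.integral_cong)
    fix \<omega> assume "\<omega> \<in> space (tree_space t)"
    then have "(\<Sum>c\<in>U. indicator {\<omega> \<in> space (tree_space t). c \<in> tree_sel t z \<omega>} \<omega>)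
      = (\<Sum>c\<in>U. if c \<in> tree_sel t z \<omega> then 1 else (0::real))"
      by (intro sum.cong) auto
    also have "\<dots> = real (card (tree_sel t z \<omega> \<inter> U))"
      using fin by (simp add: sum.If_cases Int_commute)
    finally show "real (card (tree_sel t z \<omega> \<inter> U)) =
      (\<Sum>c\<in>U. indicator {\<omega> \<in> space (tree_space t). c \<in> tree_sel t z \<omega>} \<omega>)" by simp
  qed simp
  also have "\<dots> = (\<Sum>c\<in>U. measure (tree_space t) {\<omega> \<in> space (tree_space t). c \<in> tree_sel t z \<omega>})"
    by (subst Bochner_Integration.integral_sum) (auto intro!: integrable_real_indicator simp: emeasure_eq_measure)
  also have "\<dots> = (\<Sum>c\<in>U. z c)"
    using assms by (intro sum.cong) (auto simp: measure_def prob_tree_sel subset_iff image_subset_iff)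
  finally show ?thesis .
qed

text \<open>The pointwise bound is linear in the counts, so expectations can be inserted: each count
  of a set containing \<open>c\<close> grows by \<open>v - z c\<close>. The whole tree enters once,
  and at most \<open>depth t\<close> smaller subtrees enter twice.\<close>

lemma tree_stability_mono:
  assumes t: "distinct (leaves t)" "c \<in> set (leaves t)"
    and z: "z ` set (leaves t) \<subseteq> {0..1}" and v: "z c \<le> v" "v \<le> 1"
  shows "(\<integral>\<omega>. real (card (sym_diff (tree_sel t z \<omega>) (tree_sel t (z(c := v)) \<omega>))) \<partial>tree_space t)
       \<le> (2 * real (depth t) + 1) * (v - z c)"
proof -
  define z' where "z' = z(c := v)"
  have z': "z' ` set (leaves t) \<subseteq> {0..1}"
  proof -
    have "0 \<le> z c" using t z by (auto simp: image_subset_iff)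
    then show ?thesis using v z by (auto simp: z'_def image_subset_iff)
  qed
  define D where "D = (\<lambda>U \<omega>. real (card (tree_sel t z' \<omega> \<inter> U)) - real (card (tree_sel t z \<omega> \<inter> U)))"
  have intD: "integrable (tree_space t) (D U)" for U
    unfolding D_def
    by (rule integrable_tree_sel[OF t(1), where h = "\<lambda>A B. real (card (B \<inter> U)) - real (card (A \<inter> U))"])
  have sumd: "(\<Sum>x\<in>U. z' x) = (\<Sum>x\<in>U. z x) + (v - z c)" if "c \<in> U" "finite U" for U
    using that by (simp add: z'_def sum.remove[of U c])
  have ED: "(\<integral>\<omega>. D U \<omega> \<partial>tree_space t) = v - z c" if "U \<subseteq> set (leaves t)" "c \<in> U" for U
  proof -
    have "(\<integral>\<omega>. D U \<omega> \<partial>tree_space t) = (\<Sum>x\<in>U. z' x) - (\<Sum>x\<in>U. z x)"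
      unfolding D_def using that t z z'
      by (subst Bochner_Integration.integral_diff)
         (auto intro: integrable_tree_sel[where h = "\<lambda>A B. real (card (A \<inter> U))"] simp: expectation_card_tree_sel)
    moreover have "finite U" by (rule finite_subset[OF that(1)]) simp
    ultimately show ?thesis using sumd[OF that(2)] by simp
  qed
  let ?Us = "below_path t c"
  have pw: "real (card (sym_diff (tree_sel t z \<omega>) (tree_sel t z' \<omega>))) \<le>
      D (set (leaves t)) \<omega> + 2 * (\<Sum>i<length ?Us. D (?Us ! i) \<omega>)" for \<omega>
  proof -
    define \<beta> \<beta>' where "\<beta> = (fst \<omega> < tree_val t z)" and "\<beta>' = (fst \<omega> < tree_val t z')"
    have eq: "tree_sel t z \<omega> = tree_out (snd \<omega>) t z \<beta>" "tree_sel t z' \<omega> = tree_out (snd \<omega>) t z' \<beta>'"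
      using t by (simp_all add: tree_sample_eq \<beta>_def \<beta>'_def)
    \<comment> \<open>Both root bits come from the same threshold, so for equal bases the larger
      value has the larger bit. This starts the comparison of counts.\<close>
    have "tree_base t z < tree_base t z' \<or> (tree_base t z = tree_base t z' \<and> tree_val t z \<le> tree_val t z')"
      using tree_val_range[OF z] tree_val_range[OF z'] sumd[of "set (leaves t)"] t v tree_val_zero[OF z]
      by (intro base_val_cases) (auto simp: tree_base_val_sum)
    then have "tree_count t z \<beta> \<le> tree_count t z' \<beta>'"
      by (auto simp: tree_count_def \<beta>_def \<beta>'_def)
    from card_sym_diff_tree_out[OF t v z this[unfolded z'_def], of "snd \<omega>"]
    have "int (card (sym_diff (tree_sel t z \<omega>) (tree_sel t z' \<omega>)))
      \<le> int (card (tree_sel t z' \<omega>)) - int (card (tree_sel t z \<omega>))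
     + 2 * (\<Sum>U\<leftarrow>?Us. int (card (tree_sel t z' \<omega> \<inter> U)) - int (card (tree_sel t z \<omega> \<inter> U)))"
      unfolding eq(1) eq(2)[unfolded z'_def] z'_def .
    also have "(\<Sum>U\<leftarrow>?Us. int (card (tree_sel t z' \<omega> \<inter> U)) - int (card (tree_sel t z \<omega> \<inter> U)))
      = (\<Sum>i<length ?Us. int (card (tree_sel t z' \<omega> \<inter> ?Us ! i)) - int (card (tree_sel t z \<omega> \<inter> ?Us ! i)))"
      by (simp add: sum_list_sum_nth lessThan_atLeast0)
    finally have "real_of_int (int (card (sym_diff (tree_sel t z \<omega>) (tree_sel t z' \<omega>)))) \<le>
      real_of_int (int (card (tree_sel t z' \<omega>)) - int (card (tree_sel t z \<omega>))
     + 2 * (\<Sum>i<length ?Us. int (card (tree_sel t z' \<omega> \<inter> ?Us ! i)) - int (card (tree_sel t z \<omega> \<inter> ?Us ! i))))"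
      by (simp only: of_int_le_iff)
    also have "\<dots> = D (set (leaves t)) \<omega> + 2 * (\<Sum>i<length ?Us. D (?Us ! i) \<omega>)"
      using tree_sel_subset[of t] by (simp add: D_def Int_absorb2)
    finally show ?thesis by simp
  qed
  have "(\<integral>\<omega>. real (card (sym_diff (tree_sel t z \<omega>) (tree_sel t z' \<omega>))) \<partial>tree_space t)
     \<le> (\<integral>\<omega>. D (set (leaves t)) \<omega> + 2 * (\<Sum>i<length ?Us. D (?Us ! i) \<omega>) \<partial>tree_space t)"
    by (intro integral_mono integrable_tree_sel t pw Bochner_Integration.integrable_add
        integrable_mult_right Bochner_Integration.integrable_sum intD)
  also have "\<dots> = (v - z c) + 2 * (\<Sum>i<length ?Us. (\<integral>\<omega>. D (?Us ! i) \<omega> \<partial>tree_space t))"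
    using t by (simp add: intD ED)
  also have "(\<Sum>i<length ?Us. (\<integral>\<omega>. D (?Us ! i) \<omega> \<partial>tree_space t)) = (\<Sum>i<length ?Us. v - z c)"
  proof (intro sum.cong refl ED)
    fix i assume "i \<in> {..<length ?Us}"
    then have "?Us ! i \<in> set ?Us" by simp
    then show "?Us ! i \<subseteq> set (leaves t)" "c \<in> ?Us ! i"
      using t by (blast dest: below_path_subset, blast dest: below_path_mem)
  qed
  also have "(v - z c) + 2 * (\<Sum>i<length ?Us. v - z c) = (2 * real (length ?Us) + 1) * (v - z c)"
    by (simp add: algebra_simps)
  also have "\<dots> \<le> (2 * real (depth t) + 1) * (v - z c)"
    using v length_below_path[of t c] by (intro mult_right_mono) auto
  finally show ?thesis unfolding z'_def .
qed

lemma tree_stability: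
  assumes t: "distinct (leaves t)" "c \<in> set (leaves t)"
    and z: "z ` set (leaves t) \<subseteq> {0..1}" and v: "0 \<le> v" "v \<le> 1"
  shows "(\<integral>\<^sup>+\<omega>. of_nat (card (sym_diff (tree_sel t z \<omega>) (tree_sel t (z(c := v)) \<omega>))) \<partial>tree_space t)
       \<le> ennreal ((2 * real (depth t) + 1) * \<bar>v - z c\<bar>)"
proof -
  have "(\<integral>\<omega>. real (card (sym_diff (tree_sel t z \<omega>) (tree_sel t (z(c := v)) \<omega>))) \<partial>tree_space t)
       \<le> (2 * real (depth t) + 1) * \<bar>v - z c\<bar>"
  proof (cases "z c \<le> v")
    case True
    then show ?thesis using tree_stability_mono[OF t z] v by simp
  next
    case False
    have "(z(c := v)) ` set (leaves t) \<subseteq> {0..1}" "z c \<le> 1" using t z v by (auto simp: image_subset_iff)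
    with False tree_stability_mono[OF t, of "z(c := v)" "z c"] show ?thesis
      by (simp add: Un_commute)
  qed
  moreover have "(\<integral>\<^sup>+\<omega>. of_nat (card (sym_diff (tree_sel t z \<omega>) (tree_sel t (z(c := v)) \<omega>))) \<partial>tree_space t)
    = ennreal (\<integral>\<omega>. real (card (sym_diff (tree_sel t z \<omega>) (tree_sel t (z(c := v)) \<omega>))) \<partial>tree_space t)"
    using t by (subst nn_integral_eq_integral[symmetric])
       (auto intro: integrable_tree_sel simp: ennreal_of_nat_eq_real_of_nat)
  ultimately show ?thesis by (simp add: ennreal_leI)
qed

subsection \<open>Exponential clocks\<close>

abbreviation clocks :: "nat \<Rightarrow> (nat \<Rightarrow> real) measure" where
  "clocks n \<equiv> \<Pi>\<^sub>M i\<in>{1..n}. exponential_measure 1"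

lemma space_exponential_measure [simp]: "space (exponential_measure l) = UNIV"
  and sets_exponential_measure [simp, measurable_cong]: "sets (exponential_measure l) = sets borel"
  by (simp_all add: exponential_measure_def)

lemma prob_space_exponential_measure: "0 < l \<Longrightarrow> prob_space (exponential_measure l)"
  unfolding exponential_measure_def by (rule prob_space_exponential_density)

lemma AE_exponential_measure: "AE u in exponential_measure l. 0 \<le> u"
  unfolding exponential_measure_def by (subst AE_density) (auto simp: exponential_density_def)

lemma emeasure_exponential_tail:
  assumes "0 < l" "0 \<le> y"
  shows "emeasure (exponential_measure l) {y<..} = ennreal (exp (- y * l))"
    and "emeasure (exponential_measure l) {y..} = ennreal (exp (- y * l))"
proof -
  interpret prob_space "exponential_measure l" using assms(1) by (rule prob_space_exponential_measure)
  have "distributed (exponential_measure l) lborel (\<lambda>x. x) (exponential_density l)"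
    unfolding distributed_def exponential_measure_def using assms
    by (auto simp: distr_id2 exponential_density_nonneg)
  from exponential_distributedD_gt[OF this assms(2,1)]
  show 1: "emeasure (exponential_measure l) {y<..} = ennreal (exp (- y * l))"
    by (simp add: emeasure_eq_measure greaterThan_def)
  have "AE u in lborel. u \<noteq> y"
    by (rule AE_lborel_singleton)
  then have "AE u in exponential_measure l. u \<noteq> y"
    unfolding exponential_measure_def by (subst AE_density) auto
  then have "emeasure (exponential_measure l) {y..} = emeasure (exponential_measure l) {y<..}"
    by (intro emeasure_eq_AE) auto
  with 1 show "emeasure (exponential_measure l) {y..} = ennreal (exp (- y * l))" by simp
qed

text \<open>Up to the factor \<open>l / (l + c)\<close> the integrand times the density is the
  exponential density of rate l + c, which integrates to 1.\<close>

lemma nn_integral_exp_exponential_measure: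
  assumes "0 < l" "0 \<le> c"
  shows "(\<integral>\<^sup>+y. ennreal (exp (- c * y)) \<partial>exponential_measure l) = ennreal (l / (l + c))"
proof -
  have "(\<integral>\<^sup>+y. ennreal (exp (- c * y)) \<partial>exponential_measure l)
      = (\<integral>\<^sup>+y. ennreal (exponential_density l y) * ennreal (exp (- c * y)) \<partial>lborel)"
    unfolding exponential_measure_def by (subst nn_integral_density) auto
  also have "\<dots> = (\<integral>\<^sup>+y. ennreal (l / (l + c)) * ennreal (exponential_density (l + c) y) \<partial>lborel)"
  proof (intro nn_integral_cong)
    fix y :: real
    have "l * (exp (- y * l) * exp (- c * y)) = l / (l + c) * ((l + c) * exp (- y * (l + c)))"
      using assms by (simp add: exp_add[symmetric] algebra_simps add_divide_distrib[symmetric])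
        (simp add: field_simps)
    then show "ennreal (exponential_density l y) * ennreal (exp (- c * y))
      = ennreal (l / (l + c)) * ennreal (exponential_density (l + c) y)"
      using assms by (simp add: exponential_density_def ennreal_mult[symmetric] mult.assoc)
  qed
  also have "\<dots> = ennreal (l / (l + c)) * emeasure (density lborel (exponential_density (l + c))) UNIV"
    by (subst nn_integral_cmult) (auto simp: emeasure_density)
  also have "emeasure (density lborel (exponential_density (l + c))) UNIV = 1"
    using prob_space.emeasure_space_1[OF prob_space_exponential_density[of "l + c"]] assms by simp
  finally show ?thesis by simp
qed

text \<open>The weak and the strict race have the same probability, so ties need no separate treatment.\<close>

lemma emeasure_clock_race:
  assumes J: "finite J" "j \<in> J" "S \<subseteq> J - {j}" and r: "\<And>i. i \<in> S \<Longrightarrow> 0 \<le> r i"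
    and cmp: "cmp = (\<le>) \<or> cmp = (<)"
  shows "emeasure (\<Pi>\<^sub>M i\<in>J. exponential_measure 1)
     {E \<in> space (\<Pi>\<^sub>M i\<in>J. exponential_measure 1). \<forall>i\<in>S. cmp (r i * E j) (E i)} = ennreal (1 / (1 + (\<Sum>i\<in>S. r i)))"
proof -
  interpret prob_space "exponential_measure 1" by (rule prob_space_exponential_measure) simp
  interpret product_prob_space "\<lambda>_. exponential_measure 1" by unfold_locales
  define I where "I = J - {j}"
  have I: "J = insert j I" "finite I" "j \<notin> I" "S \<subseteq> I" "finite S"
    using J by (auto simp: I_def intro: finite_subset)
  \<comment> \<open>Once the clock of \<open>j\<close> shows y, the event is a box with sides
    \<open>A y i\<close>, where UNIV stands for a clock outside the race. Independence then turns
    its probability into a product of exponential tails.\<close>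
  define A where "A = (\<lambda>y i. if i \<in> S then {x. cmp (r i * y) x} else (UNIV :: real set))"
  have A_sets [measurable]: "A y i \<in> sets borel" for y i
    using cmp by (auto simp: A_def)
  let ?W = "{E \<in> space (\<Pi>\<^sub>M i\<in>J. exponential_measure 1). \<forall>i\<in>S. cmp (r i * E j) (E i)}"
  have [measurable]: "(\<lambda>E. E i) \<in> borel_measurable (\<Pi>\<^sub>M i\<in>J. exponential_measure 1)" if "i \<in> J" for i
    using measurable_component_singleton[OF that, of "\<lambda>_. exponential_measure 1"]
    by (simp cong: measurable_cong_sets)
  have W [measurable]: "?W \<in> sets (\<Pi>\<^sub>M i\<in>J. exponential_measure 1)"
  proof -
    have "Measurable.pred (\<Pi>\<^sub>M i\<in>J. exponential_measure 1) (\<lambda>E. cmp (r i * E j) (E i))" if "i \<in> S" for i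
    proof -
      have [measurable]: "i \<in> J" "j \<in> J" using that J by auto
      show ?thesis
      proof (rule disjE[OF cmp])
        assume "cmp = (\<le>)"
        show ?thesis unfolding \<open>cmp = (\<le>)\<close> not_less[symmetric] by measurable
      next
        assume "cmp = (<)"
        show ?thesis unfolding \<open>cmp = (<)\<close> by measurable
      qed
    qed
    then show ?thesis using I by (intro predE pred_intros_finite) auto
  qed
  have tail: "emeasure (exponential_measure 1) {x. cmp y x} = ennreal (exp (- y))" if "0 \<le> y" for y
    using cmp emeasure_exponential_tail[of 1 y] that by (auto simp: greaterThan_def atLeast_def)
  have "emeasure (\<Pi>\<^sub>M i\<in>J. exponential_measure 1) ?W
      = (\<integral>\<^sup>+E. indicator ?W E \<partial>(\<Pi>\<^sub>M i\<in>insert j I. exponential_measure 1))"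
    using W I by simp
  also have "\<dots> = (\<integral>\<^sup>+y. \<integral>\<^sup>+E. indicator ?W (E(j := y)) \<partial>(\<Pi>\<^sub>M i\<in>I. exponential_measure 1) \<partial>exponential_measure 1)"
    using I(2,3) borel_measurable_indicator[OF W]
    by (intro product_nn_integral_insert_rev) (simp_all add: I(1)[symmetric])
  also have "\<dots> = (\<integral>\<^sup>+y. ennreal (exp (- (\<Sum>i\<in>S. r i) * y)) \<partial>exponential_measure 1)"
  proof (intro nn_integral_cong_AE, use AE_exponential_measure in eventually_elim)
    fix y :: real assume y: "0 \<le> y"
    have "(\<integral>\<^sup>+E. indicator ?W (E(j := y)) \<partial>(\<Pi>\<^sub>M i\<in>I. exponential_measure 1))
      = (\<integral>\<^sup>+E. (\<Prod>i\<in>I. indicator (A y i) (E i)) \<partial>(\<Pi>\<^sub>M i\<in>I. exponential_measure 1))"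
    proof (intro nn_integral_cong)
      fix E assume E: "E \<in> space (\<Pi>\<^sub>M i\<in>I. exponential_measure 1)"
      have "E(j := y) \<in> space (\<Pi>\<^sub>M i\<in>J. exponential_measure 1)"
        using E unfolding I(1) by (auto simp: space_PiM PiE_def extensional_def)
      moreover have "(E(j := y)) i = E i" if "i \<in> S" for i using that I by auto
      ultimately have "E(j := y) \<in> ?W \<longleftrightarrow> (\<forall>i\<in>S. cmp (r i * y) (E i))" by auto
      also have "\<dots> \<longleftrightarrow> (\<forall>i\<in>I. E i \<in> A y i)" using I by (auto simp: A_def)
      finally have iff: "E(j := y) \<in> ?W \<longleftrightarrow> (\<forall>i\<in>I. E i \<in> A y i)" .
      show "(indicator ?W (E(j := y)) :: ennreal) = (\<Prod>i\<in>I. indicator (A y i) (E i))"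
      proof (cases "\<forall>i\<in>I. E i \<in> A y i")
        case True then show ?thesis using iff by (simp add: indicator_def)
      next
        case False
        then obtain i where "i \<in> I" "E i \<notin> A y i" by blast
        then have z: "(\<Prod>i\<in>I. indicator (A y i) (E i) :: ennreal) = 0"
          using I(2) by (intro prod_zero bexI[of _ i]) (auto simp: indicator_def)
        have "E(j := y) \<notin> ?W" using iff False by blast
        then show ?thesis unfolding z by (rule indicator_simps(2))
      qed
    qed
    also have "\<dots> = (\<Prod>i\<in>I. \<integral>\<^sup>+x. indicator (A y i) x \<partial>exponential_measure 1)"
      by (intro product_nn_integral_prod I borel_measurable_indicator) (simp add: A_sets)
    also have "\<dots> = (\<Prod>i\<in>I. if i \<in> S then ennreal (exp (- (r i * y))) else 1)"
    proof (intro prod.cong refl)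
      fix i
      have "(\<integral>\<^sup>+x. indicator (A y i) x \<partial>exponential_measure 1) = emeasure (exponential_measure 1) (A y i)"
        by (intro nn_integral_indicator) (simp add: A_sets)
      also have "\<dots> = (if i \<in> S then ennreal (exp (- (r i * y))) else 1)"
        using y r[of i] tail[of "r i * y"] prob_space.emeasure_space_1[OF prob_space_exponential_measure[of 1]]
        by (simp add: A_def)
      finally show "(\<integral>\<^sup>+x. indicator (A y i) x \<partial>exponential_measure 1)
        = (if i \<in> S then ennreal (exp (- (r i * y))) else 1)" .
    qed
    also have "\<dots> = (\<Prod>i\<in>S. ennreal (exp (- (r i * y))))"
      using I by (simp add: prod.If_cases Int_absorb1)
    also have "\<dots> = ennreal (exp (- (\<Sum>i\<in>S. r i) * y))"
      using I by (simp add: prod_ennreal exp_sum[symmetric] sum_distrib_right sum_negf)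
    finally show "(\<integral>\<^sup>+E. indicator ?W (E(j := y)) \<partial>(\<Pi>\<^sub>M i\<in>I. exponential_measure 1)) = ennreal (exp (- (\<Sum>i\<in>S. r i) * y))" .
  qed
  also have "\<dots> = ennreal (1 / (1 + (\<Sum>i\<in>S. r i)))"
    using r by (intro nn_integral_exp_exponential_measure) (auto intro: sum_nonneg)
  finally show ?thesis .
qed

text \<open>\<open>arg_min_on\<close> chooses from the set of minimisers, so equal sets of
  minimisers yield the same choice even when there are ties.\<close>

lemma arg_min_on_cong:
  assumes "\<And>i. is_arg_min f (\<lambda>i. i \<in> A) i \<longleftrightarrow> is_arg_min g (\<lambda>i. i \<in> B) i"
  shows "arg_min_on f A = arg_min_on g B"
  using assms by (simp add: arg_min_on_def arg_min_def)

text \<open>Raising the weight of \<open>j\<close> lowers only its own ratio. If \<open>j\<close>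
  won strictly before, it still does; if it does not even win weakly afterwards, it never took part
  in the minimum, and the minimisers lie in \<open>S\<close> both times. The normalisers s and s'
  scale all ratios alike.\<close>

lemma arg_min_race_cong:
  fixes E x y :: "nat \<Rightarrow> real"
  assumes S: "j \<notin> S" and x: "\<And>i. i \<in> S \<Longrightarrow> 0 < x i" "0 \<le> x j"
    and y: "\<And>i. i \<in> S \<Longrightarrow> y i = x i" "x j < y j" and E: "0 \<le> E j" and s: "0 < s" "0 < s'"
    and A: "A = S \<union> {i. i = j \<and> 0 < x j}"
    and H: "(0 < x j \<and> (\<forall>i\<in>S. x i / x j * E j < E i)) \<or> \<not> (\<forall>i\<in>S. x i / y j * E j \<le> E i)"
  shows "arg_min_on (\<lambda>i. E i / (x i / s)) A = arg_min_on (\<lambda>i. E i / (y i / s')) (insert j S)"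
proof (rule arg_min_on_cong)
  have scale: "is_arg_min (\<lambda>i. E i / (w i / c)) P = is_arg_min (\<lambda>i. E i / w i) P" if "0 < c" for w c P
  proof -
    have "E i / (w i / c) < E k / (w k / c) \<longleftrightarrow> E i / w i < E k / w k" for i k
    proof -
      have "E i / (w i / c) = c * (E i / w i)" for i by simp
      then show ?thesis using that by (simp only: mult_less_cancel_left_pos)
    qed
    then show ?thesis by (simp add: is_arg_min_def fun_eq_iff)
  qed
  fix i
  have "is_arg_min (\<lambda>i. E i / x i) (\<lambda>i. i \<in> A) i \<longleftrightarrow> is_arg_min (\<lambda>i. E i / y i) (\<lambda>i. i \<in> insert j S) i"
    using H
  proof
    assume h: "0 < x j \<and> (\<forall>i\<in>S. x i / x j * E j < E i)"
    have 1: "E j / x j < E i / x i" if "i \<in> S" for i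
    proof -
      have "E j / x j * x i < E i" using h that by (simp add: mult.commute)
      then show ?thesis using x(1)[OF that] by (simp add: pos_less_divide_eq)
    qed
    have "E j / y j \<le> E j / x j" using h y E by (intro divide_left_mono) auto
    then have 2: "E j / y j < E i / y i" if "i \<in> S" for i
      using 1[OF that] y that by simp
    have Aj: "A = insert j S" using A h by auto
    have L: "is_arg_min (\<lambda>i. E i / x i) (\<lambda>i. i \<in> A) i \<longleftrightarrow> i = j"
      unfolding is_arg_min_linorder Aj using 1 by (auto simp: less_imp_le) (metis leD)
    have R: "is_arg_min (\<lambda>i. E i / y i) (\<lambda>i. i \<in> insert j S) i \<longleftrightarrow> i = j"
      unfolding is_arg_min_linorder using 2 by (auto simp: less_imp_le) (metis leD)
    show ?thesis unfolding L R ..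
  next
    assume "\<not> (\<forall>i\<in>S. x i / y j * E j \<le> E i)"
    then obtain i0 where i0: "i0 \<in> S" "E i0 < x i0 / y j * E j" by auto
    have yj: "0 < y j" using x y by linarith
    have lt: "E i0 / x i0 < E j / y j"
      using i0 x yj by (simp add: field_simps)
    have lt': "E i0 / x i0 < E j / x j" if "0 < x j"
    proof -
      have "E j / y j \<le> E j / x j" using that y E yj by (intro divide_left_mono) auto
      with lt show ?thesis by simp
    qed
    have L: "is_arg_min (\<lambda>i. E i / x i) (\<lambda>i. i \<in> A) i \<longleftrightarrow> i \<in> S \<and> (\<forall>k\<in>S. E i / x i \<le> E k / x k)"
      unfolding is_arg_min_linorder A using i0 lt' by (auto; fastforce)
    have R: "is_arg_min (\<lambda>i. E i / y i) (\<lambda>i. i \<in> insert j S) i \<longleftrightarrow> i \<in> S \<and> (\<forall>k\<in>S. E i / x i \<le> E k / x k)"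
      unfolding is_arg_min_linorder using i0 lt y by (auto; fastforce)
    show ?thesis unfolding L R ..
  qed
  then show "is_arg_min (\<lambda>i. E i / (x i / s)) (\<lambda>i. i \<in> A) i \<longleftrightarrow>
     is_arg_min (\<lambda>i. E i / (y i / s')) (\<lambda>i. i \<in> insert j S) i"
    using s by (simp only: scale)
qed

text \<open>A change of winner means that \<open>j\<close> wins weakly with the new weight but not strictly with the old one.
  As the second event almost surely implies the first, the probabilities subtract.\<close>

lemma nn_integral_clock_change:
  fixes x :: "nat \<Rightarrow> real"
  assumes J: "finite J" "j \<in> J" "S \<subseteq> J - {j}" and x: "\<And>i. i \<in> S \<Longrightarrow> 0 < x i" "0 \<le> x j" and v: "x j < v"
    and pos: "0 < sum x S + x j" and s: "0 < s" "0 < s'"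
    and y: "\<And>i. i \<in> S \<Longrightarrow> y i = x i" "y j = v"
    and A: "A = S \<union> {i. i = j \<and> 0 < x j}"
  shows "(\<integral>\<^sup>+E. of_bool (arg_min_on (\<lambda>i. E i / (x i / s)) A \<noteq> arg_min_on (\<lambda>i. E i / (y i / s')) (insert j S))
      \<partial>(\<Pi>\<^sub>M i\<in>J. exponential_measure 1)) \<le> ennreal ((v - x j) / (sum x S + x j))"
proof -
  interpret prob_space "exponential_measure 1" by (rule prob_space_exponential_measure) simp
  let ?P = "\<Pi>\<^sub>M i\<in>J. exponential_measure 1"
  interpret P: prob_space ?P by (intro prob_space_PiM) unfold_locales
  have fin: "finite S" using J finite_subset by auto
  have s0: "0 \<le> sum x S" using x by (intro sum_nonneg) (auto intro: less_imp_le)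
  have v0: "0 < v" using x v by linarith
  define W where "W = {E \<in> space ?P. \<forall>i\<in>S. x i / v * E j \<le> E i}"
  \<comment> \<open>An old weight of 0 keeps \<open>j\<close> out of the race; the empty event
    matches the formula \<open>x j / (x j + sum x S)\<close>.\<close>
  define V where "V = (if 0 < x j then {E \<in> space ?P. \<forall>i\<in>S. x i / x j * E j < E i} else {})"
  have EW: "emeasure ?P W = ennreal (v / (v + sum x S))"
  proof -
    have "emeasure ?P W = ennreal (1 / (1 + (\<Sum>i\<in>S. x i / v)))"
      unfolding W_def using J x v0
      by (intro emeasure_clock_race[where cmp = "(\<le>)"]) (auto intro: less_imp_le)
    also have "1 / (1 + (\<Sum>i\<in>S. x i / v)) = v / (v + sum x S)"
      using v0 s0 by (simp add: sum_divide_distrib[symmetric] field_simps)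
    finally show ?thesis .
  qed
  have EV: "emeasure ?P V = ennreal (x j / (x j + sum x S))"
  proof (cases "0 < x j")
    case True
    then have "emeasure ?P V = ennreal (1 / (1 + (\<Sum>i\<in>S. x i / x j)))"
      unfolding V_def using J x
      by (simp only: if_True, intro emeasure_clock_race[where cmp = "(<)"]) (auto intro: less_imp_le)
    also have "1 / (1 + (\<Sum>i\<in>S. x i / x j)) = x j / (x j + sum x S)"
      using True s0 by (simp add: sum_divide_distrib[symmetric] field_simps)
    finally show ?thesis .
  next
    case False then show ?thesis using x by (simp add: V_def)
  qed
  have "0 < v + sum x S" "0 < v / (v + sum x S)" using v0 s0 by auto
  \<comment> \<open>A non-measurable set would have \<open>emeasure\<close> 0, so measurability
    follows from the positive value just computed.\<close>
  then have setW: "W \<in> sets ?P"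
    using EW emeasure_notin_sets[of W ?P] by (cases "W \<in> sets ?P") auto
  have setV: "V \<in> sets ?P"
  proof (cases "0 < x j")
    case True
    then have "0 < x j / (x j + sum x S)" using s0 by auto
    then show ?thesis using EV emeasure_notin_sets[of V ?P] by (cases "V \<in> sets ?P") auto
  qed (simp add: V_def)
  have AEj: "AE E in ?P. 0 \<le> E j"
    using AE_PiM_component[of J "\<lambda>_. exponential_measure 1" j "\<lambda>u. 0 \<le> u"] AE_exponential_measure J
      prob_space_exponential_measure[of 1] by auto
  have sub: "AE E in ?P. E \<in> V \<longrightarrow> E \<in> W"
    using AEj
  proof eventually_elim
    fix E :: "nat \<Rightarrow> real" assume E: "0 \<le> E j"
    show "E \<in> V \<longrightarrow> E \<in> W"
    proof
      assume "E \<in> V"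
      then have xj: "0 < x j" and E': "E \<in> space ?P" "\<And>i. i \<in> S \<Longrightarrow> x i / x j * E j < E i"
        by (auto simp: V_def split: if_splits)
      have "x i / v * E j \<le> E i" if "i \<in> S" for i
      proof -
        have "x i / v \<le> x i / x j" using xj v x(1)[OF that] by (intro divide_left_mono) auto
        then have "x i / v * E j \<le> x i / x j * E j" using E by (rule mult_right_mono)
        with E'(2)[OF that] show ?thesis by simp
      qed
      then show "E \<in> W" using E' by (auto simp: W_def)
    qed
  qed
  have "(\<integral>\<^sup>+E. of_bool (arg_min_on (\<lambda>i. E i / (x i / s)) A \<noteq> arg_min_on (\<lambda>i. E i / (y i / s')) (insert j S)) \<partial>?P)
     \<le> (\<integral>\<^sup>+E. indicator (W - V) E \<partial>?P)"
  proof (intro nn_integral_mono_AE, use AEj AE_space in eventually_elim)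
    fix E :: "nat \<Rightarrow> real" assume E: "0 \<le> E j" "E \<in> space ?P"
    show "of_bool (arg_min_on (\<lambda>i. E i / (x i / s)) A \<noteq> arg_min_on (\<lambda>i. E i / (y i / s')) (insert j S))
      \<le> (indicator (W - V) E :: ennreal)"
    proof (cases "E \<in> W - V")
      case False
      then have "(0 < x j \<and> (\<forall>i\<in>S. x i / x j * E j < E i)) \<or> \<not> (\<forall>i\<in>S. x i / y j * E j \<le> E i)"
        using E y by (auto simp: W_def V_def split: if_splits)
      then have "arg_min_on (\<lambda>i. E i / (x i / s)) A = arg_min_on (\<lambda>i. E i / (y i / s')) (insert j S)"
        using J x v s y E by (intro arg_min_race_cong A) auto
      then show ?thesis by simp
    qed simp
  qed
  also have "\<dots> = emeasure ?P (W - V)" using setW setV by simp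
  also have "\<dots> = ennreal (measure ?P W - measure ?P V)"
  proof -
    have "emeasure ?P (W - V) = emeasure ?P (W - (V \<inter> W))" by (simp add: Diff_Int)
    also have "\<dots> = emeasure ?P W - emeasure ?P (V \<inter> W)"
      using setW setV by (intro emeasure_Diff) auto
    also have "emeasure ?P (V \<inter> W) = emeasure ?P V"
      using sub setW setV by (intro emeasure_eq_AE) auto
    also have "emeasure ?P W - emeasure ?P V = ennreal (measure ?P W - measure ?P V)"
      by (simp add: P.emeasure_eq_measure ennreal_minus)
    finally show ?thesis .
  qed
  also have "measure ?P W = v / (v + sum x S)" using EW v0 s0 by (simp add: measure_def)
  also have "measure ?P V = x j / (x j + sum x S)" using EV x s0 by (simp add: measure_def)
  \<comment> \<open>The second factor is the probability that \<open>j\<close> loses with its new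
    weight; it is bounded by 1.\<close>
  also have "v / (v + sum x S) - x j / (x j + sum x S)
      = ((v - x j) / (sum x S + x j)) * (sum x S / (v + sum x S))"
    using pos v0 s0 by (simp add: field_simps)
  also have "\<dots> \<le> ((v - x j) / (sum x S + x j)) * 1"
    using pos v0 s0 v by (intro mult_left_mono) auto
  finally show ?thesis by (simp add: ennreal_leI)
qed

lemma clock_sample_nonempty_eq:
  assumes "\<And>i. p i > 0 \<Longrightarrow> i \<in> {1..n} \<Longrightarrow> i \<in> A" "A \<subseteq> {1..n}" "\<And>i. i \<in> A \<Longrightarrow> p i = q i" "\<And>i. i \<in> A \<Longrightarrow> q i > 0"
  shows "clock_sample n E p = {arg_min_on (\<lambda>i. E i / q i) A}"
proof -
  have "{i \<in> {1..n}. p i > 0} = A" using assms by auto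
  moreover have "arg_min_on (\<lambda>i. E i / p i) A = arg_min_on (\<lambda>i. E i / q i) A"
    using assms(3) by (intro arg_min_on_cong) (auto simp: is_arg_min_def)
  ultimately show ?thesis by (simp add: clock_sample_def)
qed

text \<open>The choice made by \<open>arg_min_on\<close> is unspecified, but it is a function of the
  set of minimisers, and this finite random set is measurable.\<close>

lemma measurable_clock_sample:
  fixes Er :: "'a \<Rightarrow> nat \<Rightarrow> real"
  assumes "\<And>i. i \<in> {1..n} \<Longrightarrow> (\<lambda>\<omega>. Er \<omega> i) \<in> borel_measurable M"
  shows "(\<lambda>\<omega>. clock_sample n (Er \<omega>) p) \<in> measurable M (count_space UNIV)"
proof -
  define A where "A = {i \<in> {1..n}. p i > 0}"
  have A: "finite A" "A \<subseteq> {1..n}" by (auto simp: A_def)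
  define F where "F = (\<lambda>\<omega>. {i. is_arg_min (\<lambda>i. Er \<omega> i / p i) (\<lambda>i. i \<in> A) i})"
  have "F \<in> measurable M (count_space UNIV)"
  proof (rule measurable_set_valued[OF A(1)])
    fix c assume c: "c \<in> A"
    have [measurable]: "(\<lambda>\<omega>. Er \<omega> i / p i) \<in> borel_measurable M" if "i \<in> A" for i
      using assms[of i] that A by auto
    have "(\<lambda>\<omega>. c \<in> F \<omega>) = (\<lambda>\<omega>. \<forall>k\<in>A. Er \<omega> c / p c \<le> Er \<omega> k / p k)"
      using c by (auto simp: F_def is_arg_min_linorder)
    also have "Measurable.pred M \<dots>"
      using A c by (intro pred_intros_finite) measurable
    finally show "Measurable.pred M (\<lambda>\<omega>. c \<in> F \<omega>)" .
  qed (auto simp: F_def is_arg_min_def)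
  from measurable_compose[OF this, of "\<lambda>Q. {SOME i. i \<in> Q}" "count_space UNIV"]
  show ?thesis by (simp add: F_def clock_sample_def arg_min_on_def arg_min_def A_def)
qed

subsection \<open>The composed algorithm as a function of its discrete randomness\<close>

text \<open>The shift \<open>\<sigma>\<close> enters only through the set \<open>L\<close> of large elements. A slot is occupied by an element
  \<open>Inl i\<close> with \<open>i \<in> L\<close> or by a bucket \<open>Inr b\<close>, and \<open>case_sum C R\<close> places it.\<close>

definition members :: "nat \<Rightarrow> (nat \<Rightarrow> real) \<Rightarrow> nat set \<Rightarrow> (nat \<Rightarrow> nat) \<Rightarrow> nat \<Rightarrow> nat set" where
  "members n x L \<beta> b = {i \<in> {1..n}. 0 < x i \<and> i \<notin> L \<and> \<beta> i = b}"

definition load :: "nat \<Rightarrow> (nat \<Rightarrow> real) \<Rightarrow> nat set \<Rightarrow> (nat \<Rightarrow> nat) \<Rightarrow> nat \<Rightarrow> real" where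
  "load n x L \<beta> b = (\<Sum>i\<in>members n x L \<beta> b. x i)"

definition collision :: "nat \<Rightarrow> nat set \<Rightarrow> (nat \<Rightarrow> nat) \<Rightarrow> (nat \<Rightarrow> nat) \<Rightarrow> bool" where
  "collision m L R C \<longleftrightarrow> \<not> inj_on (case_sum C R) (L <+> {1..m})"

definition overflow :: "nat \<Rightarrow> nat \<Rightarrow> (nat \<Rightarrow> real) \<Rightarrow> nat set \<Rightarrow> (nat \<Rightarrow> nat) \<Rightarrow> real \<Rightarrow> bool" where
  "overflow n m x L \<beta> \<tau> \<longleftrightarrow> (\<exists>b\<in>{1..m}. load n x L \<beta> b > 1 - \<tau>)"

definition slot_weight :: "nat \<Rightarrow> (nat \<Rightarrow> real) \<Rightarrow> nat set \<Rightarrow> (nat \<Rightarrow> nat) \<Rightarrow> nat + nat \<Rightarrow> real" where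
  "slot_weight n x L \<beta> = case_sum x (load n x L \<beta>)"

text \<open>One sum over all occupants instead of one for buckets and one for elements: raising a
  coordinate without a change of status then alters a single summand.\<close>

definition xhat :: "nat \<Rightarrow> nat \<Rightarrow> nat \<Rightarrow> (nat \<Rightarrow> real) \<Rightarrow> nat set \<Rightarrow> (nat \<Rightarrow> nat) \<Rightarrow> (nat \<Rightarrow> nat) \<Rightarrow> (nat \<Rightarrow> nat) \<Rightarrow> nat \<Rightarrow> real" where
  "xhat n m d x L R C \<beta> = (\<lambda>l\<in>{1..d}. \<Sum>p\<in>L <+> {1..m}. if case_sum C R p = l then slot_weight n x L \<beta> p else 0)"

definition rep :: "nat \<Rightarrow> (nat \<Rightarrow> real) \<Rightarrow> nat set \<Rightarrow> (nat \<Rightarrow> nat) \<Rightarrow> (nat \<Rightarrow> real) \<Rightarrow> nat \<Rightarrow> nat set" where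
  "rep n x L \<beta> E b = clock_sample n E
     (\<lambda>i\<in>{1..n}. if i \<in> members n x L \<beta> b then x i / load n x L \<beta> b else 0)"

text \<open>For a bucket of load 0, \<open>rep\<close> would be an arbitrary choice from the empty
  set, hence the case distinction.\<close>

definition slot_items :: "nat \<Rightarrow> (nat \<Rightarrow> real) \<Rightarrow> nat set \<Rightarrow> (nat \<Rightarrow> nat) \<Rightarrow> (nat \<Rightarrow> real) \<Rightarrow> nat + nat \<Rightarrow> nat set" where
  "slot_items n x L \<beta> E = case_sum (\<lambda>i. {i}) (\<lambda>b. if 0 < load n x L \<beta> b then rep n x L \<beta> E b else {})"

text \<open>The set \<open>T\<close> of selected slots is a parameter, so that a change of the
  output can be split into a change of the selection and a change of what the slots contain.\<close>

definition main_out :: "nat \<Rightarrow> nat \<Rightarrow> (nat \<Rightarrow> real) \<Rightarrow> nat set \<Rightarrow> (nat \<Rightarrow> nat) \<Rightarrow> (nat \<Rightarrow> nat) \<Rightarrow> (nat \<Rightarrow> nat) \<Rightarrow> (nat \<Rightarrow> real) \<Rightarrow> nat set \<Rightarrow> nat set" where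
  "main_out n m x L R C \<beta> E T = (\<Union>p\<in>{p \<in> L <+> {1..m}. case_sum C R p \<in> T}. slot_items n x L \<beta> E p)"

definition fallback :: "nat \<Rightarrow> nat \<Rightarrow> (nat \<Rightarrow> real) \<Rightarrow> (nat \<Rightarrow> nat) \<Rightarrow> (nat \<Rightarrow> nat) \<Rightarrow> (nat \<Rightarrow> nat) \<Rightarrow> real \<Rightarrow> real \<Rightarrow> bool" where
  "fallback n m x R C \<beta> \<sigma> \<tau> \<longleftrightarrow>
     collision m (large_set n \<sigma> x) R C \<or> overflow n m x (large_set n \<sigma> x) \<beta> \<tau>"

lemma finite_members [simp]: "finite (members n x L \<beta> b)"
  by (simp add: members_def)

lemma finite_large_set [simp]: "finite (large_set n \<sigma> x)"
  by (simp add: large_set_def)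

lemma load_nonneg: "0 \<le> load n x L \<beta> b"
  unfolding load_def by (intro sum_nonneg) (auto simp: members_def)

lemma load_pos_iff: "0 < load n x L \<beta> b \<longleftrightarrow> members n x L \<beta> b \<noteq> {}"
proof
  assume "members n x L \<beta> b \<noteq> {}"
  then show "0 < load n x L \<beta> b"
    unfolding load_def by (intro sum_pos) (auto simp: members_def)
qed (auto simp: load_def)

lemma rep_eq:
  assumes "0 < load n x L \<beta> b"
  shows "rep n x L \<beta> E b = {arg_min_on (\<lambda>i. E i / (x i / load n x L \<beta> b)) (members n x L \<beta> b)}"
  unfolding rep_def using assms
  by (intro clock_sample_nonempty_eq) (auto simp: members_def split: if_splits)

lemma arg_min_on_members:
  assumes "0 < load n x L \<beta> b"
  shows "arg_min_on (f :: nat \<Rightarrow> real) (members n x L \<beta> b) \<in> members n x L \<beta> b"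
  using assms arg_min_if_finite(1)[OF finite_members] by (simp add: load_pos_iff)

lemma slot_items_subset:
  assumes "L \<subseteq> {1..n}" "p \<in> L <+> {1..m}"
  shows "slot_items n x L \<beta> E p \<subseteq> {1..n}"
proof (cases p)
  case (Inr b)
  have "members n x L \<beta> b \<subseteq> {1..n}" by (auto simp: members_def)
  then have "arg_min_on f (members n x L \<beta> b) \<in> {1..n}" if "0 < load n x L \<beta> b" for f :: "nat \<Rightarrow> real"
    using arg_min_on_members[OF that] by blast
  with Inr show ?thesis
    unfolding slot_items_def by (simp add: rep_eq del: atLeastAtMost_iff)
qed (use assms in \<open>auto simp: slot_items_def\<close>)

lemma card_slot_items: "card (slot_items n x L \<beta> E p) \<le> 1"
  by (cases p) (auto simp: slot_items_def rep_eq)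

lemma finite_slot_items [simp]: "finite (slot_items n x L \<beta> E p)"
  by (cases p) (auto simp: slot_items_def rep_eq)

lemma main_out_subset:
  assumes "L \<subseteq> {1..n}"
  shows "main_out n m x L R C \<beta> E T \<subseteq> {1..n}"
  unfolding main_out_def by (intro UN_least slot_items_subset assms) auto

lemma ALG_eq:
  fixes n k \<alpha>
  defines "m \<equiv> num_buckets k \<alpha>" and "d \<equiv> num_slots k \<alpha>"
  shows "ALG n k \<alpha> t (f, E, \<theta>, \<theta>r, R, C, \<beta>, \<sigma>, \<tau>) x =
    (if fallback n m x R C \<beta> \<sigma> \<tau> then f x
     else main_out n m x (large_set n \<sigma> x) R C \<beta> E
       (tree_sample t \<theta> \<theta>r (xhat n m d x (large_set n \<sigma> x) R C \<beta>)))"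
proof -
  define L where "L = large_set n \<sigma> x"
  have mem: "{i \<in> small_set n \<sigma> x. \<beta> i = b} = members n x L \<beta> b" for b
    by (auto simp: members_def small_set_def L_def large_set_def)
  have ld: "(\<Sum>i\<in>members n x L \<beta> b. x i) = load n x L \<beta> b" for b
    by (simp add: load_def)
  have finL: "finite L" by (simp add: L_def)
  \<comment> \<open>Buckets of load 0 add nothing, so the restriction to positive loads
    disappears.\<close>
  have A: "(\<Sum>b | b \<in> {1..m} \<and> 0 < load n x L \<beta> b \<and> R b = l. load n x L \<beta> b) =
     (\<Sum>b\<in>{1..m}. if R b = l then load n x L \<beta> b else 0)" for l
  proof -
    have "(\<Sum>b | b \<in> {1..m} \<and> 0 < load n x L \<beta> b \<and> R b = l. load n x L \<beta> b) =
      (\<Sum>b\<in>{1..m} \<inter> {b. R b = l}. load n x L \<beta> b)"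
      using load_nonneg[of n x L \<beta>] by (intro sum.mono_neutral_left) (auto simp: less_le)
    then show ?thesis by (simp add: sum.If_cases)
  qed
  have B: "(\<Sum>i | i \<in> L \<and> C i = l. x i) = (\<Sum>i\<in>L. if C i = l then x i else 0)" for l
    using finL by (simp add: sum.inter_filter)
  have xh: "(\<lambda>l\<in>{1..d}. (\<Sum>b | b \<in> {1..m} \<and> 0 < load n x L \<beta> b \<and> R b = l. load n x L \<beta> b) + (\<Sum>i | i \<in> L \<and> C i = l. x i))
    = xhat n m d x L R C \<beta>"
    unfolding xhat_def A B slot_weight_def using finL by (simp add: sum.Plus add.commute comp_def cong: if_cong)
  have out: "{i \<in> L. C i \<in> T} \<union> (\<Union>b\<in>{b \<in> {1..m}. 0 < load n x L \<beta> b \<and> R b \<in> T}. rep n x L \<beta> E b)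
    = main_out n m x L R C \<beta> E T" for T
  proof (intro equalityI subsetI)
    fix i assume "i \<in> {i \<in> L. C i \<in> T} \<union> (\<Union>b\<in>{b \<in> {1..m}. 0 < load n x L \<beta> b \<and> R b \<in> T}. rep n x L \<beta> E b)"
    then consider "i \<in> L" "C i \<in> T" | b where "b \<in> {1..m}" "0 < load n x L \<beta> b" "R b \<in> T" "i \<in> rep n x L \<beta> E b"
      by auto
    then show "i \<in> main_out n m x L R C \<beta> E T"
    proof cases
      case 1
      then show ?thesis unfolding main_out_def slot_items_def
        by (intro UN_I[of "Inl i"]) auto
    next
      case (2 b)
      then show ?thesis unfolding main_out_def slot_items_def
        by (intro UN_I[of "Inr b"]) auto
    qed
  qed (auto simp: main_out_def slot_items_def split: if_splits)
  show ?thesis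
    unfolding ALG_def fallback_def collision_def overflow_def Let_def prod.case m_def[symmetric] d_def[symmetric]
      L_def[symmetric] mem ld xh rep_def[symmetric] out by auto
qed

section \<open>Measurability of the output in the shared randomness\<close>

lemma measurable_main_out:
  assumes t: "distinct (leaves t)" and L: "L \<subseteq> {1..n}"
    and E: "\<And>i. i \<in> {1..n} \<Longrightarrow> (\<lambda>\<omega>. Er \<omega> i) \<in> borel_measurable M"
    and \<theta>: "\<theta>r \<in> borel_measurable M" "\<And>p. p \<in> inner_nodes t \<Longrightarrow> (\<lambda>\<omega>. \<theta> \<omega> p) \<in> borel_measurable M"
  shows "(\<lambda>\<omega>. main_out n m x L R C \<beta> (Er \<omega>) (tree_sample t (\<theta> \<omega>) (\<theta>r \<omega>) z)) \<in> measurable M (count_space UNIV)"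
proof (rule measurable_set_valued[of "{1..n}"])
  fix i
  have [measurable]: "Measurable.pred M (\<lambda>\<omega>. c \<in> tree_sample t (\<theta> \<omega>) (\<theta>r \<omega>) z)" for c
    using assms by (intro measurable_tree_sample)
  have "Measurable.pred M (\<lambda>\<omega>. i \<in> slot_items n x L \<beta> (Er \<omega>) p)" for p
  proof (cases p)
    case (Inr b)
    have "(\<lambda>\<omega>. rep n x L \<beta> (Er \<omega>) b) \<in> measurable M (count_space UNIV)"
      unfolding rep_def using E by (rule measurable_clock_sample)
    from measurable_compose[OF this, of "\<lambda>Q. i \<in> Q" "count_space UNIV"] show ?thesis
      by (simp add: Inr slot_items_def)
  qed (simp add: slot_items_def)
  then have "Measurable.pred M (\<lambda>\<omega>. \<exists>p\<in>L <+> {1..m}. case_sum C R p \<in> tree_sample t (\<theta> \<omega>) (\<theta>r \<omega>) z \<and> i \<in> slot_items n x L \<beta> (Er \<omega>) p)"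
    using L finite_subset[of L "{1..n}"] by (intro pred_intros_finite pred_intros_logic) auto
  then show "Measurable.pred M (\<lambda>\<omega>. i \<in> main_out n m x L R C \<beta> (Er \<omega>) (tree_sample t (\<theta> \<omega>) (\<theta>r \<omega>) z))"
    unfolding main_out_def UN_iff mem_Collect_eq Bex_def conj_assoc .
qed (use main_out_subset[OF L] in auto)

abbreviation uniform_funs :: "'i set \<Rightarrow> nat set \<Rightarrow> ('i \<Rightarrow> nat) measure" where
  "uniform_funs I B \<equiv> \<Pi>\<^sub>M i\<in>I. uniform_count_measure B"

text \<open>There are only finitely many hash functions, so their product space is discrete and
  every function of R, C or \<beta> is measurable.\<close>

lemma sets_PiM_uniform_count:
  assumes "finite I" "finite B"
  shows "sets (uniform_funs I B) = Pow (I \<rightarrow>\<^sub>E B)"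
proof -
  have "sets (uniform_funs I B) = sets (\<Pi>\<^sub>M i\<in>I. count_space B)"
    by (intro sets_PiM_cong) (auto simp: sets_uniform_count_measure)
  also have "(\<Pi>\<^sub>M i\<in>I. count_space B) = count_space (I \<rightarrow>\<^sub>E B)"
    using assms by (intro count_space_PiM_finite) (auto intro: countable_finite)
  finally show ?thesis by simp
qed

lemma space_PiM_uniform_count: "space (uniform_funs I B) = (I \<rightarrow>\<^sub>E B)"
  by (simp add: space_PiM space_uniform_count_measure)

lemma measurable_from_PiM_uniform_count:
  assumes "finite I" "finite B"
  shows "measurable (uniform_funs I B) N = measurable (count_space (I \<rightarrow>\<^sub>E B)) N"
  using sets_PiM_uniform_count[OF assms] by (intro measurable_cong_sets) auto

lemma measurable_large_set:
  assumes [measurable]: "\<sigma> \<in> borel_measurable M"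
  shows "(\<lambda>\<omega>. large_set n (\<sigma> \<omega>) x) \<in> measurable M (count_space UNIV)"
proof (rule measurable_set_valued[of "{1..n}"])
  fix c assume "c \<in> {1..n}"
  then have "(\<lambda>\<omega>. c \<in> large_set n (\<sigma> \<omega>) x) = (\<lambda>\<omega>. 1 / 10 + \<sigma> \<omega> < x c)"
    by (auto simp: large_set_def)
  then show "Measurable.pred M (\<lambda>\<omega>. c \<in> large_set n (\<sigma> \<omega>) x)" by simp
qed (auto simp: large_set_def)

lemma measurable_eval:
  assumes "correlated_sampling n k A" "x \<in> Delta n k"
  shows "(\<lambda>f. f x) \<in> measurable A (count_space UNIV)" "\<And>f. f \<in> space A \<Longrightarrow> f x \<subseteq> {1..n}"
proof -
  have A': "sets A = sets (\<Pi>\<^sub>M x\<in>Delta n k. count_space (Pow {1..n}))"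
    using assms by (auto simp: correlated_sampling_def)
  have "(\<lambda>f. f x) \<in> measurable (\<Pi>\<^sub>M x\<in>Delta n k. count_space (Pow {1..n})) (count_space (Pow {1..n}))"
    using assms(2) by (rule measurable_component_singleton)
  then have ev: "(\<lambda>f. f x) \<in> measurable A (count_space (Pow {1..n}))"
    using measurable_cong_sets[OF A' refl] by blast
  from measurable_compose[OF ev, of "\<lambda>x. x" "count_space UNIV"]
  show "(\<lambda>f. f x) \<in> measurable A (count_space UNIV)" by simp
  show "f x \<subseteq> {1..n}" if "f \<in> space A" for f
    using measurable_space[OF ev that] by auto
qed

text \<open>The hashing and \<sigma> enter only through the tuple (R, C, \<beta>, L), which has
  finitely many values. For each value the output is measurable in the remaining variables, and the
  pieces are glued along this finite partition.\<close>

lemma measurable_ALG: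
  assumes A: "correlated_sampling n k A" and t: "distinct (leaves t)" and x: "x \<in> Delta n k"
  shows "(\<lambda>\<omega>. ALG n k \<alpha> t \<omega> x) \<in> measurable (shared_randomness n k \<alpha> A t) (count_space UNIV)"
    and "\<And>\<omega>. \<omega> \<in> space (shared_randomness n k \<alpha> A t) \<Longrightarrow> ALG n k \<alpha> t \<omega> x \<subseteq> {1..n}"
proof -
  define m d where "m = num_buckets k \<alpha>" and "d = num_slots k \<alpha>"
  let ?M = "shared_randomness n k \<alpha> A t"
  define F1 where "F1 = (\<lambda>\<omega> :: randomness. fst \<omega>)"
  define F2 where "F2 = (\<lambda>\<omega> :: randomness. fst (snd \<omega>))"
  define F3 where "F3 = (\<lambda>\<omega> :: randomness. fst (snd (snd \<omega>)))"
  define F4 where "F4 = (\<lambda>\<omega> :: randomness. fst (snd (snd (snd \<omega>))))"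
  define F5 where "F5 = (\<lambda>\<omega> :: randomness. fst (snd (snd (snd (snd \<omega>)))))"
  define F6 where "F6 = (\<lambda>\<omega> :: randomness. fst (snd (snd (snd (snd (snd \<omega>))))))"
  define F7 where "F7 = (\<lambda>\<omega> :: randomness. fst (snd (snd (snd (snd (snd (snd \<omega>)))))))"
  define F8 where "F8 = (\<lambda>\<omega> :: randomness. fst (snd (snd (snd (snd (snd (snd (snd \<omega>))))))))"
  define F9 where "F9 = (\<lambda>\<omega> :: randomness. snd (snd (snd (snd (snd (snd (snd (snd \<omega>))))))))"
  note Fs = F1_def F2_def F3_def F4_def F5_def F6_def F7_def F8_def F9_def
  have om: "\<omega> = (F1 \<omega>, F2 \<omega>, F3 \<omega>, F4 \<omega>, F5 \<omega>, F6 \<omega>, F7 \<omega>, F8 \<omega>, F9 \<omega>)" for \<omega>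
    by (simp add: Fs)
  note M_def = shared_randomness_def Let_def m_def[symmetric] d_def[symmetric]
  have meas:
    "F1 \<in> measurable ?M A"
    "F2 \<in> measurable ?M (clocks n)"
    "F3 \<in> measurable ?M (tree_nodes t)"
    "F4 \<in> measurable ?M (uniform_real 0 1)"
    "F5 \<in> measurable ?M (uniform_funs {1..m} {1..d})"
    "F6 \<in> measurable ?M (uniform_funs {1..n} {1..d})"
    "F7 \<in> measurable ?M (uniform_funs {1..n} {1..m})"
    "F8 \<in> measurable ?M (uniform_real 0 (1/10))"
    "F9 \<in> measurable ?M (uniform_real 0 (1/10))"
    unfolding Fs M_def by measurable
  have real4: "F4 \<in> borel_measurable ?M" "F8 \<in> borel_measurable ?M" "F9 \<in> borel_measurable ?M"
    using meas(4,8,9) by (simp_all cong: measurable_cong_sets)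
  have f_sub: "F1 \<omega> x \<subseteq> {1..n}" if "\<omega> \<in> space ?M" for \<omega>
    using measurable_space[OF meas(1) that] by (rule measurable_eval(2)[OF A x])
  have f_meas: "(\<lambda>\<omega>. F1 \<omega> x) \<in> measurable ?M (count_space UNIV)"
    using meas(1) measurable_eval(1)[OF A x] by (rule measurable_compose)
  have E_meas: "(\<lambda>\<omega>. F2 \<omega> i) \<in> borel_measurable ?M" if "i \<in> {1..n}" for i
    using measurable_compose[OF meas(2) measurable_component_singleton[OF that]]
    by (simp cong: measurable_cong_sets)
  have \<theta>_meas: "(\<lambda>\<omega>. F3 \<omega> i) \<in> borel_measurable ?M" if "i \<in> inner_nodes t" for i
    using measurable_compose[OF meas(3) measurable_component_singleton[OF that]]
    by (simp cong: measurable_cong_sets)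
  define D where "D = ({1..m} \<rightarrow>\<^sub>E {1..d}) \<times> ({1..n} \<rightarrow>\<^sub>E {1..d}) \<times> ({1..n} \<rightarrow>\<^sub>E {1..m}) \<times> Pow {1..n}"
  have "finite D" by (auto simp: D_def intro!: finite_PiE)
  define disc where "disc = (\<lambda>\<omega>. (F5 \<omega>, F6 \<omega>, F7 \<omega>, large_set n (F8 \<omega>) x))"
  have discD: "disc \<omega> \<in> D" if "\<omega> \<in> space ?M" for \<omega>
    using measurable_space[OF meas(5) that] measurable_space[OF meas(6) that] measurable_space[OF meas(7) that]
    by (auto simp: D_def disc_def space_PiM_uniform_count large_set_def)
  have to_count: "F \<in> measurable ?M (count_space UNIV)"
    if "F \<in> measurable ?M (uniform_funs I B)" "finite I" "finite B" for F :: "randomness \<Rightarrow> nat \<Rightarrow> nat" and I B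
    using measurable_compose[OF that(1), of "\<lambda>x. x" "count_space UNIV"] that
    by (simp add: measurable_from_PiM_uniform_count)
  have m5: "F5 \<in> measurable ?M (count_space UNIV)" "F6 \<in> measurable ?M (count_space UNIV)"
    "F7 \<in> measurable ?M (count_space UNIV)"
    using to_count[OF meas(5)] to_count[OF meas(6)] to_count[OF meas(7)] by auto
  have disc_meas: "disc \<in> measurable ?M (count_space D)"
  proof (subst measurable_count_space_eq2[OF \<open>finite D\<close>], intro conjI ballI funcsetI discD)
    fix q assume "q \<in> D"
    obtain R C \<beta> L where q: "q = (R, C, \<beta>, L)" by (cases q)
    note m5[measurable] measurable_large_set[OF real4(2), measurable]
    have "disc -` {q} \<inter> space ?M = {\<omega> \<in> space ?M. F5 \<omega> = R \<and> F6 \<omega> = C \<and> F7 \<omega> = \<beta> \<and> large_set n (F8 \<omega>) x = L}"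
      by (auto simp: disc_def q)
    also have "\<dots> \<in> sets ?M" by measurable
    finally show "disc -` {q} \<inter> space ?M \<in> sets ?M" .
  qed
  define G where "G = (\<lambda>(R, C, \<beta>, L) \<omega>. if collision m L R C \<or> overflow n m x L \<beta> (F9 \<omega>) then F1 \<omega> x
     else main_out n m x L R C \<beta> (F2 \<omega>) (tree_sample t (F3 \<omega>) (F4 \<omega>) (xhat n m d x L R C \<beta>)))"
  have ALG_G: "ALG n k \<alpha> t \<omega> x = G (disc \<omega>) \<omega>" for \<omega>
    by (subst om) (simp add: ALG_eq G_def disc_def fallback_def m_def d_def)
  have "(\<lambda>\<omega>. G (disc \<omega>) \<omega>) \<in> measurable ?M (count_space UNIV)"
  proof (rule measurable_compose_countable'[OF _ disc_meas])
    fix q assume q: "q \<in> D"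
    obtain R C \<beta> L where q': "q = (R, C, \<beta>, L)" by (cases q)
    have L: "L \<subseteq> {1..n}" using q by (auto simp: q' D_def)
    note real4[measurable]
    have ov: "Measurable.pred ?M (\<lambda>\<omega>. collision m L R C \<or> overflow n m x L \<beta> (F9 \<omega>))"
      unfolding overflow_def by measurable
    have main: "(\<lambda>\<omega>. main_out n m x L R C \<beta> (F2 \<omega>) (tree_sample t (F3 \<omega>) (F4 \<omega>) (xhat n m d x L R C \<beta>)))
       \<in> measurable ?M (count_space UNIV)"
      using t L E_meas real4(1) \<theta>_meas by (rule measurable_main_out)
    show "G q \<in> measurable ?M (count_space UNIV)"
      unfolding G_def q' prod.case
      using f_meas main ov by (intro measurable_If) (auto simp: pred_def)
  qed (use \<open>finite D\<close> in \<open>rule countable_finite\<close>)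
  then show "(\<lambda>\<omega>. ALG n k \<alpha> t \<omega> x) \<in> measurable ?M (count_space UNIV)"
    by (simp add: ALG_G)
  fix \<omega> assume w: "\<omega> \<in> space ?M"
  have "main_out n m x (large_set n (F8 \<omega>) x) R C \<beta> E T \<subseteq> {1..n}" for R C \<beta> E T
    by (rule main_out_subset) (auto simp: large_set_def)
  then show "ALG n k \<alpha> t \<omega> x \<subseteq> {1..n}"
    unfolding ALG_G G_def disc_def using f_sub[OF w] by (simp split: if_splits)
qed

section \<open>Range and total mass of the input of the tree sampler\<close>

lemma xhat_nonneg:
  assumes "\<And>i. i \<in> L \<Longrightarrow> 0 \<le> x i" "l \<in> {1..d}"
  shows "0 \<le> xhat n m d x L R C \<beta> l"
  using assms by (auto simp: xhat_def slot_weight_def load_nonneg split: sum.splits intro!: sum_nonneg)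

text \<open>Without a collision a slot has at most one occupant, and its weight is an entry of
  \<open>x\<close> or a load that does not exceed 1 - \<tau>.\<close>

lemma xhat_le_1:
  assumes "\<not> collision m L R C" "\<not> overflow n m x L \<beta> \<tau>" "0 \<le> \<tau>" "finite L" "\<And>i. i \<in> L \<Longrightarrow> x i \<le> 1" "l \<in> {1..d}"
  shows "xhat n m d x L R C \<beta> l \<le> 1"
proof -
  have w: "slot_weight n x L \<beta> p \<le> 1" if "p \<in> L <+> {1..m}" for p
    using that assms(2,3,5) by (force simp: slot_weight_def overflow_def not_less split: sum.splits)
  define P where "P = (L <+> {1..m}) \<inter> {p. case_sum C R p = l}"
  have "finite P" using assms by (simp add: P_def)
  have "card P \<le> 1"
  proof (rule card_le_Suc0_iff_eq[THEN iffD2, OF \<open>finite P\<close>, folded One_nat_def], intro ballI)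
    fix p q assume "p \<in> P" "q \<in> P"
    then show "p = q" using assms(1) unfolding collision_def P_def inj_on_def by auto
  qed
  have "xhat n m d x L R C \<beta> l = (\<Sum>p\<in>P. slot_weight n x L \<beta> p)"
    using assms by (simp add: xhat_def P_def sum.If_cases)
  also have "\<dots> \<le> (\<Sum>p\<in>P. 1)" using w by (intro sum_mono) (auto simp: P_def)
  also have "\<dots> \<le> 1" using \<open>card P \<le> 1\<close> by simp
  finally show ?thesis .
qed

lemma sum_load:
  assumes "\<beta> \<in> {1..n} \<rightarrow> {1..m}"
  shows "(\<Sum>b\<in>{1..m}. load n x L \<beta> b) = (\<Sum>i\<in>{i \<in> {1..n}. 0 < x i \<and> i \<notin> L}. x i)"
proof -
  have "(\<Sum>b\<in>{1..m}. load n x L \<beta> b) = (\<Sum>b\<in>{1..m}. \<Sum>i | i \<in> {i \<in> {1..n}. 0 < x i \<and> i \<notin> L} \<and> \<beta> i = b. x i)"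
    unfolding load_def members_def by (intro sum.cong refl) auto
  also have "\<dots> = (\<Sum>i\<in>{i \<in> {1..n}. 0 < x i \<and> i \<notin> L}. x i)"
    using assms by (intro sum.group) auto
  finally show ?thesis .
qed

text \<open>Every element is counted once, in its own slot or through its bucket, whether or not
  slots collide. This bounds the expected number of selected slots by k.\<close>

lemma sum_xhat:
  assumes "\<And>i. i \<in> {1..n} \<Longrightarrow> 0 \<le> x i" "L \<subseteq> {1..n}" "\<beta> \<in> {1..n} \<rightarrow> {1..m}"
    and "R \<in> {1..m} \<rightarrow> {1..d}" "C \<in> {1..n} \<rightarrow> {1..d}"
  shows "(\<Sum>l\<in>{1..d}. xhat n m d x L R C \<beta> l) = (\<Sum>i\<in>{1..n}. x i)"
proof -
  have finL: "finite L" by (rule finite_subset[OF assms(2)]) simp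
  have "(\<Sum>l\<in>{1..d}. xhat n m d x L R C \<beta> l)
      = (\<Sum>p\<in>L <+> {1..m}. \<Sum>l\<in>{1..d}. if case_sum C R p = l then slot_weight n x L \<beta> p else 0)"
    unfolding xhat_def by (subst sum.swap) (simp only: restrict_apply' cong: sum.cong)
  also have "\<dots> = (\<Sum>p\<in>L <+> {1..m}. slot_weight n x L \<beta> p)"
  proof (intro sum.cong refl)
    fix p assume "p \<in> L <+> {1..m}"
    then have "case_sum C R p \<in> {1..d}" using assms by (auto split: sum.splits)
    then show "(\<Sum>l\<in>{1..d}. if case_sum C R p = l then slot_weight n x L \<beta> p else 0) = slot_weight n x L \<beta> p"
      by simp
  qed
  also have "\<dots> = (\<Sum>i\<in>L. x i) + (\<Sum>b\<in>{1..m}. load n x L \<beta> b)"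
    using finL by (simp add: sum.Plus slot_weight_def comp_def)
  also have "\<dots> = (\<Sum>i\<in>L. x i) + (\<Sum>i\<in>{1..n} - L. x i)"
  proof -
    have "(\<Sum>i\<in>{i \<in> {1..n}. 0 < x i \<and> i \<notin> L}. x i) = (\<Sum>i\<in>{1..n} - L. x i)"
      using assms(1) by (intro sum.mono_neutral_left) (auto simp: less_le)
    then show ?thesis using sum_load[OF assms(3)] by simp
  qed
  also have "\<dots> = (\<Sum>i\<in>{1..n}. x i)"
    using sum.subset_diff[OF assms(2), of x] by simp
  finally show ?thesis .
qed

subsection \<open>Expected change for fixed hashing randomness\<close>

text \<open>An element of the difference comes either from a slot whose selection changed, which
  costs at most two elements, or from a slot selected both times whose contents changed. In the
  second case only selection under \<open>T\<close> is recorded, and its probability is a marginal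
  of the tree sampler.\<close>

lemma card_sym_diff_UN:
  assumes P: "finite P" "inj_on \<kappa> P" and T: "finite T" "finite T'" and V: "V \<subseteq> P"
    and g: "\<And>p. p \<in> P \<Longrightarrow> finite (g p) \<and> card (g p) \<le> 1" and h: "\<And>p. p \<in> P \<Longrightarrow> finite (h p) \<and> card (h p) \<le> 1"
    and eq: "\<And>p. p \<in> P - V \<Longrightarrow> g p = h p"
  shows "card (sym_diff (\<Union>p\<in>{p \<in> P. \<kappa> p \<in> T}. g p) (\<Union>p\<in>{p \<in> P. \<kappa> p \<in> T'}. h p))
    \<le> 2 * card (sym_diff T T') + (\<Sum>p\<in>V. if \<kappa> p \<in> T then card (sym_diff (g p) (h p)) else 0)"
proof -
  define Q where "Q = {p \<in> P. \<kappa> p \<in> sym_diff T T'}"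
  define W where "W = {p \<in> V. \<kappa> p \<in> T}"
  have finV: "finite V" by (rule finite_subset[OF V P(1)])
  then have fin: "finite V" "finite Q" "finite W"
    using P by (auto simp: Q_def W_def)
  have "card Q \<le> card (sym_diff T T')"
  proof (rule card_inj_on_le)
    show "inj_on \<kappa> Q" using P(2) by (rule inj_on_subset) (auto simp: Q_def)
  qed (use T in \<open>auto simp: Q_def\<close>)
  moreover have "card (\<Union>p\<in>Q. g p \<union> h p) \<le> 2 * card Q"
  proof -
    have "card (g p \<union> h p) \<le> 2" if "p \<in> Q" for p
      using card_Un_le[of "g p" "h p"] g[of p] h[of p] that unfolding Q_def by fastforce
    then have "(\<Sum>p\<in>Q. card (g p \<union> h p)) \<le> (\<Sum>p\<in>Q. 2)" by (rule sum_mono)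
    then show ?thesis using card_UN_le[OF fin(2), of "\<lambda>p. g p \<union> h p"] by simp
  qed
  moreover have "card (\<Union>p\<in>W. sym_diff (g p) (h p)) \<le> (\<Sum>p\<in>V. if \<kappa> p \<in> T then card (sym_diff (g p) (h p)) else 0)"
  proof -
    have "(\<Sum>p\<in>W. card (sym_diff (g p) (h p))) = (\<Sum>p\<in>V. if \<kappa> p \<in> T then card (sym_diff (g p) (h p)) else 0)"
      using fin by (simp add: W_def sum.inter_filter)
    then show ?thesis using card_UN_le[OF fin(3), of "\<lambda>p. sym_diff (g p) (h p)"] by simp
  qed
  moreover have "card (sym_diff (\<Union>p\<in>{p \<in> P. \<kappa> p \<in> T}. g p) (\<Union>p\<in>{p \<in> P. \<kappa> p \<in> T'}. h p))
     \<le> card ((\<Union>p\<in>Q. g p \<union> h p) \<union> (\<Union>p\<in>W. sym_diff (g p) (h p)))"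
  proof (rule card_mono)
    show "finite ((\<Union>p\<in>Q. g p \<union> h p) \<union> (\<Union>p\<in>W. sym_diff (g p) (h p)))"
      using fin g h V by (auto simp: Q_def W_def)
    show "sym_diff (\<Union>p\<in>{p \<in> P. \<kappa> p \<in> T}. g p) (\<Union>p\<in>{p \<in> P. \<kappa> p \<in> T'}. h p)
      \<subseteq> (\<Union>p\<in>Q. g p \<union> h p) \<union> (\<Union>p\<in>W. sym_diff (g p) (h p))"
    proof
      fix e assume e: "e \<in> sym_diff (\<Union>p\<in>{p \<in> P. \<kappa> p \<in> T}. g p) (\<Union>p\<in>{p \<in> P. \<kappa> p \<in> T'}. h p)"
      show "e \<in> (\<Union>p\<in>Q. g p \<union> h p) \<union> (\<Union>p\<in>W. sym_diff (g p) (h p))"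
      proof (cases "e \<in> (\<Union>p\<in>{p \<in> P. \<kappa> p \<in> T}. g p)")
        case True
        then obtain p where p: "p \<in> P" "\<kappa> p \<in> T" "e \<in> g p" by auto
        show ?thesis
        proof (cases "\<kappa> p \<in> T'")
          case True
          then have "e \<notin> h p" using e p by auto
          moreover have "p \<in> V" using eq[of p] p \<open>e \<notin> h p\<close> by auto
          ultimately show ?thesis using p by (auto simp: W_def)
        qed (use p in \<open>auto simp: Q_def\<close>)
      next
        case False
        then obtain p where p: "p \<in> P" "\<kappa> p \<in> T'" "e \<in> h p" using e by auto
        show ?thesis
        proof (cases "\<kappa> p \<in> T")
          case True
          then have "e \<notin> g p" using False p by auto
          moreover have "p \<in> V" using eq[of p] p \<open>e \<notin> g p\<close> by auto
          ultimately show ?thesis using p True by (auto simp: W_def)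
        qed (use p in \<open>auto simp: Q_def\<close>)
      qed
    qed
  qed
  ultimately show ?thesis
    using card_Un_le[of "\<Union>p\<in>Q. g p \<union> h p" "\<Union>p\<in>W. sym_diff (g p) (h p)"] by linarith
qed

lemma card_main_out_le:
  assumes "\<not> collision m L R C" "finite L" "finite T"
  shows "card (main_out n m x L R C \<beta> E T) \<le> card T"
proof -
  define P where "P = {p \<in> L <+> {1..m}. case_sum C R p \<in> T}"
  have "finite P" using assms by (simp add: P_def)
  have "card (main_out n m x L R C \<beta> E T) \<le> (\<Sum>p\<in>P. card (slot_items n x L \<beta> E p))"
    unfolding main_out_def P_def[symmetric] using \<open>finite P\<close> by (rule card_UN_le)
  also have "\<dots> \<le> (\<Sum>p\<in>P. 1)" by (intro sum_mono card_slot_items)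
  also have "\<dots> = card P" by simp
  also have "\<dots> \<le> card T"
    using assms unfolding P_def collision_def
    by (intro card_inj_on_le[of "case_sum C R"]) (auto simp: inj_on_def)
  finally show ?thesis .
qed

text \<open>Abstract in occupants and weights, so that the update rules below serve a bucket, a
  large element and an element that just became large.\<close>

definition slot_vec :: "nat \<Rightarrow> 'p set \<Rightarrow> ('p \<Rightarrow> nat) \<Rightarrow> ('p \<Rightarrow> real) \<Rightarrow> nat \<Rightarrow> real" where
  "slot_vec d P \<kappa> w = (\<lambda>l\<in>{1..d}. \<Sum>p\<in>P. if \<kappa> p = l then w p else 0)"

lemma xhat_slot_vec: "xhat n m d x L R C \<beta> = slot_vec d (L <+> {1..m}) (case_sum C R) (slot_weight n x L \<beta>)"
  by (simp add: xhat_def slot_vec_def)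

lemma slot_vec_cong: "(\<And>p. p \<in> P \<Longrightarrow> w p = w' p) \<Longrightarrow> slot_vec d P \<kappa> w = slot_vec d P \<kappa> w'"
  unfolding slot_vec_def by (intro restrict_ext sum.cong) auto

lemma slot_vec_insert:
  assumes "finite P" "p \<notin> P" "\<kappa> p \<in> {1..d}"
  shows "slot_vec d (insert p P) \<kappa> w = (slot_vec d P \<kappa> w)(\<kappa> p := slot_vec d P \<kappa> w (\<kappa> p) + w p)"
  using assms by (auto simp: slot_vec_def fun_eq_iff restrict_def)

lemma slot_vec_change:
  assumes "finite P" "p0 \<in> P" "\<kappa> p0 \<in> {1..d}" "\<And>p. p \<in> P - {p0} \<Longrightarrow> w' p = w p"
  shows "slot_vec d P \<kappa> w' = (slot_vec d P \<kappa> w)(\<kappa> p0 := slot_vec d P \<kappa> w (\<kappa> p0) + (w' p0 - w p0))"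
proof -
  define Q where "Q = P - {p0}"
  have Q: "P = insert p0 Q" "finite Q" "p0 \<notin> Q" using assms by (auto simp: Q_def)
  have "slot_vec d Q \<kappa> w' = slot_vec d Q \<kappa> w" using assms(4) by (intro slot_vec_cong) (auto simp: Q_def)
  then show ?thesis unfolding Q(1) using Q assms(3) by (simp add: slot_vec_insert)
qed

lemma slot_vec_at:
  assumes "finite P" "p0 \<in> P" "\<kappa> p0 \<in> {1..d}" "inj_on \<kappa> P"
  shows "slot_vec d P \<kappa> w (\<kappa> p0) = w p0"
proof -
  have "(\<Sum>p\<in>P. if \<kappa> p = \<kappa> p0 then w p else 0) = (\<Sum>p\<in>P. if p = p0 then w p else 0)"
    using assms by (intro sum.cong refl) (auto simp: inj_on_def)
  then show ?thesis using assms by (simp add: slot_vec_def)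
qed

lemma measurable_tree_pair:
  fixes h :: "nat set \<Rightarrow> nat set \<Rightarrow> ennreal"
  assumes "distinct (leaves t)"
  shows "(\<lambda>\<omega>. h (tree_sel t z \<omega>) (tree_sel t z' \<omega>)) \<in> borel_measurable (tree_space t)"
proof -
  have "(\<lambda>\<omega>. h (tree_sel t z \<omega>) (tree_sel t z' \<omega>)) \<in> measurable (tree_space t) (count_space UNIV)"
    by (rule measurable_pair_finite_range[where F = "tree_sel t z" and G = "tree_sel t z'" and h = h
          and P = "Pow (set (leaves t))" and Q = "Pow (set (leaves t))"])
       (use measurable_tree_sel_count_space[OF assms] tree_sel_subset in auto)
  from measurable_compose[OF this, of "\<lambda>x. x" borel] show ?thesis by simp
qed

lemma nn_integral_card_tree_sel:
  assumes "distinct (leaves t)" "z ` set (leaves t) \<subseteq> {0..1}"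
  shows "(\<integral>\<^sup>+\<omega>. of_nat (card (tree_sel t z \<omega>)) \<partial>tree_space t) = ennreal (\<Sum>c\<in>set (leaves t). z c)"
proof -
  have "(\<integral>\<^sup>+\<omega>. of_nat (card (tree_sel t z \<omega>)) \<partial>tree_space t) = (\<integral>\<^sup>+\<omega>. ennreal (real (card (tree_sel t z \<omega>))) \<partial>tree_space t)"
    by (simp add: ennreal_of_nat_eq_real_of_nat)
  also have "\<dots> = ennreal (\<integral>\<omega>. real (card (tree_sel t z \<omega>)) \<partial>tree_space t)"
    by (rule nn_integral_eq_integral)
       (use integrable_tree_sel[OF assms(1), where h = "\<lambda>A B. real (card A)"] in auto)
  also have "(\<integral>\<omega>. real (card (tree_sel t z \<omega>)) \<partial>tree_space t) = (\<integral>\<omega>. real (card (tree_sel t z \<omega> \<inter> set (leaves t))) \<partial>tree_space t)"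
    by (simp only: Int_absorb2[OF tree_sel_subset])
  also have "\<dots> = (\<Sum>c\<in>set (leaves t). z c)"
    by (rule expectation_card_tree_sel) (use assms in auto)
  finally show ?thesis .
qed

lemma nn_integral_tree_mem:
  assumes "distinct (leaves t)" "z ` set (leaves t) \<subseteq> {0..1}" "c \<in> set (leaves t)"
  shows "(\<integral>\<^sup>+\<omega>. of_bool (c \<in> tree_sel t z \<omega>) \<partial>tree_space t) = ennreal (z c)"
proof -
  have "(\<integral>\<^sup>+\<omega>. of_bool (c \<in> tree_sel t z \<omega>) \<partial>tree_space t)
     = (\<integral>\<^sup>+\<omega>. indicator {\<omega> \<in> space (tree_space t). c \<in> tree_sel t z \<omega>} \<omega> \<partial>tree_space t)"
    by (intro nn_integral_cong) (auto split: split_indicator)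
  also have "\<dots> = ennreal (z c)"
    using measurable_tree_sel[OF assms(1)] prob_tree_sel[OF assms(1,3,2)]
    by (subst nn_integral_indicator) (auto simp: pred_def)
  finally show ?thesis .
qed

section \<open>Expectations when an input uses the given algorithm\<close>

lemma Delta_range: "x \<in> Delta n k \<Longrightarrow> i \<in> {1..n} \<Longrightarrow> 0 \<le> x i \<and> x i \<le> 1"
  by (auto simp: Delta_def PiE_iff)

lemma sum_Delta_le:
  assumes "x \<in> Delta n k"
  shows "(\<Sum>i\<in>{1..n}. x i) \<le> real k"
proof -
  have "(\<Sum>i\<in>{1..n}. x i) = l1_norm n x"
    unfolding l1_norm_def using Delta_range[OF assms] by (intro sum.cong) auto
  then show ?thesis using assms by (simp add: Delta_def)
qed

text \<open>The expectation over what remains once R, C, \<beta>, \<sigma>, \<tau> are fixed. With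
  the tree outside the clocks, the event that a slot is selected can be pulled out of the integral
  over the clocks.\<close>

definition expect_inner :: "nat \<Rightarrow> map_distr \<Rightarrow> btree \<Rightarrow>
    (((nat \<Rightarrow> real) \<Rightarrow> nat set) \<Rightarrow> (nat \<Rightarrow> real) \<Rightarrow> real \<times> (bool list \<Rightarrow> real) \<Rightarrow> ennreal) \<Rightarrow> ennreal" where
  "expect_inner n A t g = (\<integral>\<^sup>+\<omega>. \<integral>\<^sup>+E. \<integral>\<^sup>+f. g f E \<omega> \<partial>A \<partial>clocks n \<partial>tree_space t)"

lemma prob_space_clocks: "prob_space (\<Pi>\<^sub>M i\<in>I. exponential_measure 1)"
  by (intro prob_space_PiM prob_space_exponential_measure) simp

lemma nn_integral_prob_const: "prob_space M \<Longrightarrow> (\<integral>\<^sup>+x. c \<partial>M) = c"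
  by (simp add: prob_space.emeasure_space_1)

lemma expect_inner_const_f:
  assumes "prob_space A"
  shows "expect_inner n A t (\<lambda>f E \<omega>. g E \<omega>)
    = (\<integral>\<^sup>+\<omega>. \<integral>\<^sup>+E. g E \<omega> \<partial>clocks n \<partial>tree_space t)"
  unfolding expect_inner_def using nn_integral_prob_const[OF assms] by simp

lemma expect_inner_mono:
  assumes "\<And>f E \<omega>. g f E \<omega> \<le> h f E \<omega>"
  shows "expect_inner n A t g \<le> expect_inner n A t h"
  unfolding expect_inner_def by (intro nn_integral_mono assms)

lemma measurable_eval_pair:
  assumes "correlated_sampling n k A" "x \<in> Delta n k" "y \<in> Delta n k"
  shows "(\<lambda>f. h (f x) (f y)) \<in> measurable A (count_space UNIV)"
  by (rule measurable_pair_finite_range[where F = "\<lambda>f. f x" and G = "\<lambda>f. f y" and h = h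
        and P = "Pow {1..n}" and Q = "Pow {1..n}"])
     (use measurable_eval[OF assms(1)] assms in auto)

text \<open>The distance condition uses the Bochner integral, which is informative only for
  integrable functions; the bound n on the size of a difference supplies integrability.\<close>

lemma nn_integral_stretch:
  assumes A: "correlated_sampling n k A" "stretch n k \<alpha> A" and x: "x \<in> Delta n k" "y \<in> Delta n k"
  shows "(\<integral>\<^sup>+f. of_nat (card (sym_diff (f x) (f y))) \<partial>A) \<le> ennreal (\<alpha> * l1_dist n x y)"
proof -
  interpret prob_space A using A by (simp add: correlated_sampling_def)
  have m: "(\<lambda>f. real (card (sym_diff (f x) (f y)))) \<in> borel_measurable A"
    using measurable_compose[OF measurable_eval_pair[OF A(1) x, of "\<lambda>X Y. real (card (sym_diff X Y))"], of "\<lambda>x. x" borel] by simp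
  have "integrable A (\<lambda>f. real (card (sym_diff (f x) (f y))))"
  proof (rule integrable_const_bound[OF _ m])
    show "AE f in A. norm (real (card (sym_diff (f x) (f y)))) \<le> real n"
    proof (rule AE_I2)
      fix f assume "f \<in> space A"
      then have "card (sym_diff (f x) (f y)) \<le> card {1..n}"
        using measurable_eval(2)[OF A(1) x(1)] measurable_eval(2)[OF A(1) x(2)] by (intro card_mono) auto
      then show "norm (real (card (sym_diff (f x) (f y)))) \<le> real n" by simp
    qed
  qed
  then have "(\<integral>\<^sup>+f. of_nat (card (sym_diff (f x) (f y))) \<partial>A) = ennreal (\<integral>f. real (card (sym_diff (f x) (f y))) \<partial>A)"
    by (subst nn_integral_eq_integral[symmetric]) (auto simp: ennreal_of_nat_eq_real_of_nat)
  also have "\<dots> \<le> ennreal (\<alpha> * l1_dist n x y)"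
    using A(2) x by (intro ennreal_leI) (auto simp: stretch_def)
  finally show ?thesis .
qed

lemma AE_card_le:
  assumes "stretch n k \<alpha> A" "x \<in> Delta n k"
  shows "AE f in A. card (f x) \<le> k"
proof -
  have "AE f in A. int (card (f x)) \<in> {\<lfloor>l1_norm n x\<rfloor>, \<lceil>l1_norm n x\<rceil>}"
    using assms by (auto simp: stretch_def)
  then show ?thesis
  proof eventually_elim
    fix f assume "int (card (f x)) \<in> {\<lfloor>l1_norm n x\<rfloor>, \<lceil>l1_norm n x\<rceil>}"
    moreover have "l1_norm n x \<le> real k" using assms by (simp add: Delta_def)
    then have "\<lfloor>l1_norm n x\<rfloor> \<le> int k" "\<lceil>l1_norm n x\<rceil> \<le> int k" by linarith+
    ultimately show "card (f x) \<le> k" by auto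
  qed
qed

lemma expect_both_fallback:
  assumes A: "correlated_sampling n k A" "stretch n k \<alpha> A" and x: "x \<in> Delta n k" "y \<in> Delta n k"
  shows "expect_inner n A t (\<lambda>f E \<omega>. of_nat (card (sym_diff (f x) (f y)))) \<le> ennreal (\<alpha> * l1_dist n x y)"
  unfolding expect_inner_def
  using nn_integral_stretch[OF A x]
  by (simp add: prob_space.emeasure_space_1 prob_space_clocks prob_space_tree_space)

lemma card_sym_diff_le: "finite A \<Longrightarrow> finite B \<Longrightarrow> card (sym_diff A B) \<le> card A + card B"
  by (meson Diff_subset Un_mono card_Un_le card_mono finite_UnI order_trans)

text \<open>Two different algorithms are not compared; the sizes of their outputs are added. The
  random map contributes at most k elements almost surely, the tree sampler at most k slots in
  expectation.\<close>

lemma expect_one_fallback: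
  assumes A: "correlated_sampling n k A" "stretch n k \<alpha> A" and x: "x \<in> Delta n k" and t: "distinct (leaves t)"
    and z: "z ` set (leaves t) \<subseteq> {0..1}" "(\<Sum>c\<in>set (leaves t). z c) \<le> real k"
    and g: "\<And>E T. finite T \<Longrightarrow> finite (g E T) \<and> card (g E T) \<le> card T"
  shows "expect_inner n A t (\<lambda>f E \<omega>. of_nat (card (sym_diff (f x) (g E (tree_sel t z \<omega>))))) \<le> ennreal (2 * real k)"
proof -
  interpret prob_space A using A by (simp add: correlated_sampling_def)
  have 1: "(\<integral>\<^sup>+f. of_nat (card (sym_diff (f x) (g E (tree_sel t z \<omega>)))) \<partial>A) \<le> of_nat (k + card (tree_sel t z \<omega>))" for E \<omega>
  proof -
    have "(\<integral>\<^sup>+f. of_nat (card (sym_diff (f x) (g E (tree_sel t z \<omega>)))) \<partial>A) \<le> (\<integral>\<^sup>+f. of_nat (k + card (tree_sel t z \<omega>)) \<partial>A)"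
    proof (intro nn_integral_mono_AE, use AE_card_le[OF A(2) x] AE_space in eventually_elim)
      fix f assume f: "card (f x) \<le> k" "f \<in> space A"
      have "finite (f x)" by (rule finite_subset[OF measurable_eval(2)[OF A(1) x f(2)]]) simp
      then have "card (sym_diff (f x) (g E (tree_sel t z \<omega>))) \<le> card (f x) + card (g E (tree_sel t z \<omega>))"
        using g by (intro card_sym_diff_le) auto
      also have "\<dots> \<le> k + card (tree_sel t z \<omega>)" using f g[of "tree_sel t z \<omega>" E] by (intro add_mono) auto
      finally show "of_nat (card (sym_diff (f x) (g E (tree_sel t z \<omega>)))) \<le> (of_nat (k + card (tree_sel t z \<omega>)) :: ennreal)"
        by (simp only: of_nat_le_iff)
    qed
    then show ?thesis using nn_integral_prob_const[OF prob_space_axioms] by simp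
  qed
  have "expect_inner n A t (\<lambda>f E \<omega>. of_nat (card (sym_diff (f x) (g E (tree_sel t z \<omega>)))))
     \<le> (\<integral>\<^sup>+\<omega>. \<integral>\<^sup>+E. of_nat (k + card (tree_sel t z \<omega>)) \<partial>clocks n \<partial>tree_space t)"
    unfolding expect_inner_def by (intro nn_integral_mono 1)
  also have "\<dots> = (\<integral>\<^sup>+\<omega>. of_nat k + of_nat (card (tree_sel t z \<omega>)) \<partial>tree_space t)"
    by (simp add: prob_space.emeasure_space_1 prob_space_clocks)
  also have "\<dots> = of_nat k + ennreal (\<Sum>c\<in>set (leaves t). z c)"
    using measurable_tree_pair[OF t, of "\<lambda>A B. of_nat (card A)"]
    by (subst nn_integral_add) (auto simp: nn_integral_card_tree_sel[OF t z(1)] prob_space.emeasure_space_1 prob_space_tree_space)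
  also have "\<dots> \<le> of_nat k + of_nat k"
    using z(2) by (intro add_left_mono) (simp add: ennreal_of_nat_eq_real_of_nat ennreal_leI)
  also have "\<dots> = ennreal (2 * real k)"
    by (simp add: ennreal_of_nat_eq_real_of_nat ennreal_plus[symmetric] del: ennreal_plus)
  finally show ?thesis .
qed

section \<open>Raising one coordinate when both inputs reach the main case\<close>

lemma members_update:
  assumes "j \<in> {1..n}" "0 \<le> x j" "x j < v" "j \<notin> L"
  shows "members n (x(j := v)) L \<beta> (\<beta> j) = insert j (members n x L \<beta> (\<beta> j) - {j})"
    and "members n x L \<beta> (\<beta> j) = (members n x L \<beta> (\<beta> j) - {j}) \<union> {i. i = j \<and> 0 < x j}"
    and "b \<noteq> \<beta> j \<Longrightarrow> members n (x(j := v)) L \<beta> b = members n x L \<beta> b"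
  using assms by (auto simp: members_def)

text \<open>If \<open>j\<close> is not yet a member, then \<open>x j = 0\<close>. Taking
  \<open>j\<close> out and adding \<open>x j\<close> thus treats an old and a new member of the
  bucket alike.\<close>

lemma load_split:
  assumes "j \<in> {1..n}" "0 \<le> x j" "j \<notin> L"
  shows "load n x L \<beta> (\<beta> j) = sum x (members n x L \<beta> (\<beta> j) - {j}) + x j"
proof (cases "0 < x j")
  case True
  then have "j \<in> members n x L \<beta> (\<beta> j)" using assms by (simp add: members_def)
  then show ?thesis unfolding load_def by (simp add: sum.remove)
next
  case False
  then have "j \<notin> members n x L \<beta> (\<beta> j)" "x j = 0" using assms by (simp_all add: members_def)
  then show ?thesis unfolding load_def by simp
qed

lemma load_update:
  assumes "j \<in> {1..n}" "0 \<le> x j" "x j < v" "j \<notin> L"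
  shows "load n (x(j := v)) L \<beta> (\<beta> j) = load n x L \<beta> (\<beta> j) + (v - x j)"
    and "b \<noteq> \<beta> j \<Longrightarrow> load n (x(j := v)) L \<beta> b = load n x L \<beta> b"
proof -
  let ?S = "members n x L \<beta> (\<beta> j) - {j}"
  have eq: "sum (x(j := v)) ?S = sum x ?S" by (intro sum.cong) auto
  have "load n (x(j := v)) L \<beta> (\<beta> j) = sum (x(j := v)) (insert j ?S)"
    by (simp add: load_def members_update(1)[of j n x v L, OF assms])
  also have "\<dots> = v + sum (x(j := v)) ?S" by (subst sum.insert) auto
  finally show "load n (x(j := v)) L \<beta> (\<beta> j) = load n x L \<beta> (\<beta> j) + (v - x j)"
    using load_split[of j n x L, OF assms(1,2,4), of \<beta>] eq by simp
  assume b: "b \<noteq> \<beta> j"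
  show "load n (x(j := v)) L \<beta> b = load n x L \<beta> b"
    unfolding load_def members_update(3)[where j = j and n = n and x = x and v = v and L = L and b = b and \<beta> = \<beta>, OF assms b]
    using b by (intro sum.cong refl) (auto simp: members_def)
qed

lemma rep_cong:
  assumes "members n x L \<beta> b = members n y L' \<beta> b" "\<And>i. i \<in> members n x L \<beta> b \<Longrightarrow> x i = y i"
  shows "rep n x L \<beta> E b = rep n y L' \<beta> E b" "load n x L \<beta> b = load n y L' \<beta> b"
proof -
  show l: "load n x L \<beta> b = load n y L' \<beta> b"
    unfolding load_def using assms by (intro sum.cong) auto
  have "(\<lambda>i\<in>{1..n}. if i \<in> members n x L \<beta> b then x i / load n x L \<beta> b else 0)
     = (\<lambda>i\<in>{1..n}. if i \<in> members n y L' \<beta> b then y i / load n y L' \<beta> b else 0)"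
    using assms l by (intro restrict_ext) auto
  then show "rep n x L \<beta> E b = rep n y L' \<beta> E b" by (simp add: rep_def)
qed

text \<open>Raising \<open>x j\<close> rescales every probability in the bucket, but a race ignores
  common factors, so only the weight of \<open>j\<close> has changed.\<close>

lemma nn_integral_rep_change:
  assumes j: "j \<in> {1..n}" "0 \<le> x j" "x j < v" "j \<notin> L" and pos: "0 < load n x L \<beta> (\<beta> j)"
  shows "(\<integral>\<^sup>+E. of_bool (rep n x L \<beta> E (\<beta> j) \<noteq> rep n (x(j := v)) L \<beta> E (\<beta> j)) \<partial>clocks n)
     \<le> ennreal ((v - x j) / load n x L \<beta> (\<beta> j))"
proof -
  let ?S = "members n x L \<beta> (\<beta> j) - {j}"
  have posy: "0 < load n (x(j := v)) L \<beta> (\<beta> j)" using load_update(1)[of j n x v L, OF j, of \<beta>] pos j by simp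
  have "(rep n x L \<beta> E (\<beta> j) \<noteq> rep n (x(j := v)) L \<beta> E (\<beta> j)) \<longleftrightarrow>
    (arg_min_on (\<lambda>i. E i / (x i / load n x L \<beta> (\<beta> j))) (members n x L \<beta> (\<beta> j)) \<noteq>
     arg_min_on (\<lambda>i. E i / ((x(j := v)) i / load n (x(j := v)) L \<beta> (\<beta> j))) (insert j ?S))" for E
    by (simp only: rep_eq[OF pos] rep_eq[OF posy] members_update(1)[of j n x v L, OF j]) simp
  then show ?thesis
    unfolding load_split[of j n x L, OF j(1,2,4)] using load_split[of j n x L, OF j(1,2,4), of \<beta>] j pos posy members_update(2)[of j n x v L, OF j, of \<beta>]
    by (simp only:) (rule nn_integral_clock_change; auto simp: members_def)
qed

lemma measurable_rep_neq:
  assumes "0 < load n x L \<beta> b" "0 < load n y L' \<beta> b"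
  shows "Measurable.pred (clocks n) (\<lambda>E. rep n x L \<beta> E b \<noteq> rep n y L' \<beta> E b)"
proof (rule measurable_pair_finite_range[where F = "\<lambda>E. rep n x L \<beta> E b" and G = "\<lambda>E. rep n y L' \<beta> E b" and h = "(\<noteq>)"
      and P = "Pow {1..n}" and Q = "Pow {1..n}"])
  have E: "(\<lambda>E. E i) \<in> borel_measurable (clocks n)" if "i \<in> {1..n}" for i
    using measurable_component_singleton[OF that, of "\<lambda>_. exponential_measure 1"]
    by (simp cong: measurable_cong_sets)
  show "(\<lambda>E. rep n x L \<beta> E b) \<in> measurable (clocks n) (count_space UNIV)"
    "(\<lambda>E. rep n y L' \<beta> E b) \<in> measurable (clocks n) (count_space UNIV)"
    unfolding rep_def by (rule measurable_clock_sample, rule E, assumption)+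
  have "members n x L \<beta> b \<subseteq> {1..n}" for x L by (auto simp: members_def)
  then show "rep n x L \<beta> E b \<in> Pow {1..n}" "rep n y L' \<beta> E b \<in> Pow {1..n}" for E
    using arg_min_on_members[OF assms(1)] arg_min_on_members[OF assms(2)]
    by (simp_all only: rep_eq[OF assms(1)] rep_eq[OF assms(2)] PowI) blast+
qed auto

lemma xhat_range:
  assumes "x \<in> Delta n k" "L \<subseteq> {1..n}" "\<not> collision m L R C" "\<not> overflow n m x L \<beta> \<tau>" "0 \<le> \<tau>"
  shows "xhat n m d x L R C \<beta> ` {1..d} \<subseteq> {0..1}"
proof -
  have "finite L" by (rule finite_subset[OF assms(2)]) simp
  moreover have "0 \<le> x i \<and> x i \<le> 1" if "i \<in> L" for i using Delta_range[OF assms(1)] assms(2) that by blast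
  ultimately show ?thesis
    using xhat_nonneg[of L x] xhat_le_1[OF assms(3,4,5)] by fastforce
qed

text \<open>Here \<open>c\<close> is the slot whose value grows by \<open>\<delta>\<close>, and
  \<open>G\<close> bounds the cost of a change of its contents. Selection of \<open>c\<close>
  depends on the tree variables and \<open>G\<close> on the clocks, so by independence this cost is
  at most \<open>g * z c\<close>. The other term is twice the stretch of the tree sampler.\<close>

lemma expect_main_step:
  fixes F :: "(nat \<Rightarrow> real) \<Rightarrow> real \<times> (bool list \<Rightarrow> real) \<Rightarrow> ennreal"
  assumes A: "prob_space A" and t: "distinct (leaves t)" and c: "c \<in> set (leaves t)"
    and z: "z ` set (leaves t) \<subseteq> {0..1}" and z': "z' ` set (leaves t) \<subseteq> {0..1}"
    and zz: "z' = z(c := z c + \<delta>)" and \<delta>: "0 \<le> \<delta>"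
    and G: "G \<in> borel_measurable (clocks n)" "(\<integral>\<^sup>+E. G E \<partial>clocks n) \<le> ennreal g" "0 \<le> g" "g * z c \<le> 2 * \<delta>"
    and F: "\<And>E \<omega>. F E \<omega> \<le> 2 * of_nat (card (sym_diff (tree_sel t z \<omega>) (tree_sel t z' \<omega>)))
       + of_bool (c \<in> tree_sel t z \<omega>) * G E"
  shows "expect_inner n A t (\<lambda>f E \<omega>. F E \<omega>) \<le> ennreal ((2 * (2 * real (depth t) + 1) + 2) * \<delta>)"
proof -
  have zc: "0 \<le> z c" "0 \<le> z c + \<delta>" "z c + \<delta> \<le> 1"
    using z z' c unfolding zz by (auto simp: image_subset_iff)
  have stab: "(\<integral>\<^sup>+\<omega>. of_nat (card (sym_diff (tree_sel t z \<omega>) (tree_sel t z' \<omega>))) \<partial>tree_space t)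
     \<le> ennreal ((2 * real (depth t) + 1) * \<delta>)"
    using tree_stability[OF t c z zc(2,3)] \<delta> unfolding zz by simp
  have "expect_inner n A t (\<lambda>f E \<omega>. F E \<omega>)
    \<le> expect_inner n A t (\<lambda>f E \<omega>. 2 * of_nat (card (sym_diff (tree_sel t z \<omega>) (tree_sel t z' \<omega>))) + of_bool (c \<in> tree_sel t z \<omega>) * G E)"
    by (intro expect_inner_mono F)
  also have "\<dots> = (\<integral>\<^sup>+\<omega>. 2 * of_nat (card (sym_diff (tree_sel t z \<omega>) (tree_sel t z' \<omega>)))
       + of_bool (c \<in> tree_sel t z \<omega>) * (\<integral>\<^sup>+E. G E \<partial>clocks n) \<partial>tree_space t)"
    unfolding expect_inner_const_f[OF A] using G(1)
    by (intro nn_integral_cong)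
       (simp add: nn_integral_add nn_integral_cmult prob_space.emeasure_space_1 prob_space_clocks)
  also have "\<dots> \<le> (\<integral>\<^sup>+\<omega>. 2 * of_nat (card (sym_diff (tree_sel t z \<omega>) (tree_sel t z' \<omega>)))
       + of_bool (c \<in> tree_sel t z \<omega>) * ennreal g \<partial>tree_space t)"
    by (intro nn_integral_mono add_left_mono mult_left_mono G) auto
  also have "\<dots> = 2 * (\<integral>\<^sup>+\<omega>. of_nat (card (sym_diff (tree_sel t z \<omega>) (tree_sel t z' \<omega>))) \<partial>tree_space t)
       + ennreal (z c) * ennreal g"
    using measurable_tree_pair[OF t, of "\<lambda>A B. of_nat (card (sym_diff A B))" z z']
      measurable_tree_pair[OF t, of "\<lambda>A B. of_bool (c \<in> A)" z z']
    by (simp add: nn_integral_add nn_integral_cmult nn_integral_multc nn_integral_tree_mem[OF t z c])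
  also have "\<dots> \<le> 2 * ennreal ((2 * real (depth t) + 1) * \<delta>) + ennreal (2 * \<delta>)"
    using stab G zc by (intro add_mono mult_left_mono) (auto simp: ennreal_mult[symmetric] mult.commute ennreal_leI)
  also have "\<dots> = ennreal ((2 * (2 * real (depth t) + 1) + 2) * \<delta>)"
  proof -
    have "2 * ennreal ((2 * real (depth t) + 1) * \<delta>) = ennreal (2 * ((2 * real (depth t) + 1) * \<delta>))"
      using \<delta> by (subst ennreal_mult) auto
    moreover have "ennreal (2 * ((2 * real (depth t) + 1) * \<delta>)) + ennreal (2 * \<delta>)
       = ennreal (2 * ((2 * real (depth t) + 1) * \<delta>) + 2 * \<delta>)"
      using \<delta> by (subst ennreal_plus) auto
    moreover have "2 * ((2 * real (depth t) + 1) * \<delta>) + 2 * \<delta> = (2 * (2 * real (depth t) + 1) + 2) * \<delta>"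
      by algebra
    ultimately show ?thesis by simp
  qed
  finally show ?thesis .
qed

lemma expect_main_small:
  assumes A: "prob_space A" and t: "distinct (leaves t)" "set (leaves t) = {1..d}"
    and x: "x \<in> Delta n k" "x(j := v) \<in> Delta n k" and j: "j \<in> {1..n}" "x j < v" "j \<notin> L" and L: "L \<subseteq> {1..n}"
    and rnd: "R \<in> {1..m} \<rightarrow> {1..d}" "C \<in> {1..n} \<rightarrow> {1..d}" "\<beta> \<in> {1..n} \<rightarrow> {1..m}"
    and col: "\<not> collision m L R C" and ov: "\<not> overflow n m x L \<beta> \<tau>" "\<not> overflow n m (x(j := v)) L \<beta> \<tau>" "0 \<le> \<tau>"
  shows "expect_inner n A t (\<lambda>f E \<omega>. of_nat (card (sym_diff
       (main_out n m x L R C \<beta> E (tree_sel t (xhat n m d x L R C \<beta>) \<omega>))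
       (main_out n m (x(j := v)) L R C \<beta> E (tree_sel t (xhat n m d (x(j := v)) L R C \<beta>) \<omega>)))))
    \<le> ennreal ((2 * (2 * real (depth t) + 1) + 2) * (v - x j))"
proof -
  define y where "y = x(j := v)"
  define b where "b = \<beta> j"
  define s where "s = load n x L \<beta> b"
  define P where "P = L <+> {1..m}"
  define \<kappa> where "\<kappa> = case_sum C R"
  define z z' where "z = xhat n m d x L R C \<beta>" and "z' = xhat n m d y L R C \<beta>"
  have finL: "finite L" by (rule finite_subset[OF L]) simp
  have finP: "finite P" using finL by (simp add: P_def)
  have inj: "inj_on \<kappa> P" using col by (simp add: collision_def \<kappa>_def P_def)
  have bm: "b \<in> {1..m}" using rnd(3) j by (auto simp: b_def)
  have bP: "Inr b \<in> P" unfolding P_def using bm by blast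
  have Rb: "R b \<in> {1..d}" using rnd(1) bm by auto
  have xj: "0 \<le> x j" using Delta_range[OF x(1) j(1)] by simp
  have jj: "j \<in> {1..n}" "0 \<le> x j" "x j < v" "j \<notin> L" using j xj by auto
  have zr: "z ` set (leaves t) \<subseteq> {0..1}" unfolding z_def t(2) by (rule xhat_range[OF x(1) L col ov(1,3)])
  have zr': "z' ` set (leaves t) \<subseteq> {0..1}" unfolding z'_def t(2) y_def by (rule xhat_range[OF x(2) L col ov(2,3)])
  have wy: "slot_weight n y L \<beta> p = slot_weight n x L \<beta> p" if "p \<in> P - {Inr b}" for p
    using that j load_update(2)[of j n x v L, OF jj] by (auto simp: slot_weight_def y_def b_def P_def split: sum.splits)
  have wb: "slot_weight n y L \<beta> (Inr b) - slot_weight n x L \<beta> (Inr b) = v - x j"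
    using load_update(1)[of j n x v L, OF jj, of \<beta>] by (simp add: slot_weight_def y_def b_def)
  have zz: "z' = z(R b := z (R b) + (v - x j))"
    using slot_vec_change[OF finP bP, of \<kappa> d "slot_weight n y L \<beta>" "slot_weight n x L \<beta>"] Rb wy wb
    unfolding z_def z'_def xhat_slot_vec P_def[symmetric] \<kappa>_def[symmetric] by (simp add: \<kappa>_def)
  have zb: "z (R b) = s"
    using slot_vec_at[OF finP bP _ inj, of d "slot_weight n x L \<beta>"] Rb
    unfolding z_def xhat_slot_vec P_def[symmetric] \<kappa>_def[symmetric] s_def by (simp add: \<kappa>_def slot_weight_def)
  have Rbl: "R b \<in> set (leaves t)" using Rb t by simp
  have s0: "0 \<le> s" by (simp add: s_def load_nonneg)
  \<comment> \<open>A change involves an old and a new representative, hence the 2. If the bucket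
    was empty, its slot has value 0 and is almost never selected, so the constant 2 costs
    nothing.\<close>
  define G :: "(nat \<Rightarrow> real) \<Rightarrow> ennreal" where
    "G = (\<lambda>E. if 0 < s then 2 * of_bool (rep n x L \<beta> E b \<noteq> rep n y L \<beta> E b) else 2)"
  have ypos: "0 < load n y L \<beta> b"
    using load_update(1)[of j n x v L, OF jj, of \<beta>] s0 j by (simp add: y_def b_def s_def)
  have G_meas: "G \<in> borel_measurable (clocks n)"
  proof (cases "0 < s")
    case True
    note measurable_rep_neq[OF True[unfolded s_def] ypos, measurable]
    have "(\<lambda>E. 2 * (if rep n x L \<beta> E b \<noteq> rep n y L \<beta> E b then 1 else 0)) \<in> borel_measurable (clocks n)"
      by measurable
    then show ?thesis unfolding G_def of_bool_def using True by simp
  qed (simp add: G_def)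
  define g where "g = (if 0 < s then 2 * ((v - x j) / s) else 2)"
  have g0: "0 \<le> g" "g * s \<le> 2 * (v - x j)" using s0 j by (auto simp: g_def)
  have intG: "(\<integral>\<^sup>+E. G E \<partial>clocks n) \<le> ennreal g"
  proof (cases "0 < s")
    case True
    have "(\<integral>\<^sup>+E. G E \<partial>clocks n)
      = 2 * (\<integral>\<^sup>+E. of_bool (rep n x L \<beta> E b \<noteq> rep n y L \<beta> E b) \<partial>clocks n)"
      unfolding G_def using True measurable_rep_neq[OF True[unfolded s_def] ypos, measurable]
      by (simp add: of_bool_def nn_integral_cmult)
    also have "\<dots> \<le> 2 * ennreal ((v - x j) / s)"
      unfolding y_def b_def s_def using True
      by (intro mult_left_mono nn_integral_rep_change jj) (auto simp: s_def b_def)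
    also have "\<dots> = ennreal (2 * ((v - x j) / s))"
      using True j by (subst ennreal_mult) auto
    also have "\<dots> = ennreal g"
      using True by (simp only: g_def if_True)
    finally show ?thesis .
  next
    case False
    then show ?thesis by (simp add: G_def g_def prob_space.emeasure_space_1 prob_space_clocks)
  qed
  have items: "slot_items n x L \<beta> E p = slot_items n y L \<beta> E p" if "p \<in> P - {Inr b}" for p E
  proof (cases p)
    case (Inr b')
    with that have b': "b' \<noteq> \<beta> j" by (auto simp: b_def)
    have mem: "members n x L \<beta> b' = members n y L \<beta> b'"
      using members_update(3)[where j = j and n = n and x = x and v = v and L = L and b = b' and \<beta> = \<beta>, OF jj b']
      by (simp add: y_def)
    have "x i = y i" if "i \<in> members n x L \<beta> b'" for i
      using that b' by (auto simp: members_def y_def)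
    from rep_cong[OF mem this] show ?thesis by (simp add: Inr slot_items_def)
  qed (simp add: slot_items_def)
  have itb: "of_nat (card (sym_diff (slot_items n x L \<beta> E (Inr b)) (slot_items n y L \<beta> E (Inr b)))) \<le> G E" for E
  proof -
    have le2: "card (sym_diff (slot_items n x L \<beta> E (Inr b)) (slot_items n y L \<beta> E (Inr b))) \<le> 2"
      using card_sym_diff_le[of "slot_items n x L \<beta> E (Inr b)" "slot_items n y L \<beta> E (Inr b)"]
        card_slot_items[of n x L \<beta> E "Inr b"] card_slot_items[of n y L \<beta> E "Inr b"] by simp
    then have le2': "of_nat (card (sym_diff (slot_items n x L \<beta> E (Inr b)) (slot_items n y L \<beta> E (Inr b)))) \<le> (2 :: ennreal)"
      by (metis of_nat_le_iff of_nat_numeral)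
    show ?thesis
    proof (cases "0 < s \<and> rep n x L \<beta> E b = rep n y L \<beta> E b")
      case True
      then show ?thesis using ypos by (simp add: slot_items_def s_def)
    qed (use le2' in \<open>auto simp: G_def\<close>)
  qed
  have pw: "of_nat (card (sym_diff (main_out n m x L R C \<beta> E (tree_sel t z \<omega>)) (main_out n m y L R C \<beta> E (tree_sel t z' \<omega>))))
    \<le> 2 * of_nat (card (sym_diff (tree_sel t z \<omega>) (tree_sel t z' \<omega>))) + of_bool (R b \<in> tree_sel t z \<omega>) * G E" for E \<omega>
  proof -
    let ?T = "tree_sel t z \<omega>" and ?T' = "tree_sel t z' \<omega>"
    have "card (sym_diff (main_out n m x L R C \<beta> E ?T) (main_out n m y L R C \<beta> E ?T'))
      \<le> 2 * card (sym_diff ?T ?T') + (\<Sum>p\<in>{Inr b}. if \<kappa> p \<in> ?T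
           then card (sym_diff (slot_items n x L \<beta> E p) (slot_items n y L \<beta> E p)) else 0)"
      unfolding main_out_def P_def[symmetric] \<kappa>_def[symmetric]
      using bP items by (intro card_sym_diff_UN finP inj) (auto simp: card_slot_items[simplified])
    then have "of_nat (card (sym_diff (main_out n m x L R C \<beta> E ?T) (main_out n m y L R C \<beta> E ?T')))
      \<le> (of_nat (2 * card (sym_diff ?T ?T') + (if R b \<in> ?T
           then card (sym_diff (slot_items n x L \<beta> E (Inr b)) (slot_items n y L \<beta> E (Inr b))) else 0)) :: ennreal)"
      by (simp only: of_nat_le_iff) (simp add: \<kappa>_def)
    also have "\<dots> \<le> 2 * of_nat (card (sym_diff ?T ?T')) + of_bool (R b \<in> ?T) * G E"
      unfolding of_nat_add of_nat_mult using itb[of E] by (intro add_mono) auto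
    finally show ?thesis .
  qed
  have "0 \<le> v - x j" "g * z (R b) \<le> 2 * (v - x j)" using j g0 zb by auto
  then show ?thesis
    unfolding z_def[symmetric] y_def[symmetric] z'_def[symmetric]
    by (intro expect_main_step[OF A t(1) Rbl zr zr' zz _ G_meas intG g0(1) _ pw])
qed

lemma main_out_large_cong:
  assumes "j \<in> L"
  shows "main_out n m (x(j := v)) L R C \<beta> E T = main_out n m x L R C \<beta> E T"
    and "load n (x(j := v)) L \<beta> b = load n x L \<beta> b"
proof -
  have mem: "members n (x(j := v)) L \<beta> b = members n x L \<beta> b" for b
    using assms by (auto simp: members_def)
  have rl: "rep n (x(j := v)) L \<beta> E b = rep n x L \<beta> E b" "load n (x(j := v)) L \<beta> b = load n x L \<beta> b" for b
    using assms by (intro rep_cong mem; auto simp: members_def)+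
  have items: "slot_items n (x(j := v)) L \<beta> E = slot_items n x L \<beta> E"
    unfolding slot_items_def rl ..
  show "main_out n m (x(j := v)) L R C \<beta> E T = main_out n m x L R C \<beta> E T"
    unfolding main_out_def items ..
  show "load n (x(j := v)) L \<beta> b = load n x L \<beta> b" by (rule rl(2))
qed

text \<open>A large element represents itself and enters no load. Its value matters to the tree
  sampler alone, so no slot changes its contents and \<open>G = 0\<close> is a valid choice.\<close>

lemma expect_main_large:
  assumes A: "prob_space A" and t: "distinct (leaves t)" "set (leaves t) = {1..d}"
    and x: "x \<in> Delta n k" "x(j := v) \<in> Delta n k" and j: "x j < v" "j \<in> L" and L: "L \<subseteq> {1..n}"
    and rnd: "C \<in> {1..n} \<rightarrow> {1..d}"
    and col: "\<not> collision m L R C" and ov: "\<not> overflow n m x L \<beta> \<tau>" "\<not> overflow n m (x(j := v)) L \<beta> \<tau>" "0 \<le> \<tau>"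
  shows "expect_inner n A t (\<lambda>f E \<omega>. of_nat (card (sym_diff
       (main_out n m x L R C \<beta> E (tree_sel t (xhat n m d x L R C \<beta>) \<omega>))
       (main_out n m (x(j := v)) L R C \<beta> E (tree_sel t (xhat n m d (x(j := v)) L R C \<beta>) \<omega>)))))
    \<le> ennreal ((2 * (2 * real (depth t) + 1) + 2) * (v - x j))"
proof -
  define y where "y = x(j := v)"
  define P where "P = L <+> {1..m}"
  define \<kappa> where "\<kappa> = case_sum C R"
  define z z' where "z = xhat n m d x L R C \<beta>" and "z' = xhat n m d y L R C \<beta>"
  have finL: "finite L" by (rule finite_subset[OF L]) simp
  have finP: "finite P" using finL by (simp add: P_def)
  have inj: "inj_on \<kappa> P" using col by (simp add: collision_def \<kappa>_def P_def)
  have jn: "j \<in> {1..n}" using j L by auto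
  have jP: "Inl j \<in> P" using j by (simp add: P_def InlI)
  have Cj: "C j \<in> {1..d}" using rnd jn by auto
  have zr: "z ` set (leaves t) \<subseteq> {0..1}" unfolding z_def t(2) by (rule xhat_range[OF x(1) L col ov(1,3)])
  have zr': "z' ` set (leaves t) \<subseteq> {0..1}" unfolding z'_def t(2) y_def by (rule xhat_range[OF x(2) L col ov(2,3)])
  have wy: "slot_weight n y L \<beta> p = slot_weight n x L \<beta> p" if "p \<in> P - {Inl j}" for p
    using that main_out_large_cong(2)[OF j(2)] by (auto simp: slot_weight_def y_def split: sum.splits)
  have zz: "z' = z(C j := z (C j) + (v - x j))"
    using slot_vec_change[OF finP jP, of \<kappa> d "slot_weight n y L \<beta>" "slot_weight n x L \<beta>"] Cj wy
    unfolding z_def z'_def xhat_slot_vec P_def[symmetric] \<kappa>_def[symmetric]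
    by (simp add: \<kappa>_def slot_weight_def y_def)
  have Cjl: "C j \<in> set (leaves t)" using Cj t by simp
  have pw: "of_nat (card (sym_diff (main_out n m x L R C \<beta> E (tree_sel t z \<omega>)) (main_out n m y L R C \<beta> E (tree_sel t z' \<omega>))))
    \<le> (2 * of_nat (card (sym_diff (tree_sel t z \<omega>) (tree_sel t z' \<omega>))) :: ennreal)" for E \<omega>
  proof -
    let ?T = "tree_sel t z \<omega>" and ?T' = "tree_sel t z' \<omega>"
    have "card (sym_diff (main_out n m x L R C \<beta> E ?T) (main_out n m x L R C \<beta> E ?T'))
      \<le> 2 * card (sym_diff ?T ?T') + (\<Sum>p\<in>{}. if \<kappa> p \<in> ?T
           then card (sym_diff (slot_items n x L \<beta> E p) (slot_items n x L \<beta> E p)) else 0)"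
      unfolding main_out_def P_def[symmetric] \<kappa>_def[symmetric]
      by (intro card_sym_diff_UN finP inj) (auto simp: card_slot_items[simplified])
    then have "of_nat (card (sym_diff (main_out n m x L R C \<beta> E ?T) (main_out n m y L R C \<beta> E ?T')))
      \<le> (of_nat (2 * card (sym_diff ?T ?T')) :: ennreal)"
      unfolding y_def main_out_large_cong(1)[OF j(2)] by (simp only: of_nat_le_iff) simp
    then show ?thesis by simp
  qed
  have "0 \<le> v - x j" "0 * z (C j) \<le> 2 * (v - x j)" using j by auto
  with pw show ?thesis
    unfolding z_def[symmetric] y_def[symmetric] z'_def[symmetric]
    by (intro expect_main_step[OF A t(1) Cjl zr zr' zz, where G = "\<lambda>_. 0" and g = 0]) auto
qed

text \<open>The bucket of \<open>j\<close> loses \<open>x j\<close> and the slot of \<open>j\<close>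
  gains \<open>v\<close>: two changes of the tree input, each by at most 1, and two slots with new
  contents, each costing at most 2. The bound has no factor \<open>v - x j\<close>; that factor
  comes from the probability of a status change.\<close>

lemma expect_main_move:
  assumes A: "prob_space A" and t: "distinct (leaves t)" "set (leaves t) = {1..d}"
    and x: "x \<in> Delta n k" "x(j := v) \<in> Delta n k" and j: "j \<in> {1..n}" "x j < v" "j \<notin> L" and L: "L \<subseteq> {1..n}"
    and rnd: "R \<in> {1..m} \<rightarrow> {1..d}" "C \<in> {1..n} \<rightarrow> {1..d}" "\<beta> \<in> {1..n} \<rightarrow> {1..m}"
    and col: "\<not> collision m L R C" "\<not> collision m (insert j L) R C"
    and ov: "\<not> overflow n m x L \<beta> \<tau>" "\<not> overflow n m (x(j := v)) (insert j L) \<beta> \<tau>" "0 \<le> \<tau>"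
  shows "expect_inner n A t (\<lambda>f E \<omega>. of_nat (card (sym_diff
       (main_out n m x L R C \<beta> E (tree_sel t (xhat n m d x L R C \<beta>) \<omega>))
       (main_out n m (x(j := v)) (insert j L) R C \<beta> E (tree_sel t (xhat n m d (x(j := v)) (insert j L) R C \<beta>) \<omega>)))))
    \<le> ennreal (4 * (2 * real (depth t) + 1) + 4)"
proof -
  define y where "y = x(j := v)"
  define L' where "L' = insert j L"
  define b where "b = \<beta> j"
  define P where "P = L <+> {1..m}"
  define P' where "P' = insert (Inl j) P"
  define \<kappa> where "\<kappa> = case_sum C R"
  define w w' where "w = slot_weight n x L \<beta>" and "w' = slot_weight n y L' \<beta>"
  define z z' where "z = xhat n m d x L R C \<beta>" and "z' = xhat n m d y L' R C \<beta>"
  \<comment> \<open>The intermediate input: \<open>j\<close> has left its bucket and does not yet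
    occupy its own slot.\<close>
  define zm where "zm = slot_vec d P \<kappa> w'"
  have L': "L' \<subseteq> {1..n}" using L j by (simp add: L'_def)
  have finL: "finite L" by (rule finite_subset[OF L]) simp
  have finP: "finite P" "finite P'" using finL by (simp_all add: P_def P'_def)
  have PP: "L' <+> {1..m} = P'" by (auto simp: P'_def P_def L'_def)
  have inj: "inj_on \<kappa> P'" using col(2) PP by (simp add: collision_def \<kappa>_def L'_def)
  have bm: "b \<in> {1..m}" using rnd(3) j by (auto simp: b_def)
  have bP: "Inr b \<in> P" unfolding P_def using bm by blast
  have jP: "Inl j \<notin> P" using j by (auto simp: P_def)
  have Rb: "R b \<in> {1..d}" using rnd(1) bm by auto
  have Cj: "C j \<in> {1..d}" using rnd(2) j by auto
  have xj: "0 \<le> x j" using Delta_range[OF x(1) j(1)] by simp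
  have v1: "v \<le> 1" using Delta_range[OF x(2) j(1)] by simp
  have zr: "z ` set (leaves t) \<subseteq> {0..1}" unfolding z_def t(2) by (rule xhat_range[OF x(1) L col(1) ov(1,3)])
  have zr': "z' ` set (leaves t) \<subseteq> {0..1}" unfolding z'_def t(2) y_def L'_def
    by (rule xhat_range[OF x(2) L'[unfolded L'_def] col(2) ov(2,3)])
  have mem': "members n y L' \<beta> c = members n x L \<beta> c - {j}" for c
    using j by (auto simp: members_def y_def L'_def)
  have mem: "members n y L' \<beta> c = members n x L \<beta> c" if "c \<noteq> b" for c
    using that by (auto simp: mem') (auto simp: members_def b_def)
  have ld: "load n y L' \<beta> c = load n x L \<beta> c" if "c \<noteq> b" for c
    unfolding load_def mem[OF that] using that by (intro sum.cong refl) (auto simp: members_def y_def b_def)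
  have ldb: "load n y L' \<beta> b = load n x L \<beta> b - x j"
  proof -
    have "load n y L' \<beta> b = sum x (members n x L \<beta> b - {j})"
      unfolding load_def mem' by (intro sum.cong refl) (auto simp: y_def)
    then show ?thesis using load_split[of j n x L, OF j(1) xj j(3), of \<beta>] by (simp add: b_def)
  qed
  have ww: "w' p = w p" if "p \<in> P - {Inr b}" for p
    using that ld j by (auto simp: w_def w'_def slot_weight_def y_def P_def split: sum.splits)
  have wb: "w' (Inr b) - w (Inr b) = - x j" by (simp add: w_def w'_def slot_weight_def ldb)
  have w0: "0 \<le> w' p" if "p \<in> P'" for p
  proof (cases p)
    case (Inl i)
    then have "i \<in> L'" using that PP by auto
    then have "0 \<le> y i" using L' Delta_range[OF x(2), folded y_def] by blast
    then show ?thesis by (simp add: Inl w'_def slot_weight_def)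
  qed (simp add: w'_def slot_weight_def load_nonneg)
  have z1: "zm = z(R b := z (R b) - x j)"
    using slot_vec_change[OF finP(1) bP, of \<kappa> d w' w] Rb ww wb
    unfolding z_def zm_def xhat_slot_vec P_def[symmetric] \<kappa>_def[symmetric] w_def[symmetric] by (simp add: \<kappa>_def)
  have z2: "z' = zm(C j := zm (C j) + v)"
    using slot_vec_insert[OF finP(1) jP, of \<kappa> d w'] Cj
    unfolding z'_def zm_def xhat_slot_vec PP P'_def[symmetric] \<kappa>_def[symmetric] w'_def[symmetric]
    by (simp add: \<kappa>_def) (simp add: w'_def slot_weight_def y_def)
  have leaf: "R b \<in> set (leaves t)" "C j \<in> set (leaves t)" using Rb Cj t by auto
  have zmr: "zm ` set (leaves t) \<subseteq> {0..1}"
  proof (intro image_subsetI)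
    fix l assume l: "l \<in> set (leaves t)"
    have "0 \<le> zm l" unfolding zm_def slot_vec_def using l t w0
      by (auto intro!: sum_nonneg simp: P'_def)
    moreover have "zm l \<le> z' l" unfolding z2 using v1 xj j by auto
    moreover have "z' l \<le> 1" using zr' l by auto
    ultimately show "zm l \<in> {0..1}" by auto
  qed
  have s1: "(\<integral>\<^sup>+\<omega>. of_nat (card (sym_diff (tree_sel t z \<omega>) (tree_sel t zm \<omega>))) \<partial>tree_space t)
     \<le> ennreal (2 * real (depth t) + 1)"
  proof -
    have "0 \<le> z (R b) - x j" "z (R b) - x j \<le> 1" using zmr leaf unfolding z1 by (auto simp: image_subset_iff)
    then have "(\<integral>\<^sup>+\<omega>. of_nat (card (sym_diff (tree_sel t z \<omega>) (tree_sel t zm \<omega>))) \<partial>tree_space t)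
      \<le> ennreal ((2 * real (depth t) + 1) * \<bar>z (R b) - x j - z (R b)\<bar>)"
      unfolding z1 by (intro tree_stability t leaf zr)
    also have "\<dots> \<le> ennreal ((2 * real (depth t) + 1) * 1)"
      using xj v1 j by (intro ennreal_leI mult_left_mono) auto
    finally show ?thesis by simp
  qed
  have s2: "(\<integral>\<^sup>+\<omega>. of_nat (card (sym_diff (tree_sel t zm \<omega>) (tree_sel t z' \<omega>))) \<partial>tree_space t)
     \<le> ennreal (2 * real (depth t) + 1)"
  proof -
    have "0 \<le> zm (C j) + v" "zm (C j) + v \<le> 1" using zr' leaf unfolding z2 by (auto simp: image_subset_iff)
    then have "(\<integral>\<^sup>+\<omega>. of_nat (card (sym_diff (tree_sel t zm \<omega>) (tree_sel t z' \<omega>))) \<partial>tree_space t)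
      \<le> ennreal ((2 * real (depth t) + 1) * \<bar>zm (C j) + v - zm (C j)\<bar>)"
      unfolding z2 by (intro tree_stability t leaf zmr)
    also have "\<dots> \<le> ennreal ((2 * real (depth t) + 1) * 1)"
      using xj v1 j by (intro ennreal_leI mult_left_mono) auto
    finally show ?thesis by simp
  qed
  \<comment> \<open>For \<open>x\<close> the slot of \<open>j\<close> is treated as an occupant
    without contents, so that both outputs are unions over the same index set
    \<open>P'\<close>.\<close>
  define g where "g = (\<lambda>E p. if p = Inl j then {} else slot_items n x L \<beta> E p)"
  have gP: "main_out n m x L R C \<beta> E T = (\<Union>p\<in>{p \<in> P'. \<kappa> p \<in> T}. g E p)" for E T
    unfolding main_out_def P_def[symmetric] \<kappa>_def[symmetric] P'_def g_def using jP by (auto split: if_splits)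
  have items: "g E p = slot_items n y L' \<beta> E p" if "p \<in> P' - {Inr b, Inl j}" for p E
  proof (cases p)
    case (Inr c)
    with that have c: "c \<noteq> b" by auto
    have "rep n x L \<beta> E c = rep n y L' \<beta> E c"
      using mem[OF c] c by (intro rep_cong) (auto simp: y_def members_def b_def)
    then show ?thesis by (simp add: Inr slot_items_def g_def ld[OF c])
  qed (use that in \<open>auto simp: slot_items_def g_def\<close>)
  have g1: "finite (g E p) \<and> card (g E p) \<le> 1" for E p
    by (cases "p = Inl j") (simp_all add: g_def card_slot_items[simplified])
  have pw: "of_nat (card (sym_diff (main_out n m x L R C \<beta> E (tree_sel t z \<omega>)) (main_out n m y L' R C \<beta> E (tree_sel t z' \<omega>))))
    \<le> (2 * (of_nat (card (sym_diff (tree_sel t z \<omega>) (tree_sel t zm \<omega>))) + of_nat (card (sym_diff (tree_sel t zm \<omega>) (tree_sel t z' \<omega>)))) + 4 :: ennreal)" for E \<omega>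
  proof -
    let ?T = "tree_sel t z \<omega>" and ?T' = "tree_sel t z' \<omega>" and ?Tm = "tree_sel t zm \<omega>"
    let ?h = "slot_items n y L' \<beta> E"
    have "card (sym_diff (main_out n m x L R C \<beta> E ?T) (main_out n m y L' R C \<beta> E ?T'))
      \<le> 2 * card (sym_diff ?T ?T') + (\<Sum>p\<in>{Inr b, Inl j}. if \<kappa> p \<in> ?T
           then card (sym_diff (g E p) (?h p)) else 0)"
      unfolding gP unfolding main_out_def PP \<kappa>_def[symmetric]
      using items g1 bP by (intro card_sym_diff_UN finP inj) (auto simp: card_slot_items[simplified] P'_def)
    also have "(\<Sum>p\<in>{Inr b, Inl j}. if \<kappa> p \<in> ?T then card (sym_diff (g E p) (?h p)) else 0) \<le> (\<Sum>p\<in>{Inr b, Inl j}. 2)"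
    proof (rule sum_mono)
      fix p
      have "card (sym_diff (g E p) (?h p)) \<le> card (g E p) + card (?h p)"
        using g1 by (intro card_sym_diff_le) auto
      also have "\<dots> \<le> 2" using g1[of E p] card_slot_items[of n y L' \<beta> E p] by linarith
      finally show "(if \<kappa> p \<in> ?T then card (sym_diff (g E p) (?h p)) else 0) \<le> 2" by simp
    qed
    also have "(\<Sum>p\<in>{Inr b, Inl j}. 2 :: nat) = 4" by simp
    also have "card (sym_diff ?T ?T') \<le> card (sym_diff ?T ?Tm) + card (sym_diff ?Tm ?T')"
    proof -
      have "card (sym_diff ?T ?T') \<le> card (sym_diff ?T ?Tm \<union> sym_diff ?Tm ?T')"
        by (intro card_mono) auto
      then show ?thesis using card_Un_le order_trans by blast
    qed
    finally have "card (sym_diff (main_out n m x L R C \<beta> E ?T) (main_out n m y L' R C \<beta> E ?T'))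
      \<le> 2 * (card (sym_diff ?T ?Tm) + card (sym_diff ?Tm ?T')) + 4" by simp
    then have "of_nat (card (sym_diff (main_out n m x L R C \<beta> E ?T) (main_out n m y L' R C \<beta> E ?T')))
      \<le> (of_nat (2 * (card (sym_diff ?T ?Tm) + card (sym_diff ?Tm ?T')) + 4) :: ennreal)"
      by (simp only: of_nat_le_iff)
    then show ?thesis by (simp only: of_nat_add of_nat_mult of_nat_numeral)
  qed
  have "expect_inner n A t (\<lambda>f E \<omega>. of_nat (card (sym_diff
       (main_out n m x L R C \<beta> E (tree_sel t z \<omega>)) (main_out n m y L' R C \<beta> E (tree_sel t z' \<omega>)))))
    \<le> expect_inner n A t (\<lambda>f E \<omega>. 2 * (of_nat (card (sym_diff (tree_sel t z \<omega>) (tree_sel t zm \<omega>)))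
       + of_nat (card (sym_diff (tree_sel t zm \<omega>) (tree_sel t z' \<omega>)))) + 4)"
    by (intro expect_inner_mono pw)
  also have "\<dots> = 2 * ((\<integral>\<^sup>+\<omega>. of_nat (card (sym_diff (tree_sel t z \<omega>) (tree_sel t zm \<omega>))) \<partial>tree_space t)
      + (\<integral>\<^sup>+\<omega>. of_nat (card (sym_diff (tree_sel t zm \<omega>) (tree_sel t z' \<omega>))) \<partial>tree_space t)) + 4"
    unfolding expect_inner_const_f[OF A]
    using measurable_tree_pair[OF t(1), of "\<lambda>A B. of_nat (card (sym_diff A B))" z zm]
      measurable_tree_pair[OF t(1), of "\<lambda>A B. of_nat (card (sym_diff A B))" zm z']
    by (simp add: prob_space.emeasure_space_1 prob_space_clocks prob_space_tree_space nn_integral_cmult nn_integral_add)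
  also have "\<dots> \<le> 2 * (ennreal (2 * real (depth t) + 1) + ennreal (2 * real (depth t) + 1)) + 4"
    by (intro add_right_mono mult_left_mono add_mono s1 s2) simp
  also have "\<dots> = ennreal (4 * (2 * real (depth t) + 1) + 4)"
  proof -
    have "2 * ennreal (2 * (2 * real (depth t) + 1)) = ennreal (2 * (2 * (2 * real (depth t) + 1)))"
      by (subst ennreal_mult[of 2]) auto
    moreover have "ennreal (2 * real (depth t) + 1) + ennreal (2 * real (depth t) + 1) = ennreal (2 * (2 * real (depth t) + 1))"
      by (simp add: ennreal_plus[symmetric] del: ennreal_plus)
    moreover have "ennreal (4 * (2 * real (depth t) + 1)) + 4 = ennreal (4 * (2 * real (depth t) + 1) + 4)"
      by (subst ennreal_plus) auto
    ultimately show ?thesis by simp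
  qed
  finally show ?thesis unfolding z_def z'_def y_def L'_def .
qed

subsection \<open>Collisions and overflows\<close>

text \<open>Given all coordinates but \<open>i\<close>, the target \<open>g x\<close> is a constant,
  and the independent uniform value at \<open>i\<close> hits it with probability at most 1 /
  N.\<close>

lemma nn_integral_PiM_uniform_eq:
  fixes g :: "('i \<Rightarrow> nat) \<Rightarrow> nat"
  assumes "finite I" "i \<in> I" "0 < N" and g: "\<And>x y. g (x(i := y)) = g x"
  shows "(\<integral>\<^sup>+x. of_bool (x i = g x) \<partial>(uniform_funs I {1..N})) \<le> ennreal (1 / real N)"
proof -
  interpret U: prob_space "uniform_count_measure {1..N}"
    using assms(3) by (intro prob_space_uniform_count_measure) auto
  interpret product_prob_space "\<lambda>_. uniform_count_measure {1..N}" by unfold_locales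
  define J where "J = I - {i}"
  have J: "I = insert i J" "finite J" "i \<notin> J" using assms by (auto simp: J_def)
  have K: "prob_space (uniform_funs J {1..N})" by (intro prob_space_PiM) unfold_locales
  have "(\<integral>\<^sup>+x. of_bool (x i = g x) \<partial>(uniform_funs I {1..N}))
     = (\<integral>\<^sup>+x. (\<integral>\<^sup>+y. of_bool ((x(i := y)) i = g (x(i := y))) \<partial>uniform_count_measure {1..N})
         \<partial>(uniform_funs J {1..N}))"
    unfolding J(1) using J(2,3)
    by (intro product_nn_integral_insert) (simp_all add: measurable_from_PiM_uniform_count)
  also have "\<dots> \<le> (\<integral>\<^sup>+x. ennreal (1 / real N) \<partial>(uniform_funs J {1..N}))"
  proof (intro nn_integral_mono)
    fix x
    have "(\<integral>\<^sup>+y. of_bool ((x(i := y)) i = g (x(i := y))) \<partial>uniform_count_measure {1..N})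
      = (\<integral>\<^sup>+y. indicator ({g x} \<inter> {1..N}) y \<partial>uniform_count_measure {1..N})"
      by (intro nn_integral_cong) (auto simp: g space_uniform_count_measure split: split_indicator)
    also have "\<dots> = ennreal (card ({g x} \<inter> {1..N}) / card {1..N})"
      by (subst nn_integral_indicator)
         (auto simp: sets_uniform_count_measure emeasure_uniform_count_measure)
    also have "\<dots> \<le> ennreal (1 / real N)"
    proof (intro ennreal_leI)
      have "card ({g x} \<inter> {1..N}) \<le> card {g x}" by (intro card_mono) auto
      then have "real (card ({g x} \<inter> {1..N})) \<le> 1" by simp
      then show "real (card ({g x} \<inter> {1..N})) / real (card {1..N}) \<le> 1 / real N"
        unfolding card_atLeastAtMost by (intro frac_le) (use assms(3) in auto)
    qed
    finally show "(\<integral>\<^sup>+y. of_bool ((x(i := y)) i = g (x(i := y))) \<partial>uniform_count_measure {1..N}) \<le> ennreal (1 / real N)" .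
  qed
  also have "\<dots> = ennreal (1 / real N)" by (rule nn_integral_prob_const[OF K])
  finally show ?thesis .
qed

lemma prob_space_PiM_uniform: "0 < N \<Longrightarrow> prob_space (uniform_funs I {1..N::nat})"
  by (intro prob_space_PiM prob_space_uniform_count_measure) auto

lemma nn_integral_PiM_uniform_const:
  "0 < N \<Longrightarrow> (\<integral>\<^sup>+x. c \<partial>(uniform_funs I {1..N::nat})) = c"
  by (rule nn_integral_prob_const[OF prob_space_PiM_uniform])

text \<open>A superset of the large elements that works for every \<sigma> \<ge> 0 and still has at
  most 10k members.\<close>

definition candidates :: "nat \<Rightarrow> (nat \<Rightarrow> real) \<Rightarrow> nat set" where
  "candidates n x = {i \<in> {1..n}. 1 / 10 < x i}"

text \<open>A sum over ordered pairs in place of the event: it is at least 1 whenever a collision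
  occurs, and its expectation is linear.\<close>

definition collision_count :: "nat \<Rightarrow> nat \<Rightarrow> (nat \<Rightarrow> real) \<Rightarrow> (nat \<Rightarrow> nat) \<Rightarrow> (nat \<Rightarrow> nat) \<Rightarrow> ennreal" where
  "collision_count n m x R C = (\<Sum>(p, q)\<in>{(p, q). p \<in> candidates n x <+> {1..m} \<and> q \<in> candidates n x <+> {1..m} \<and> p \<noteq> q}.
     of_bool (case_sum C R p = case_sum C R q))"

text \<open>The factor 2 normalises this to be at least 1 on overflow. Weighting a pair by the
  product of its entries keeps the expectation independent of n.\<close>

definition pair_mass :: "nat \<Rightarrow> (nat \<Rightarrow> real) \<Rightarrow> (nat \<Rightarrow> nat) \<Rightarrow> ennreal" where
  "pair_mass n x \<beta> = (\<Sum>(i, i')\<in>{(i, i'). i \<in> {1..n} \<and> i' \<in> {1..n} \<and> i \<noteq> i'}.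
     ennreal (2 * (x i * x i')) * of_bool (\<beta> i = \<beta> i'))"

lemma finite_pairs: "finite P \<Longrightarrow> finite {(p, q). p \<in> P \<and> q \<in> P \<and> p \<noteq> q}"
  by (rule finite_subset[of _ "P \<times> P"]) auto

lemma finite_candidates [simp]: "finite (candidates n x)"
  by (simp add: candidates_def)

lemma large_set_candidates: "0 \<le> \<sigma> \<Longrightarrow> large_set n \<sigma> x \<subseteq> candidates n x"
  by (auto simp: large_set_def candidates_def)

lemma card_candidates:
  assumes "x \<in> Delta n k"
  shows "card (candidates n x) \<le> 10 * k"
proof -
  have "real (card (candidates n x)) * (1 / 10) = (\<Sum>i\<in>candidates n x. 1 / 10)" by simp
  also have "\<dots> \<le> (\<Sum>i\<in>candidates n x. x i)" by (intro sum_mono) (auto simp: candidates_def)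
  also have "\<dots> \<le> (\<Sum>i\<in>{1..n}. x i)"
    using Delta_range[OF assms] by (intro sum_mono2) (auto simp: candidates_def)
  also have "\<dots> \<le> real k" using sum_Delta_le[OF assms] .
  finally show ?thesis by linarith
qed

lemma collision_count_ge_1:
  assumes "collision m L R C" "L \<subseteq> candidates n x"
  shows "1 \<le> collision_count n m x R C"
proof -
  let ?P = "candidates n x <+> {1..m}"
  obtain p q where pq: "p \<in> L <+> {1..m}" "q \<in> L <+> {1..m}" "case_sum C R p = case_sum C R q" "p \<noteq> q"
    using assms(1) by (auto simp: collision_def inj_on_def)
  have "p \<in> ?P" "q \<in> ?P" using pq(1,2) assms(2) by auto
  then have "(p, q) \<in> {(p, q). p \<in> ?P \<and> q \<in> ?P \<and> p \<noteq> q}" using pq by auto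
  moreover have "finite {(p, q). p \<in> ?P \<and> q \<in> ?P \<and> p \<noteq> q}" by (intro finite_pairs) auto
  ultimately have "(case (p, q) of (p, q) \<Rightarrow> of_bool (case_sum C R p = case_sum C R q)) \<le> collision_count n m x R C"
    unfolding collision_count_def by (intro member_le_sum) auto
  then show ?thesis using pq by simp
qed

text \<open>There are at most 10k + m \<le> 2m possible occupants, hence at most 4m^2 ordered pairs,
  and each pair collides with probability at most 1/d = 1/m^3.\<close>

lemma expectation_collision_count:
  assumes x: "x \<in> Delta n k" and md: "10 * k \<le> m" "0 < m" "d = m ^ 3"
  shows "(\<integral>\<^sup>+R. \<integral>\<^sup>+C. collision_count n m x R C \<partial>(uniform_funs {1..n} {1..d})
       \<partial>(uniform_funs {1..m} {1..d})) \<le> ennreal (4 / real m)"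
proof -
  let ?MR = "uniform_funs {1..m} {1..d}" and ?MC = "uniform_funs {1..n} {1..d}"
  let ?P = "candidates n x <+> {1..m}"
  define Q where "Q = {(p, q). p \<in> ?P \<and> q \<in> ?P \<and> p \<noteq> q}"
  have d: "0 < d" using md by simp
  have finQ: "finite Q" unfolding Q_def by (intro finite_pairs) auto
  have cn: "i \<in> {1..n}" if "i \<in> candidates n x" for i using that by (simp add: candidates_def)
  have pair: "(\<integral>\<^sup>+R. \<integral>\<^sup>+C. of_bool (case_sum C R p = case_sum C R q) \<partial>?MC \<partial>?MR) \<le> ennreal (1 / real d)"
    if "(p, q) \<in> Q" for p q
  proof -
    have RR: "(\<integral>\<^sup>+R. c \<partial>?MR) = c" "(\<integral>\<^sup>+C. c \<partial>?MC) = c" for c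
      by (rule nn_integral_PiM_uniform_const[OF d])+
    \<comment> \<open>Unless both occupants are buckets, the pair is already random in
      \<open>C\<close> for a fixed \<open>R\<close>.\<close>
    have CC: ?thesis if "\<And>R. (\<integral>\<^sup>+C. of_bool (case_sum C R p = case_sum C R q) \<partial>?MC) \<le> ennreal (1 / real d)"
    proof -
      have "(\<integral>\<^sup>+R. \<integral>\<^sup>+C. of_bool (case_sum C R p = case_sum C R q) \<partial>?MC \<partial>?MR) \<le> (\<integral>\<^sup>+R. ennreal (1 / real d) \<partial>?MR)"
        by (intro nn_integral_mono that)
      then show ?thesis by (simp only: RR)
    qed
    have pq: "p \<in> ?P" "q \<in> ?P" "p \<noteq> q" using that by (auto simp: Q_def)
    show ?thesis
    proof (cases p; cases q)
      fix i i' assume e: "p = Inl i" "q = Inl i'"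
      have "(\<integral>\<^sup>+C. of_bool (case_sum C R p = case_sum C R q) \<partial>?MC) \<le> ennreal (1 / real d)" for R
        unfolding e sum.case using pq e d cn by (intro nn_integral_PiM_uniform_eq[where g = "\<lambda>C. C i'"]) auto
      then show ?thesis by (rule CC)
    next
      fix i b assume e: "p = Inl i" "q = Inr b"
      have "(\<integral>\<^sup>+C. of_bool (case_sum C R p = case_sum C R q) \<partial>?MC) \<le> ennreal (1 / real d)" for R
        unfolding e sum.case using pq e d cn by (intro nn_integral_PiM_uniform_eq) auto
      then show ?thesis by (rule CC)
    next
      fix i b assume e: "p = Inr b" "q = Inl i"
      have "(\<integral>\<^sup>+C. of_bool (case_sum C R p = case_sum C R q) \<partial>?MC) \<le> ennreal (1 / real d)" for R
        unfolding e sum.case eq_commute[of "R b"] using pq e d cn by (intro nn_integral_PiM_uniform_eq) auto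
      then show ?thesis by (rule CC)
    next
      fix b b' assume e: "p = Inr b" "q = Inr b'"
      show ?thesis
        unfolding e sum.case RR using pq e d by (intro nn_integral_PiM_uniform_eq[where g = "\<lambda>R. R b'"]) auto
    qed
  qed
  have "(\<integral>\<^sup>+R. \<integral>\<^sup>+C. collision_count n m x R C \<partial>?MC \<partial>?MR)
     = (\<Sum>(p, q)\<in>Q. \<integral>\<^sup>+R. \<integral>\<^sup>+C. of_bool (case_sum C R p = case_sum C R q) \<partial>?MC \<partial>?MR)"
    unfolding collision_count_def Q_def[symmetric] case_prod_beta
    by (simp add: nn_integral_sum measurable_from_PiM_uniform_count)
  also have "\<dots> \<le> (\<Sum>(p, q)\<in>Q. ennreal (1 / real d))"
    using pair by (intro sum_mono) auto
  also have "\<dots> = ennreal (real (card Q) * (1 / real d))"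
    by (simp add: case_prod_beta ennreal_mult[symmetric] ennreal_of_nat_eq_real_of_nat)
  also have "real (card Q) * (1 / real d) \<le> 4 / real m"
  proof -
    have "card ?P \<le> 2 * m" using card_candidates[OF x] md by (simp add: card_Plus)
    have "card Q \<le> card (?P \<times> ?P)" by (intro card_mono) (auto simp: Q_def)
    also have "\<dots> = card ?P * card ?P" by (rule card_cartesian_product)
    also have "\<dots> \<le> (2 * m) * (2 * m)" using \<open>card ?P \<le> 2 * m\<close> by (intro mult_mono) auto
    finally have "card Q \<le> 4 * m ^ 2" by (simp add: power2_eq_square)
    then have "real (card Q) \<le> 4 * real m ^ 2"
      by (metis of_nat_le_iff of_nat_mult of_nat_numeral of_nat_power)
    then have "real (card Q) * (1 / real d) \<le> 4 * real m ^ 2 * (1 / real d)"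
      by (intro mult_right_mono) auto
    also have "\<dots> = 4 / real m" using md by (simp add: power2_eq_square power3_eq_cube)
    finally show ?thesis .
  qed
  finally show ?thesis by (simp add: ennreal_leI)
qed

text \<open>The bucket has load s > 9/10 and its members are at most 1/5, so no element fills it
  alone. The mass off the diagonal is at least s^2 - s/5 > 9/10 * 7/10, which exceeds 1/2.\<close>

lemma overflow_pair_mass:
  assumes x: "x \<in> Delta n k" and L: "L = large_set n \<sigma> x" and \<sigma>: "\<sigma> \<le> 1 / 10" and \<tau>: "\<tau> \<le> 1 / 10"
    and ov: "overflow n m x L \<beta> \<tau>"
  shows "1 \<le> pair_mass n x \<beta>"
proof -
  obtain b where b: "1 - \<tau> < load n x L \<beta> b" using ov by (auto simp: overflow_def)
  define M where "M = members n x L \<beta> b"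
  have M: "finite M" "M \<subseteq> {1..n}" "\<And>i. i \<in> M \<Longrightarrow> \<beta> i = b" by (auto simp: M_def members_def)
  have xM: "0 < x i" "x i \<le> 1 / 5" if "i \<in> M" for i
    using that \<sigma> by (auto simp: M_def members_def L large_set_def)
  define s where "s = sum x M"
  have s: "9 / 10 < s" using b \<tau> by (simp add: s_def load_def M_def)
  let ?D = "{(i, i'). i \<in> M \<and> i' \<in> M \<and> i \<noteq> i'}" and ?N = "{(i, i'). i \<in> {1..n} \<and> i' \<in> {1..n} \<and> i \<noteq> i'}"
  have off: "(\<Sum>(i, i')\<in>?D. x i * x i') = s * s - (\<Sum>i\<in>M. x i * x i)"
  proof -
    have "s * s = (\<Sum>(i, i')\<in>M \<times> M. x i * x i')"
      unfolding s_def by (simp add: sum_product sum.cartesian_product)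
    also have "M \<times> M = ?D \<union> (\<lambda>i. (i, i)) ` M" by auto
    also have "(\<Sum>(i, i')\<in>?D \<union> (\<lambda>i. (i, i)) ` M. x i * x i')
        = (\<Sum>(i, i')\<in>?D. x i * x i') + (\<Sum>(i, i')\<in>(\<lambda>i. (i, i)) ` M. x i * x i')"
      using M finite_pairs[OF M(1)] by (intro sum.union_disjoint) auto
    also have "(\<Sum>(i, i')\<in>(\<lambda>i. (i, i)) ` M. x i * x i') = (\<Sum>i\<in>M. x i * x i)"
      by (subst sum.reindex) (auto simp: inj_on_def)
    finally show ?thesis by simp
  qed
  have "(\<Sum>i\<in>M. x i * x i) \<le> (\<Sum>i\<in>M. x i * (1 / 5))"
    using xM by (intro sum_mono mult_left_mono) (auto intro: less_imp_le)
  also have "\<dots> = s / 5" by (simp add: s_def sum_divide_distrib)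
  finally have "s * s - s / 5 \<le> (\<Sum>(i, i')\<in>?D. x i * x i')" using off by simp
  moreover have "1 / 2 \<le> s * s - s / 5"
  proof -
    have "9 / 10 * (7 / 10) \<le> s * (s - 1 / 5)" using s by (intro mult_mono) auto
    then show ?thesis by (simp add: algebra_simps)
  qed
  ultimately have "1 \<le> (\<Sum>(i, i')\<in>?D. 2 * (x i * x i'))"
    by (simp add: case_prod_beta sum_distrib_left[symmetric])
  then have "1 \<le> ennreal (\<Sum>(i, i')\<in>?D. 2 * (x i * x i'))"
    by (simp only: ennreal_leI flip: ennreal_1)
  also have "\<dots> = (\<Sum>(i, i')\<in>?D. ennreal (2 * (x i * x i')))"
    using xM unfolding case_prod_beta
    by (subst sum_ennreal) (auto intro: mult_nonneg_nonneg less_imp_le)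
  also have "\<dots> = (\<Sum>(i, i')\<in>?D. ennreal (2 * (x i * x i')) * of_bool (\<beta> i = \<beta> i'))"
    using M(3) by (intro sum.cong) auto
  also have "\<dots> \<le> pair_mass n x \<beta>"
    unfolding pair_mass_def using M finite_pairs[of "{1..n}"] by (intro sum_mono2) auto
  finally show ?thesis .
qed

text \<open>A pair shares its bucket with probability at most 1/m, and the products over all pairs
  add up to at most the square of the sum of the entries.\<close>

lemma expectation_pair_mass:
  assumes x: "x \<in> Delta n k" and m: "0 < m"
  shows "(\<integral>\<^sup>+\<beta>. pair_mass n x \<beta> \<partial>(uniform_funs {1..n} {1..m})) \<le> ennreal (2 * real k ^ 2 / real m)"
proof -
  let ?M = "uniform_funs {1..n} {1..m}"
  let ?N = "{(i, i'). i \<in> {1..n} \<and> i' \<in> {1..n} \<and> i \<noteq> i'}"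
  have x0: "0 \<le> x i" if "i \<in> {1..n}" for i using Delta_range[OF x that] by simp
  have "(\<integral>\<^sup>+\<beta>. pair_mass n x \<beta> \<partial>?M) = (\<Sum>(i, i')\<in>?N. ennreal (2 * (x i * x i')) * (\<integral>\<^sup>+\<beta>. of_bool (\<beta> i = \<beta> i') \<partial>?M))"
    unfolding pair_mass_def case_prod_beta
    by (simp add: nn_integral_sum nn_integral_cmult measurable_from_PiM_uniform_count)
  also have "\<dots> \<le> (\<Sum>(i, i')\<in>?N. ennreal (2 * (x i * x i')) * ennreal (1 / real m))"
  proof (intro sum_mono, clarify)
    fix i i' assume "i \<in> {1..n}" "i' \<in> {1..n}" "i \<noteq> i'"
    then show "ennreal (2 * (x i * x i')) * (\<integral>\<^sup>+\<beta>. of_bool (\<beta> i = \<beta> i') \<partial>?M) \<le> ennreal (2 * (x i * x i')) * ennreal (1 / real m)"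
      using m by (intro mult_left_mono nn_integral_PiM_uniform_eq[where g = "\<lambda>\<beta>. \<beta> i'"]) auto
  qed
  also have "\<dots> = (\<Sum>(i, i')\<in>?N. ennreal (2 * (x i * x i') / real m))"
    using x0 by (intro sum.cong refl) (auto simp: ennreal_mult[symmetric])
  also have "\<dots> = ennreal (\<Sum>(i, i')\<in>?N. 2 * (x i * x i') / real m)"
    using x0 unfolding case_prod_beta by (subst sum_ennreal) auto
  also have "\<dots> \<le> ennreal (\<Sum>(i, i')\<in>{1..n} \<times> {1..n}. 2 * (x i * x i') / real m)"
    using x0 by (intro ennreal_leI sum_mono2) auto
  also have "(\<Sum>(i, i')\<in>{1..n} \<times> {1..n}. 2 * (x i * x i') / real m) = 2 * (sum x {1..n}) ^ 2 / real m"
  proof -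
    have "(sum x {1..n}) ^ 2 = (\<Sum>(i, i')\<in>{1..n} \<times> {1..n}. x i * x i')"
      by (simp add: power2_eq_square sum_product sum.cartesian_product)
    then show ?thesis by (simp only: split_def sum_distrib_left sum_divide_distrib)
  qed
  also have "\<dots> \<le> 2 * real k ^ 2 / real m"
    using sum_Delta_le[OF x] x0 by (intro divide_right_mono mult_left_mono power_mono sum_nonneg) auto
  finally show ?thesis by (simp add: ennreal_leI)
qed

text \<open>The common form for both shifts: \<open>A\<close> is always paid and \<open>B\<close>
  only on an interval. With b - a = 1/10, an interval of length \<delta> yields the factor 10
  \<delta>.\<close>

lemma nn_integral_add_of_bool:
  assumes "a < b" "c \<le> d" "\<And>u. P u \<Longrightarrow> c \<le> u \<and> u \<le> d"
    and h: "AE u in uniform_real a b. h u \<le> A + B * of_bool (P u)"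
  shows "(\<integral>\<^sup>+u. h u \<partial>uniform_real a b) \<le> A + B * ennreal ((d - c) / (b - a))"
proof -
  interpret prob_space "uniform_real a b" using assms(1) by (rule prob_space_uniform_real)
  have "(\<integral>\<^sup>+u. h u \<partial>uniform_real a b) \<le> (\<integral>\<^sup>+u. A + B * indicator {c..d} u \<partial>uniform_real a b)"
    using h
  proof (intro nn_integral_mono_AE, eventually_elim)
    fix u assume "h u \<le> A + B * of_bool (P u)"
    also have "\<dots> \<le> A + B * indicator {c..d} u"
      using assms(3)[of u] by (intro add_left_mono mult_left_mono) (auto split: split_indicator)
    finally show "h u \<le> A + B * indicator {c..d} u" .
  qed
  also have "\<dots> = A + B * emeasure (uniform_real a b) {c..d}"
    using emeasure_space_1 by (simp add: nn_integral_add nn_integral_cmult)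
  also have "\<dots> \<le> A + B * ennreal ((d - c) / (b - a))"
    using assms by (intro add_left_mono mult_left_mono emeasure_uniform_real_le) auto
  finally show ?thesis .
qed

section \<open>The case distinction for fixed hashing and shifts\<close>

lemma l1_dist_update:
  assumes "j \<in> {1..n}"
  shows "l1_dist n x (x(j := v)) = \<bar>v - x j\<bar>"
proof -
  have "(\<Sum>i\<in>{1..n}. \<bar>x i - (x(j := v)) i\<bar>) = (\<Sum>i\<in>{1..n}. if i = j then \<bar>v - x j\<bar> else 0)"
    by (intro sum.cong) auto
  then show ?thesis using assms by (simp add: l1_dist_def l1_norm_def)
qed

lemma expect_mixed:
  assumes A: "correlated_sampling n k A" "stretch n k \<alpha> A" and t: "distinct (leaves t)" "set (leaves t) = {1..d}"
    and x: "x \<in> Delta n k" "y \<in> Delta n k" and L: "L \<subseteq> {1..n}"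
    and rnd: "R \<in> {1..m} \<rightarrow> {1..d}" "C \<in> {1..n} \<rightarrow> {1..d}" "\<beta> \<in> {1..n} \<rightarrow> {1..m}"
    and nf: "\<not> collision m L R C" "\<not> overflow n m y L \<beta> \<tau>" "0 \<le> \<tau>"
  shows "expect_inner n A t (\<lambda>f E \<omega>. of_nat (card (sym_diff (f x)
      (main_out n m y L R C \<beta> E (tree_sel t (xhat n m d y L R C \<beta>) \<omega>))))) \<le> ennreal (2 * real k)"
proof (rule expect_one_fallback[OF A x(1) t(1)])
  show "xhat n m d y L R C \<beta> ` set (leaves t) \<subseteq> {0..1}"
    unfolding t(2) by (rule xhat_range[OF x(2) L nf])
  have "(\<Sum>l\<in>{1..d}. xhat n m d y L R C \<beta> l) = (\<Sum>i\<in>{1..n}. y i)"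
    using Delta_range[OF x(2)] L rnd by (intro sum_xhat) auto
  then show "(\<Sum>l\<in>set (leaves t). xhat n m d y L R C \<beta> l) \<le> real k"
    unfolding t(2) using sum_Delta_le[OF x(2)] by simp
  fix E and T :: "nat set" assume "finite T"
  have "finite L" by (rule finite_subset[OF L]) simp
  then show "finite (main_out n m y L R C \<beta> E T) \<and> card (main_out n m y L R C \<beta> E T) \<le> card T"
    by (intro conjI card_main_out_le[OF nf(1)] \<open>finite T\<close> finite_subset[OF main_out_subset[OF L]]) auto
qed

text \<open>\<open>move\<close>: the status of \<open>j\<close> changes; \<open>near\<close>: the load of its bucket may cross the overflow threshold;
  \<open>Qx + Ox \<ge> 1\<close> whenever \<open>x\<close> falls back.\<close>

definition stability_bound where
  "stability_bound k \<alpha> D \<delta> Qx Qy Ox Oy move near =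
     ennreal (\<alpha> * \<delta>) * (Qx + Ox) + of_bool move * (ennreal (2 * real k) * (Qx + Qy + Ox + Oy) + ennreal (4 * D + 4))
     + ennreal (2 * real k) * Oy * of_bool near + ennreal ((2 * D + 2) * \<delta>)"

text \<open>If \<open>j\<close> keeps its status, both inputs have the same large elements and hence
  the same collisions, while no load decreases. So \<open>x\<close> cannot fall back alone;
  \<open>y\<close> can only if the bucket of \<open>j\<close> crosses 1 - \<tau>, which is the event
  \<open>near\<close>. If the status of \<open>j\<close> changes, crude bounds suffice because that
  event is itself unlikely.\<close>

lemma expect_inner_ALG:
  fixes n k :: nat and \<alpha> :: real and A :: map_distr and t :: btree and x :: "nat \<Rightarrow> real"
  defines "m \<equiv> num_buckets k \<alpha>" and "d \<equiv> num_slots k \<alpha>"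
  assumes A: "correlated_sampling n k A" "stretch n k \<alpha> A" and t: "distinct (leaves t)" "set (leaves t) = {1..d}"
    and x: "x \<in> Delta n k" "x(j := v) \<in> Delta n k" and j: "j \<in> {1..n}" "x j < v"
    and rnd: "R \<in> {1..m} \<rightarrow> {1..d}" "C \<in> {1..n} \<rightarrow> {1..d}" "\<beta> \<in> {1..n} \<rightarrow> {1..m}"
    and \<sigma>: "0 \<le> \<sigma>" "\<sigma> \<le> 1 / 10" and \<tau>: "0 \<le> \<tau>" "\<tau> \<le> 1 / 10"
  shows "expect_inner n A t (\<lambda>f E \<omega>. of_nat (card (sym_diff
       (ALG n k \<alpha> t (f, E, snd \<omega>, fst \<omega>, R, C, \<beta>, \<sigma>, \<tau>) x)
       (ALG n k \<alpha> t (f, E, snd \<omega>, fst \<omega>, R, C, \<beta>, \<sigma>, \<tau>) (x(j := v))))))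
    \<le> stability_bound k \<alpha> (2 * real (depth t) + 1) (v - x j)
       (collision_count n m x R C) (collision_count n m (x(j := v)) R C) (pair_mass n x \<beta>) (pair_mass n (x(j := v)) \<beta>)
       (x j \<le> 1 / 10 + \<sigma> \<and> 1 / 10 + \<sigma> < v)
       (\<tau> \<in> {1 - load n x (large_set n \<sigma> x) \<beta> (\<beta> j) - (v - x j)..1 - load n x (large_set n \<sigma> x) \<beta> (\<beta> j)})"
    (is "?E \<le> stability_bound k \<alpha> ?D ?\<delta> ?Qx ?Qy ?Ox ?Oy ?move ?near")
proof -
  define y where "y = x(j := v)"
  define Lx Ly where "Lx = large_set n \<sigma> x" and "Ly = large_set n \<sigma> y"
  note alg = ALG_eq[of n k \<alpha> t _ _ _ _ R C \<beta> \<sigma> \<tau>, folded m_def d_def]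
  note y_fold = y_def[symmetric]
  have ps: "prob_space A" using A(1) by (simp add: correlated_sampling_def)
  have Lsub: "Lx \<subseteq> {1..n}" "Ly \<subseteq> {1..n}" by (auto simp: Lx_def Ly_def large_set_def)
  have xj: "0 \<le> x j" using Delta_range[OF x(1) j(1)] by simp
  have fb: "1 \<le> collision_count n m w R C + pair_mass n w \<beta>" if "fallback n m w R C \<beta> \<sigma> \<tau>" "w \<in> Delta n k" for w
  proof -
    have "collision m (large_set n \<sigma> w) R C \<Longrightarrow> 1 \<le> collision_count n m w R C"
      using collision_count_ge_1 large_set_candidates[OF \<sigma>(1)] by blast
    moreover have "overflow n m w (large_set n \<sigma> w) \<beta> \<tau> \<Longrightarrow> 1 \<le> pair_mass n w \<beta>"
      using overflow_pair_mass[OF that(2) refl \<sigma>(2) \<tau>(2)] by blast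
    ultimately show ?thesis using that(1) unfolding fallback_def
      by (metis add_increasing add_increasing2 zero_le)
  qed
  have moveL: "j \<notin> Lx \<and> Ly = insert j Lx" if ?move
    using that j by (auto simp: Lx_def Ly_def y_def large_set_def)
  have stayL: "Ly = Lx" if "\<not> ?move"
    using that j by (auto simp: Lx_def Ly_def y_def large_set_def)
  have load_le: "load n x Lx \<beta> b \<le> load n y Lx \<beta> b" for b
  proof (cases "j \<in> Lx")
    case True then show ?thesis by (simp add: y_def main_out_large_cong(2))
  next
    case False
    note upd = load_update(1)[of j n x v Lx, OF j(1) xj j(2) False, of \<beta>]
      load_update(2)[where j = j and n = n and x = x and v = v and L = Lx and \<beta> = \<beta> and b = b, OF j(1) xj j(2) False]
    show ?thesis using upd j by (cases "b = \<beta> j") (auto simp: y_def)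
  qed
  have moved_bound: "ennreal (2 * real k) \<le> stability_bound k \<alpha> ?D ?\<delta> ?Qx ?Qy ?Ox ?Oy ?move ?near"
    if "1 \<le> ?Qx + ?Qy + ?Ox + ?Oy" "?move"
  proof -
    have "ennreal (2 * real k) * 1 \<le> ennreal (2 * real k) * (?Qx + ?Qy + ?Ox + ?Oy)"
      using that(1) by (rule mult_left_mono) simp
    also have "\<dots> \<le> stability_bound k \<alpha> ?D ?\<delta> ?Qx ?Qy ?Ox ?Oy ?move ?near"
      unfolding stability_bound_def using that(2) by (simp add: add_increasing add_increasing2)
    finally show ?thesis by simp
  qed
  consider "fallback n m x R C \<beta> \<sigma> \<tau>" "fallback n m y R C \<beta> \<sigma> \<tau>"
    | "fallback n m x R C \<beta> \<sigma> \<tau>" "\<not> fallback n m y R C \<beta> \<sigma> \<tau>"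
    | "\<not> fallback n m x R C \<beta> \<sigma> \<tau>" "fallback n m y R C \<beta> \<sigma> \<tau>"
    | "\<not> fallback n m x R C \<beta> \<sigma> \<tau>" "\<not> fallback n m y R C \<beta> \<sigma> \<tau>"
    by blast
  then show ?thesis
  proof cases
    case 1
    have "?E \<le> ennreal (\<alpha> * ?\<delta>) * 1"
      using expect_both_fallback[OF A x, of t] l1_dist_update[OF j(1), of x v] 1 j
      unfolding y_fold alg by simp
    also have "\<dots> \<le> ennreal (\<alpha> * ?\<delta>) * (?Qx + ?Ox)" using fb[OF 1(1) x(1)] by (rule mult_left_mono) simp
    also have "\<dots> \<le> stability_bound k \<alpha> ?D ?\<delta> ?Qx ?Qy ?Ox ?Oy ?move ?near"
      unfolding stability_bound_def by (simp add: add.assoc)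
    finally show ?thesis .
  next
    case 4
    then have nf: "\<not> collision m Lx R C" "\<not> overflow n m x Lx \<beta> \<tau>" "\<not> collision m Ly R C" "\<not> overflow n m y Ly \<beta> \<tau>"
      by (auto simp: fallback_def Lx_def Ly_def)
    have E: "?E = expect_inner n A t (\<lambda>f E \<omega>. of_nat (card (sym_diff
       (main_out n m x Lx R C \<beta> E (tree_sel t (xhat n m d x Lx R C \<beta>) \<omega>))
       (main_out n m y Ly R C \<beta> E (tree_sel t (xhat n m d y Ly R C \<beta>) \<omega>)))))"
      using 4 unfolding y_fold alg Lx_def[symmetric] Ly_def[symmetric] by simp
    show ?thesis
    proof (cases ?move)
      case True
      have "?E \<le> ennreal (4 * ?D + 4)"
      proof -
        have mv: "j \<notin> Lx" "Ly = insert j Lx" using moveL[OF True] by auto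
        show ?thesis unfolding E mv(2) y_def
          by (rule expect_main_move[OF ps t x j mv(1) Lsub(1) rnd nf(1) nf(3)[unfolded mv] nf(2) nf(4)[unfolded mv y_def] \<tau>(1)])
      qed
      also have "\<dots> \<le> stability_bound k \<alpha> ?D ?\<delta> ?Qx ?Qy ?Ox ?Oy ?move ?near"
        unfolding stability_bound_def using True by (simp add: add_increasing add_increasing2)
      finally show ?thesis .
    next
      case False
      have "?E \<le> ennreal ((2 * ?D + 2) * ?\<delta>)"
      proof (cases "j \<in> Lx")
        case True
        show ?thesis using nf unfolding E stayL[OF False] y_def
          by (intro expect_main_large[OF ps t x j(2) True Lsub(1) rnd(2) _ _ _ \<tau>(1)])
      next
        case F: False
        show ?thesis using nf unfolding E stayL[OF False] y_def
          by (intro expect_main_small[OF ps t x j F Lsub(1) rnd _ _ _ \<tau>(1)])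
      qed
      also have "\<dots> \<le> stability_bound k \<alpha> ?D ?\<delta> ?Qx ?Qy ?Ox ?Oy ?move ?near"
        unfolding stability_bound_def by (simp add: add_increasing)
      finally show ?thesis .
    qed
  next
    case 2
    then have nf: "\<not> collision m Ly R C" "\<not> overflow n m y Ly \<beta> \<tau>" by (auto simp: fallback_def Ly_def)
    have "?E \<le> ennreal (2 * real k)"
      using 2 expect_mixed[OF A t x(1) x(2)[folded y_def] Lsub(2) rnd nf \<tau>(1)]
      unfolding y_fold alg Ly_def[symmetric] by simp
    also have "\<dots> \<le> stability_bound k \<alpha> ?D ?\<delta> ?Qx ?Qy ?Ox ?Oy ?move ?near"
    proof (cases ?move)
      case True
      have "1 \<le> ?Qx + ?Qy + ?Ox + ?Oy"
        using fb[OF 2(1) x(1)] by (rule order_trans) (simp add: add_mono add_increasing2)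
      then show ?thesis using True by (rule moved_bound)
    next
      case False
      then have col: "\<not> collision m Lx R C" using nf stayL by simp
      then have "overflow n m x Lx \<beta> \<tau>" using 2(1) by (simp add: fallback_def Lx_def)
      then obtain b where b: "b \<in> {1..m}" "1 - \<tau> < load n x Lx \<beta> b" by (auto simp: overflow_def)
      then have "1 - \<tau> < load n y Lx \<beta> b" using load_le[of b] by simp
      then have "overflow n m y Ly \<beta> \<tau>" using b stayL[OF False] by (auto simp: overflow_def)
      then show ?thesis using nf by simp
    qed
    finally show ?thesis .
  next
    case 3
    then have nf: "\<not> collision m Lx R C" "\<not> overflow n m x Lx \<beta> \<tau>" by (auto simp: fallback_def Lx_def)
    have "?E \<le> ennreal (2 * real k)"
      using 3 expect_mixed[OF A t x(2)[folded y_def] x(1) Lsub(1) rnd nf \<tau>(1)]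
      unfolding y_fold alg Lx_def[symmetric] by (simp add: Un_commute)
    also have "\<dots> \<le> stability_bound k \<alpha> ?D ?\<delta> ?Qx ?Qy ?Ox ?Oy ?move ?near"
    proof (cases ?move)
      case True
      have "1 \<le> ?Qx + ?Qy + ?Ox + ?Oy"
        using fb[OF 3(2) x(2)[folded y_def]] unfolding y_def by (rule order_trans) (simp add: add_mono add_increasing add_increasing2)
      then show ?thesis using True by (rule moved_bound)
    next
      case False
      then have "\<not> collision m Ly R C" using nf stayL by simp
      then have ov: "overflow n m y Ly \<beta> \<tau>" using 3(2) by (simp add: fallback_def Ly_def)
      then obtain b where b: "b \<in> {1..m}" "1 - \<tau> < load n y Lx \<beta> b" using stayL[OF False] by (auto simp: overflow_def)
      have bx: "load n x Lx \<beta> b \<le> 1 - \<tau>" using nf(2) b(1) by (auto simp: overflow_def not_less)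
      have jL: "j \<notin> Lx" using main_out_large_cong(2)[of j Lx n x v \<beta> b] b bx unfolding y_def by auto
      have bj: "b = \<beta> j" using load_update(2)[of j n x v Lx, OF j(1) xj j(2) jL] b bx unfolding y_def by fastforce
      have ?near
        using b bx load_update(1)[of j n x v Lx, OF j(1) xj j(2) jL, of \<beta>] unfolding y_def bj Lx_def[symmetric] by simp
      have "1 \<le> ?Oy" using overflow_pair_mass[OF x(2)[folded y_def] Ly_def \<sigma>(2) \<tau>(2) ov] by (simp add: y_def)
      then have "ennreal (2 * real k) * 1 \<le> ennreal (2 * real k) * ?Oy" by (rule mult_left_mono) simp
      also have "\<dots> \<le> stability_bound k \<alpha> ?D ?\<delta> ?Qx ?Qy ?Ox ?Oy ?move ?near"
        unfolding stability_bound_def using \<open>?near\<close> by (simp add: add_increasing add_increasing2)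
      finally show ?thesis by simp
    qed
    finally show ?thesis .
  qed
qed

subsection \<open>The expected change under the shared randomness\<close>

text \<open>The fifth factor, later all of the hashing with the shifts, is moved to the outside, and
  the two tree components are paired as in \<open>tree_space\<close>.\<close>

lemma nn_integral_five:
  assumes "sigma_finite_measure M1" "sigma_finite_measure M2" "sigma_finite_measure M3"
    "sigma_finite_measure M4" "sigma_finite_measure M5"
    and [measurable]: "g \<in> borel_measurable (M1 \<Otimes>\<^sub>M M2 \<Otimes>\<^sub>M M3 \<Otimes>\<^sub>M M4 \<Otimes>\<^sub>M M5)"
  shows "integral\<^sup>N (M1 \<Otimes>\<^sub>M M2 \<Otimes>\<^sub>M M3 \<Otimes>\<^sub>M M4 \<Otimes>\<^sub>M M5) g =
     (\<integral>\<^sup>+e. \<integral>\<^sup>+w. \<integral>\<^sup>+b. \<integral>\<^sup>+a. g (a, b, snd w, fst w, e) \<partial>M1 \<partial>M2 \<partial>(M4 \<Otimes>\<^sub>M M3) \<partial>M5)"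
    and "(\<lambda>e. \<integral>\<^sup>+w. \<integral>\<^sup>+b. \<integral>\<^sup>+a. g (a, b, snd w, fst w, e) \<partial>M1 \<partial>M2 \<partial>(M4 \<Otimes>\<^sub>M M3)) \<in> borel_measurable M5"
proof -
  interpret A1: sigma_finite_measure M1 by fact
  interpret A2: sigma_finite_measure M2 by fact
  interpret A3: sigma_finite_measure M3 by fact
  interpret A4: sigma_finite_measure M4 by fact
  interpret A5: sigma_finite_measure M5 by fact
  interpret A43: pair_sigma_finite M4 M3 ..
  interpret A45: pair_sigma_finite M4 M5 ..
  interpret A35: pair_sigma_finite M3 "M4 \<Otimes>\<^sub>M M5" ..
  interpret A25: pair_sigma_finite M2 "M3 \<Otimes>\<^sub>M M4 \<Otimes>\<^sub>M M5" ..
  interpret A15: pair_sigma_finite M1 "M2 \<Otimes>\<^sub>M M3 \<Otimes>\<^sub>M M4 \<Otimes>\<^sub>M M5" ..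
  have "integral\<^sup>N (M1 \<Otimes>\<^sub>M M2 \<Otimes>\<^sub>M M3 \<Otimes>\<^sub>M M4 \<Otimes>\<^sub>M M5) g
     = (\<integral>\<^sup>+r. \<integral>\<^sup>+a. g (a, r) \<partial>M1 \<partial>(M2 \<Otimes>\<^sub>M M3 \<Otimes>\<^sub>M M4 \<Otimes>\<^sub>M M5))"
    by (rule A15.nn_integral_snd[symmetric]) measurable
  also have "\<dots> = (\<integral>\<^sup>+r. \<integral>\<^sup>+b. \<integral>\<^sup>+a. g (a, b, r) \<partial>M1 \<partial>M2 \<partial>(M3 \<Otimes>\<^sub>M M4 \<Otimes>\<^sub>M M5))"
    by (rule A25.nn_integral_snd[symmetric]) measurable
  also have "\<dots> = (\<integral>\<^sup>+r. \<integral>\<^sup>+c. \<integral>\<^sup>+b. \<integral>\<^sup>+a. g (a, b, c, r) \<partial>M1 \<partial>M2 \<partial>M3 \<partial>(M4 \<Otimes>\<^sub>M M5))"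
    by (rule A35.nn_integral_snd[symmetric]) measurable
  also have "\<dots> = (\<integral>\<^sup>+e. \<integral>\<^sup>+u. \<integral>\<^sup>+c. \<integral>\<^sup>+b. \<integral>\<^sup>+a. g (a, b, c, u, e) \<partial>M1 \<partial>M2 \<partial>M3 \<partial>M4 \<partial>M5)"
    by (rule A45.nn_integral_snd[symmetric]) measurable
  also have "\<dots> = (\<integral>\<^sup>+e. \<integral>\<^sup>+w. \<integral>\<^sup>+b. \<integral>\<^sup>+a. g (a, b, snd w, fst w, e) \<partial>M1 \<partial>M2 \<partial>(M4 \<Otimes>\<^sub>M M3) \<partial>M5)"
    by (intro nn_integral_cong, subst A3.nn_integral_fst[symmetric]) auto
  finally show "integral\<^sup>N (M1 \<Otimes>\<^sub>M M2 \<Otimes>\<^sub>M M3 \<Otimes>\<^sub>M M4 \<Otimes>\<^sub>M M5) g =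
     (\<integral>\<^sup>+e. \<integral>\<^sup>+w. \<integral>\<^sup>+b. \<integral>\<^sup>+a. g (a, b, snd w, fst w, e) \<partial>M1 \<partial>M2 \<partial>(M4 \<Otimes>\<^sub>M M3) \<partial>M5)" .
  show "(\<lambda>e. \<integral>\<^sup>+w. \<integral>\<^sup>+b. \<integral>\<^sup>+a. g (a, b, snd w, fst w, e) \<partial>M1 \<partial>M2 \<partial>(M4 \<Otimes>\<^sub>M M3)) \<in> borel_measurable M5"
    by measurable
qed

text \<open>For the hashing the order is kept, with \<tau> innermost and \<sigma> next: the interval
  of critical \<tau> depends on \<sigma> and \<beta>.\<close>

lemma nn_integral_five_natural:
  assumes "sigma_finite_measure M1" "sigma_finite_measure M2" "sigma_finite_measure M3"
    "sigma_finite_measure M4" "sigma_finite_measure M5"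
    and [measurable]: "h \<in> borel_measurable (M1 \<Otimes>\<^sub>M M2 \<Otimes>\<^sub>M M3 \<Otimes>\<^sub>M M4 \<Otimes>\<^sub>M M5)"
  shows "integral\<^sup>N (M1 \<Otimes>\<^sub>M M2 \<Otimes>\<^sub>M M3 \<Otimes>\<^sub>M M4 \<Otimes>\<^sub>M M5) h =
     (\<integral>\<^sup>+a. \<integral>\<^sup>+b. \<integral>\<^sup>+c. \<integral>\<^sup>+u. \<integral>\<^sup>+e. h (a, b, c, u, e) \<partial>M5 \<partial>M4 \<partial>M3 \<partial>M2 \<partial>M1)"
proof -
  interpret A2: sigma_finite_measure M2 by fact
  interpret A3: sigma_finite_measure M3 by fact
  interpret A4: sigma_finite_measure M4 by fact
  interpret A5: sigma_finite_measure M5 by fact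
  interpret A45: pair_sigma_finite M4 M5 ..
  interpret A35: pair_sigma_finite M3 "M4 \<Otimes>\<^sub>M M5" ..
  interpret A25: pair_sigma_finite M2 "M3 \<Otimes>\<^sub>M M4 \<Otimes>\<^sub>M M5" ..
  have "integral\<^sup>N (M1 \<Otimes>\<^sub>M M2 \<Otimes>\<^sub>M M3 \<Otimes>\<^sub>M M4 \<Otimes>\<^sub>M M5) h
     = (\<integral>\<^sup>+a. \<integral>\<^sup>+r. h (a, r) \<partial>(M2 \<Otimes>\<^sub>M M3 \<Otimes>\<^sub>M M4 \<Otimes>\<^sub>M M5) \<partial>M1)"
    by (rule A25.nn_integral_fst[symmetric]) measurable
  also have "\<dots> = (\<integral>\<^sup>+a. \<integral>\<^sup>+b. \<integral>\<^sup>+r. h (a, b, r) \<partial>(M3 \<Otimes>\<^sub>M M4 \<Otimes>\<^sub>M M5) \<partial>M2 \<partial>M1)"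
    by (intro nn_integral_cong A35.nn_integral_fst[symmetric]) measurable
  also have "\<dots> = (\<integral>\<^sup>+a. \<integral>\<^sup>+b. \<integral>\<^sup>+c. \<integral>\<^sup>+r. h (a, b, c, r) \<partial>(M4 \<Otimes>\<^sub>M M5) \<partial>M3 \<partial>M2 \<partial>M1)"
    by (intro nn_integral_cong A45.nn_integral_fst[symmetric]) measurable
  also have "\<dots> = (\<integral>\<^sup>+a. \<integral>\<^sup>+b. \<integral>\<^sup>+c. \<integral>\<^sup>+u. \<integral>\<^sup>+e. h (a, b, c, u, e) \<partial>M5 \<partial>M4 \<partial>M3 \<partial>M2 \<partial>M1)"
    by (intro nn_integral_cong A5.nn_integral_fst[symmetric]) measurable
  finally show ?thesis .
qed

text \<open>The first unit vector and the zero vector have distance 1, and almost surely their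
  outputs have sizes 1 and 0.\<close>

lemma stretch_ge_1:
  assumes n: "1 \<le> n" "1 \<le> k" and A: "correlated_sampling n k A" "stretch n k \<alpha> A"
  shows "1 \<le> \<alpha>"
proof -
  interpret prob_space A using A by (simp add: correlated_sampling_def)
  define x y :: "nat \<Rightarrow> real" where "x = (\<lambda>i\<in>{1..n}. if i = 1 then 1 else 0)" and "y = (\<lambda>i\<in>{1..n}. 0)"
  have nx: "l1_norm n x = 1" "l1_norm n y = 0" "l1_dist n x y = 1"
    using n by (simp_all add: l1_norm_def l1_dist_def x_def y_def if_distrib[of abs] cong: if_cong)
  have D: "x \<in> Delta n k" "y \<in> Delta n k"
    using n nx by (auto simp: Delta_def x_def y_def)
  have "AE f in A. int (card (f x)) \<in> {\<lfloor>l1_norm n x\<rfloor>, \<lceil>l1_norm n x\<rceil>}"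
    "AE f in A. int (card (f y)) \<in> {\<lfloor>l1_norm n y\<rfloor>, \<lceil>l1_norm n y\<rceil>}"
    using A(2) D by (auto simp: stretch_def)
  then have "AE f in A. ennreal 1 \<le> of_nat (card (sym_diff (f x) (f y)))"
    using AE_space
  proof eventually_elim
    fix f assume f: "int (card (f x)) \<in> {\<lfloor>l1_norm n x\<rfloor>, \<lceil>l1_norm n x\<rceil>}"
      "int (card (f y)) \<in> {\<lfloor>l1_norm n y\<rfloor>, \<lceil>l1_norm n y\<rceil>}" "f \<in> space A"
    have "finite (f y)" by (rule finite_subset[OF measurable_eval(2)[OF A(1) D(2) f(3)]]) simp
    then have "card (f x) = 1" "f y = {}" using f(1,2) nx by auto
    then show "ennreal 1 \<le> of_nat (card (sym_diff (f x) (f y)))" by simp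
  qed
  then have "(\<integral>\<^sup>+f. ennreal 1 \<partial>A) \<le> (\<integral>\<^sup>+f. of_nat (card (sym_diff (f x) (f y))) \<partial>A)"
    by (rule nn_integral_mono_AE)
  also have "\<dots> \<le> ennreal (\<alpha> * l1_dist n x y)" by (rule nn_integral_stretch[OF A D])
  finally have "ennreal 1 \<le> ennreal \<alpha>" using nx emeasure_space_1 by simp
  then show ?thesis by (cases "0 \<le> \<alpha>") (auto simp: ennreal_neg)
qed

text \<open>Rounding up adds less than 1, which doubling 32 to 64 absorbs because the product is at
  least 1.\<close>

lemma num_buckets_bounds:
  assumes "1 \<le> k" "1 \<le> \<alpha>"
  shows "32 * real k ^ 5 * \<alpha> ^ 5 \<le> real (num_buckets k \<alpha>)"
    and "real (num_buckets k \<alpha>) \<le> 64 * (real k ^ 5 * \<alpha> ^ 5)"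
    and "1 \<le> real k ^ 5 * \<alpha> ^ 5"
proof -
  have k: "1 \<le> real k ^ 5" "1 \<le> \<alpha> ^ 5" using assms by (simp_all add: one_le_power)
  then show p: "1 \<le> real k ^ 5 * \<alpha> ^ 5" using mult_mono[OF k] by simp
  then have "0 \<le> 2 ^ 5 * real k ^ 5 * \<alpha> ^ 5" by (simp add: mult.assoc)
  then have "0 \<le> \<lceil>2 ^ 5 * real k ^ 5 * \<alpha> ^ 5\<rceil>" by linarith
  then have "real (num_buckets k \<alpha>) = real_of_int \<lceil>2 ^ 5 * real k ^ 5 * \<alpha> ^ 5\<rceil>"
    unfolding num_buckets_def by (rule of_nat_nat)
  then show "32 * real k ^ 5 * \<alpha> ^ 5 \<le> real (num_buckets k \<alpha>)" "real (num_buckets k \<alpha>) \<le> 64 * (real k ^ 5 * \<alpha> ^ 5)"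
    using p by (simp_all add: mult.assoc) linarith+
qed

text \<open>From m \<le> 64 k^5 \<alpha>^5 one gets log m \<le> 6 + 5 (log k + log \<alpha>). The
  cube in d triples this, and the ceiling adds 1, so 19 = 3 * 6 + 1 and 15 = 3 * 5.\<close>

lemma depth_bound:
  assumes "1 \<le> k" "1 \<le> \<alpha>" "sampling_tree (num_slots k \<alpha>) t"
  shows "real (depth t) \<le> 19 + 15 * (log 2 (real k) + log 2 \<alpha>)"
proof -
  let ?m = "real (num_buckets k \<alpha>)" and ?u = "real k ^ 5 * \<alpha> ^ 5"
  note b = num_buckets_bounds[OF assms(1,2)]
  have m: "0 < ?m" using b by (simp add: mult.assoc)
  have "log 2 ?m \<le> log 2 (64 * ?u)" using b m by (simp add: log_le_cancel_iff)
  also have "\<dots> = log 2 64 + 5 * (log 2 (real k) + log 2 \<alpha>)"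
    using assms b(3) by (simp add: log_mult log_nat_power)
  also have "log 2 64 = log 2 (2 ^ 6)" by simp
  also have "\<dots> = 6" by (subst log_nat_power) auto
  finally have "log 2 ?m \<le> 6 + 5 * (log 2 (real k) + log 2 \<alpha>)" by simp
  moreover have "log 2 (real (num_slots k \<alpha>)) = 3 * log 2 ?m"
    using m by (simp add: num_slots_def log_nat_power)
  moreover have "real (depth t) = real_of_int \<lceil>log 2 (real (num_slots k \<alpha>))\<rceil>"
    using assms(3) by (metis of_int_of_nat_eq sampling_tree_def)
  moreover have "real_of_int \<lceil>log 2 (real (num_slots k \<alpha>))\<rceil> \<le> log 2 (real (num_slots k \<alpha>)) + 1"
    by linarith
  ultimately show ?thesis by linarith
qed

section \<open>Averaging the bound over the hashing\<close>

lemma nn_integral_affine2: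
  assumes "prob_space M" and [measurable]: "f \<in> borel_measurable M" "g \<in> borel_measurable M"
  shows "(\<integral>\<^sup>+x. K + c * f x + c' * g x \<partial>M) = K + c * (\<integral>\<^sup>+x. f x \<partial>M) + c' * (\<integral>\<^sup>+x. g x \<partial>M)"
  by (simp add: nn_integral_add nn_integral_cmult nn_integral_prob_const[OF assms(1)] del: nn_integral_const)

text \<open>The terms free of 1/m give 42 D + 42. The others are multiples of \<alpha>/m, k/m,
  \<alpha> k^2/m and k^3/m, each at most 1/32, with coefficients 4, 160, 2 and 120; their total
  286/32 is below 9.\<close>

lemma stability_constants:
  fixes k m :: nat and \<alpha> \<delta> D :: real
  assumes "1 \<le> k" "1 \<le> \<alpha>" "0 \<le> \<delta>" "1 \<le> D" "32 * real k ^ 5 * \<alpha> ^ 5 \<le> real m"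
  shows "(2 * D + 2) * \<delta> + (4 * D + 4) * (10 * \<delta>)
     + (\<alpha> * \<delta> + 2 * real k * (10 * \<delta>)) * (4 / real m) + 2 * real k * (10 * \<delta>) * (4 / real m)
     + (\<alpha> * \<delta> + 2 * real k * (10 * \<delta>)) * (2 * real k ^ 2 / real m)
     + (2 * real k * (10 * \<delta>) + 2 * real k * (10 * \<delta>)) * (2 * real k ^ 2 / real m)
     \<le> (42 * D + 51) * \<delta>"
proof -
  have k: "1 \<le> real k" using assms by simp
  have m: "0 < real m"
    using assms(5) k assms(2) by (smt (verit) mult_pos_pos zero_less_power)
  have k35: "real k ^ 3 \<le> real k ^ 5" "real k \<le> real k ^ 3" "1 \<le> real k ^ 2" "real k ^ 2 \<le> real k ^ 5"
    using k by (auto intro: power_increasing self_le_power one_le_power)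
  have a5: "\<alpha> \<le> \<alpha> ^ 5" "1 \<le> \<alpha> ^ 5" using assms(2) by (auto intro: self_le_power one_le_power)
  have p1: "real k ^ 3 \<le> real k ^ 5 * \<alpha> ^ 5"
    using mult_mono[OF k35(1) a5(2)] k by simp
  have p2: "\<alpha> * real k ^ 2 \<le> real k ^ 5 * \<alpha> ^ 5"
    using mult_mono[OF k35(4) a5(1)] k assms(2) by (simp add: mult.commute)
  have r1: "real k ^ 3 / real m \<le> 1 / 32" "\<alpha> * real k ^ 2 / real m \<le> 1 / 32"
    using p1 p2 assms(5) m by (simp_all add: divide_simps)
  have r2: "real k / real m \<le> 1 / 32" "\<alpha> / real m \<le> 1 / 32"
  proof -
    have "real k / real m \<le> real k ^ 3 / real m" using k35 m by (intro divide_right_mono) auto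
    then show "real k / real m \<le> 1 / 32" using r1(1) by (rule order_trans)
    have "\<alpha> * 1 \<le> \<alpha> * real k ^ 2" using k35 assms(2) by (intro mult_left_mono) auto
    then have "\<alpha> / real m \<le> \<alpha> * real k ^ 2 / real m" using m by (intro divide_right_mono) auto
    then show "\<alpha> / real m \<le> 1 / 32" using r1(2) by (rule order_trans)
  qed
  have "(2 * D + 2) * \<delta> + (4 * D + 4) * (10 * \<delta>)
     + (\<alpha> * \<delta> + 2 * real k * (10 * \<delta>)) * (4 / real m) + 2 * real k * (10 * \<delta>) * (4 / real m)
     + (\<alpha> * \<delta> + 2 * real k * (10 * \<delta>)) * (2 * real k ^ 2 / real m)
     + (2 * real k * (10 * \<delta>) + 2 * real k * (10 * \<delta>)) * (2 * real k ^ 2 / real m)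
    = \<delta> * (42 * D + 42 + 4 * (\<alpha> / real m) + 160 * (real k / real m) + 2 * (\<alpha> * real k ^ 2 / real m)
        + 120 * (real k ^ 3 / real m))"
    using m by (simp add: field_simps power2_eq_square power3_eq_cube)
  also have "\<dots> \<le> \<delta> * (42 * D + 51)"
  proof (rule mult_left_mono[OF _ assms(3)])
    show "42 * D + 42 + 4 * (\<alpha> / real m) + 160 * (real k / real m) + 2 * (\<alpha> * real k ^ 2 / real m)
        + 120 * (real k ^ 3 / real m) \<le> 42 * D + 51"
      using r1 r2 by linarith
  qed
  finally show ?thesis by (simp add: mult.commute)
qed

lemma ALG_stability_coordinate:
  assumes n: "1 \<le> n" "1 \<le> k" and A: "correlated_sampling n k A" "stretch n k \<alpha> A"
    and t: "sampling_tree (num_slots k \<alpha>) t"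
    and x: "x \<in> Delta n k" "x(j := v) \<in> Delta n k" and j: "j \<in> {1..n}" "x j < v"
  shows "(\<integral>\<^sup>+\<omega>. of_nat (card (sym_diff (ALG n k \<alpha> t \<omega> x) (ALG n k \<alpha> t \<omega> (x(j := v))))) \<partial>shared_randomness n k \<alpha> A t)
    \<le> ennreal ((42 * (2 * real (depth t) + 1) + 51) * (v - x j))"
proof -
  define m d where "m = num_buckets k \<alpha>" and "d = num_slots k \<alpha>"
  define \<delta> D where "\<delta> = v - x j" and "D = 2 * real (depth t) + 1"
  define y where "y = x(j := v)"
  have \<alpha>: "1 \<le> \<alpha>" by (rule stretch_ge_1[OF n A])
  have \<delta>: "0 < \<delta>" using j by (simp add: \<delta>_def)
  note mb = num_buckets_bounds[OF n(2) \<alpha>, folded m_def]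
  have m32: "32 \<le> real m" using mb by (simp add: mult.assoc)
  then have m0: "0 < m" by (cases m) auto
  have d3: "d = m ^ 3" by (simp add: d_def num_slots_def m_def)
  then have d0: "0 < d" using m0 by simp
  have km: "10 * k \<le> m"
  proof -
    have "real k * 1 \<le> real k ^ 5 * \<alpha> ^ 5"
      using n(2) \<alpha> by (intro mult_mono) (auto intro: self_le_power one_le_power)
    then have "10 * real k \<le> real m" using mb(1) n(2) by (simp add: mult.assoc)
    then show ?thesis by linarith
  qed
  have tl: "distinct (leaves t)" "set (leaves t) = {1..d}" using t by (auto simp: sampling_tree_def d_def)
  let ?Cl = "clocks n" and ?Th = "tree_nodes t"
  let ?U = "uniform_real 0 1" and ?S = "uniform_real 0 (1/10)"
  let ?MR = "uniform_funs {1..m} {1..d}" and ?MC = "uniform_funs {1..n} {1..d}"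
  let ?MB = "uniform_funs {1..n} {1..m}"
  define H where "H = ?MR \<Otimes>\<^sub>M ?MC \<Otimes>\<^sub>M ?MB \<Otimes>\<^sub>M ?S \<Otimes>\<^sub>M ?S"
  have M_eq: "shared_randomness n k \<alpha> A t = A \<Otimes>\<^sub>M ?Cl \<Otimes>\<^sub>M ?Th \<Otimes>\<^sub>M ?U \<Otimes>\<^sub>M H"
    by (simp only: shared_randomness_def Let_def m_def[symmetric] d_def[symmetric] H_def)
  have pR: "prob_space ?MR" and pC: "prob_space ?MC" and pB: "prob_space ?MB"
    by (rule prob_space_PiM_uniform[OF d0] prob_space_PiM_uniform[OF m0])+
  have pS: "prob_space ?S" and pU: "prob_space ?U" by (auto intro: prob_space_uniform_real)
  have AE_S: "AE u in ?S. 0 \<le> u \<and> u \<le> 1 / 10" by (rule AE_uniform_real) simp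
  have pTh: "prob_space ?Th" by (rule prob_space_tree_nodes)
  have pA: "prob_space A" using A by (simp add: correlated_sampling_def)
  have sf: "sigma_finite_measure M" if "prob_space M" for M :: "'b measure"
    using that by (rule prob_space_imp_sigma_finite)
  have pH: "prob_space H"
    unfolding H_def by (intro prob_space_pair pR pC pB pS)
  define g :: "randomness \<Rightarrow> ennreal" where
    "g = (\<lambda>\<omega>. of_nat (card (sym_diff (ALG n k \<alpha> t \<omega> x) (ALG n k \<alpha> t \<omega> y))))"
  have g_meas: "g \<in> borel_measurable (shared_randomness n k \<alpha> A t)"
  proof -
    have "g \<in> measurable (shared_randomness n k \<alpha> A t) (count_space UNIV)"
      unfolding g_def
      by (rule measurable_pair_finite_range[where F = "\<lambda>\<omega>. ALG n k \<alpha> t \<omega> x" and G = "\<lambda>\<omega>. ALG n k \<alpha> t \<omega> y"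
            and h = "\<lambda>X Y. of_nat (card (sym_diff X Y))" and P = "Pow {1..n}" and Q = "Pow {1..n}"])
         (use measurable_ALG[OF A(1) tl(1)] x in \<open>auto simp: y_def\<close>)
    from measurable_compose[OF this, of "\<lambda>x. x" borel] show ?thesis by simp
  qed
  define \<Phi> where "\<Phi> = (\<lambda>\<eta>. expect_inner n A t (\<lambda>f E \<omega>. g (f, E, snd \<omega>, fst \<omega>, \<eta>)))"
  note five = nn_integral_five[OF sf[OF pA] sf[OF prob_space_clocks] sf[OF pTh] sf[OF pU] sf[OF pH], OF g_meas[unfolded M_eq]]
  have \<Phi>_eq: "\<Phi> = (\<lambda>e. \<integral>\<^sup>+w. \<integral>\<^sup>+b. \<integral>\<^sup>+a. g (a, b, snd w, fst w, e) \<partial>A \<partial>?Cl \<partial>(?U \<Otimes>\<^sub>M ?Th))"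
    by (simp add: \<Phi>_def expect_inner_def tree_space_def)
  have \<Phi>_meas: "\<Phi> \<in> borel_measurable (?MR \<Otimes>\<^sub>M ?MC \<Otimes>\<^sub>M ?MB \<Otimes>\<^sub>M ?S \<Otimes>\<^sub>M ?S)"
    using five(2) unfolding \<Phi>_eq H_def .
  have int_\<Phi>: "(\<integral>\<^sup>+\<omega>. g \<omega> \<partial>shared_randomness n k \<alpha> A t) = (\<integral>\<^sup>+\<eta>. \<Phi> \<eta> \<partial>H)"
    unfolding \<Phi>_eq M_eq by (rule five(1))
  define Qx where "Qx = collision_count n m x"
  define Qy where "Qy = collision_count n m y"
  define Ox where "Ox = pair_mass n x"
  define Oy where "Oy = pair_mass n y"
  \<comment> \<open>The constant \<open>e\<close> bounds both the probability over \<sigma> that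
    \<open>j\<close> changes its status and the probability over \<tau> of the event
    \<open>near\<close>: an interval of length \<delta> inside one of length 1/10.\<close>
  define a1 a2 a3 a4 e where "a1 = ennreal (\<alpha> * \<delta>)" and "a2 = ennreal (2 * real k)"
    and "a3 = ennreal ((2 * D + 2) * \<delta>)" and "a4 = ennreal (4 * D + 4)" and "e = ennreal (10 * \<delta>)"
  \<comment> \<open>The part of the averaged bound that does not involve \<beta>.\<close>
  define K where "K = (\<lambda>R C. (a3 + a4 * e) + (a1 + a2 * e) * Qx R C + (a2 * e) * Qy R C)"
  have \<sigma>\<tau>: "(\<integral>\<^sup>+\<sigma>. \<integral>\<^sup>+\<tau>. \<Phi> (R, C, \<beta>, \<sigma>, \<tau>) \<partial>?S \<partial>?S) \<le> K R C + (a1 + a2 * e) * Ox \<beta> + (a2 * e + a2 * e) * Oy \<beta>"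
    if "R \<in> space ?MR" "C \<in> space ?MC" "\<beta> \<in> space ?MB" for R C \<beta>
  proof -
    have rnd: "R \<in> {1..m} \<rightarrow> {1..d}" "C \<in> {1..n} \<rightarrow> {1..d}" "\<beta> \<in> {1..n} \<rightarrow> {1..m}"
      using that by (auto simp: space_PiM_uniform_count)
    let ?W = "a2 * (Qx R C + Qy R C + Ox \<beta> + Oy \<beta>) + a4"
    let ?move = "\<lambda>\<sigma>. x j \<le> 1 / 10 + \<sigma> \<and> 1 / 10 + \<sigma> < v"
    \<comment> \<open>For a fixed \<sigma> the status of \<open>j\<close> is decided for both
      inputs, so only the term with \<open>near\<close> is averaged here.\<close>
    have \<tau>: "(\<integral>\<^sup>+\<tau>. \<Phi> (R, C, \<beta>, \<sigma>, \<tau>) \<partial>?S)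
        \<le> (a1 * (Qx R C + Ox \<beta>) + a3 + a2 * Oy \<beta> * e) + ?W * of_bool (?move \<sigma>)"
      if \<sigma>: "0 \<le> \<sigma>" "\<sigma> \<le> 1 / 10" for \<sigma>
    proof -
      let ?l = "1 - load n x (large_set n \<sigma> x) \<beta> (\<beta> j)"
      have "(\<integral>\<^sup>+\<tau>. \<Phi> (R, C, \<beta>, \<sigma>, \<tau>) \<partial>?S)
        \<le> (a1 * (Qx R C + Ox \<beta>) + of_bool (?move \<sigma>) * ?W + a3) + (a2 * Oy \<beta>) * ennreal ((?l - (?l - \<delta>)) / (1 / 10 - 0))"
      proof (rule nn_integral_add_of_bool[where P = "\<lambda>\<tau>. \<tau> \<in> {?l - \<delta>..?l}"])
        show "AE \<tau> in ?S. \<Phi> (R, C, \<beta>, \<sigma>, \<tau>) \<le> (a1 * (Qx R C + Ox \<beta>) + of_bool (?move \<sigma>) * ?W + a3)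
            + (a2 * Oy \<beta>) * of_bool (\<tau> \<in> {?l - \<delta>..?l})"
          using AE_S
        proof eventually_elim
          fix \<tau> :: real assume "0 \<le> \<tau> \<and> \<tau> \<le> 1 / 10"
          then have \<tau>: "0 \<le> \<tau>" "\<tau> \<le> 1 / 10" by auto
          have "\<Phi> (R, C, \<beta>, \<sigma>, \<tau>) \<le> stability_bound k \<alpha> D \<delta> (Qx R C) (Qy R C) (Ox \<beta>) (Oy \<beta>) (?move \<sigma>) (\<tau> \<in> {?l - \<delta>..?l})"
            unfolding \<Phi>_def g_def Qx_def Qy_def Ox_def Oy_def D_def \<delta>_def y_def m_def
            by (rule expect_inner_ALG[OF A tl[unfolded d_def] x j rnd[unfolded m_def d_def] \<sigma> \<tau>])
          then show "\<Phi> (R, C, \<beta>, \<sigma>, \<tau>) \<le> (a1 * (Qx R C + Ox \<beta>) + of_bool (?move \<sigma>) * ?W + a3)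
            + (a2 * Oy \<beta>) * of_bool (\<tau> \<in> {?l - \<delta>..?l})"
            unfolding stability_bound_def a1_def[symmetric] a2_def[symmetric] a3_def[symmetric] a4_def[symmetric]
            by (simp only: add_ac)
        qed
      qed (use \<delta> in auto)
      also have "ennreal ((?l - (?l - \<delta>)) / (1 / 10 - 0)) = e" by (simp add: e_def mult.commute)
      finally show ?thesis by (simp only: add_ac mult_ac)
    qed
    have "(\<integral>\<^sup>+\<sigma>. \<integral>\<^sup>+\<tau>. \<Phi> (R, C, \<beta>, \<sigma>, \<tau>) \<partial>?S \<partial>?S)
        \<le> (a1 * (Qx R C + Ox \<beta>) + a3 + a2 * Oy \<beta> * e) + ?W * ennreal (((v - 1 / 10) - (x j - 1 / 10)) / (1 / 10 - 0))"
    proof (rule nn_integral_add_of_bool[where P = ?move])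
      show "AE \<sigma> in ?S. (\<integral>\<^sup>+\<tau>. \<Phi> (R, C, \<beta>, \<sigma>, \<tau>) \<partial>?S)
        \<le> (a1 * (Qx R C + Ox \<beta>) + a3 + a2 * Oy \<beta> * e) + ?W * of_bool (?move \<sigma>)"
        using AE_S by eventually_elim (rule \<tau>; simp)
    qed (use j in auto)
    also have "ennreal (((v - 1 / 10) - (x j - 1 / 10)) / (1 / 10 - 0)) = e" by (simp add: e_def \<delta>_def mult.commute)
    also have "(a1 * (Qx R C + Ox \<beta>) + a3 + a2 * Oy \<beta> * e) + ?W * e
        = K R C + (a1 + a2 * e) * Ox \<beta> + (a2 * e + a2 * e) * Oy \<beta>"
      by (simp add: K_def distrib_left distrib_right add_ac mult_ac)
    finally show ?thesis .
  qed
  define q r where "q = ennreal (4 / real m)" and "r = ennreal (2 * real k ^ 2 / real m)"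
  have meas: "h \<in> borel_measurable ?MR" "h \<in> borel_measurable ?MC" "h \<in> borel_measurable ?MB" for h :: "(nat \<Rightarrow> nat) \<Rightarrow> ennreal"
    by (simp_all only: measurable_from_PiM_uniform_count[OF finite_atLeastAtMost finite_atLeastAtMost]) simp_all
  have B: "(\<integral>\<^sup>+\<beta>. \<integral>\<^sup>+\<sigma>. \<integral>\<^sup>+\<tau>. \<Phi> (R, C, \<beta>, \<sigma>, \<tau>) \<partial>?S \<partial>?S \<partial>?MB) \<le> K R C + ((a1 + a2 * e) * r + (a2 * e + a2 * e) * r)"
    if "R \<in> space ?MR" "C \<in> space ?MC" for R C
  proof -
    have "(\<integral>\<^sup>+\<beta>. \<integral>\<^sup>+\<sigma>. \<integral>\<^sup>+\<tau>. \<Phi> (R, C, \<beta>, \<sigma>, \<tau>) \<partial>?S \<partial>?S \<partial>?MB)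
        \<le> (\<integral>\<^sup>+\<beta>. K R C + (a1 + a2 * e) * Ox \<beta> + (a2 * e + a2 * e) * Oy \<beta> \<partial>?MB)"
      by (intro nn_integral_mono \<sigma>\<tau> that)
    also have "\<dots> = K R C + (a1 + a2 * e) * (\<integral>\<^sup>+\<beta>. Ox \<beta> \<partial>?MB) + (a2 * e + a2 * e) * (\<integral>\<^sup>+\<beta>. Oy \<beta> \<partial>?MB)"
      by (rule nn_integral_affine2[OF pB meas(3) meas(3)])
    also have "\<dots> \<le> K R C + (a1 + a2 * e) * r + (a2 * e + a2 * e) * r"
      unfolding Ox_def Oy_def r_def y_def using m0 x
      by (intro add_mono mult_left_mono expectation_pair_mass order_refl) auto
    finally show ?thesis by (simp only: add.assoc)
  qed
  let ?c0 = "(a3 + a4 * e) + ((a1 + a2 * e) * r + (a2 * e + a2 * e) * r)"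
  have Q: "(\<integral>\<^sup>+R. \<integral>\<^sup>+C. Qx R C \<partial>?MC \<partial>?MR) \<le> q" "(\<integral>\<^sup>+R. \<integral>\<^sup>+C. Qy R C \<partial>?MC \<partial>?MR) \<le> q"
    unfolding Qx_def Qy_def q_def y_def using expectation_collision_count[OF _ km m0 d3] x by auto
  have "(\<integral>\<^sup>+\<eta>. \<Phi> \<eta> \<partial>H) = (\<integral>\<^sup>+R. \<integral>\<^sup>+C. \<integral>\<^sup>+\<beta>. \<integral>\<^sup>+\<sigma>. \<integral>\<^sup>+\<tau>. \<Phi> (R, C, \<beta>, \<sigma>, \<tau>) \<partial>?S \<partial>?S \<partial>?MB \<partial>?MC \<partial>?MR)"
    unfolding H_def
    by (rule nn_integral_five_natural[OF sf[OF pR] sf[OF pC] sf[OF pB] sf[OF pS] sf[OF pS] \<Phi>_meas])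
  also have "\<dots> \<le> (\<integral>\<^sup>+R. \<integral>\<^sup>+C. ?c0 + (a1 + a2 * e) * Qx R C + (a2 * e) * Qy R C \<partial>?MC \<partial>?MR)"
  proof (intro nn_integral_mono)
    fix R C assume "R \<in> space ?MR" "C \<in> space ?MC"
    from B[OF this] show "(\<integral>\<^sup>+\<beta>. \<integral>\<^sup>+\<sigma>. \<integral>\<^sup>+\<tau>. \<Phi> (R, C, \<beta>, \<sigma>, \<tau>) \<partial>?S \<partial>?S \<partial>?MB)
       \<le> ?c0 + (a1 + a2 * e) * Qx R C + (a2 * e) * Qy R C"
      unfolding K_def by (simp only: add_ac)
  qed
  also have "\<dots> = (\<integral>\<^sup>+R. ?c0 + (a1 + a2 * e) * (\<integral>\<^sup>+C. Qx R C \<partial>?MC) + (a2 * e) * (\<integral>\<^sup>+C. Qy R C \<partial>?MC) \<partial>?MR)"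
    by (intro nn_integral_cong nn_integral_affine2[OF pC meas(2) meas(2)])
  also have "\<dots> = ?c0 + (a1 + a2 * e) * (\<integral>\<^sup>+R. \<integral>\<^sup>+C. Qx R C \<partial>?MC \<partial>?MR) + (a2 * e) * (\<integral>\<^sup>+R. \<integral>\<^sup>+C. Qy R C \<partial>?MC \<partial>?MR)"
    by (rule nn_integral_affine2[OF pR meas(1) meas(1)])
  also have "\<dots> \<le> ?c0 + (a1 + a2 * e) * q + (a2 * e) * q"
    by (intro add_mono mult_left_mono Q order_refl) auto
  also have "\<dots> = ennreal ((2 * D + 2) * \<delta> + (4 * D + 4) * (10 * \<delta>)
     + (\<alpha> * \<delta> + 2 * real k * (10 * \<delta>)) * (4 / real m) + 2 * real k * (10 * \<delta>) * (4 / real m)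
     + (\<alpha> * \<delta> + 2 * real k * (10 * \<delta>)) * (2 * real k ^ 2 / real m)
     + (2 * real k * (10 * \<delta>) + 2 * real k * (10 * \<delta>)) * (2 * real k ^ 2 / real m))"
  proof -
    have nn: "0 \<le> (2 * D + 2) * \<delta>" "0 \<le> 4 * D + 4" "0 \<le> \<alpha> * \<delta>" "0 \<le> 2 * real k" "0 \<le> 10 * \<delta>" "0 \<le> 4 / real m"
      "0 \<le> 2 * real k ^ 2 / real m"
      using \<alpha> \<delta> by (auto simp: D_def)
    show ?thesis
      unfolding a1_def a2_def a3_def a4_def e_def q_def r_def using nn
      by (simp only: ennreal_mult[symmetric] ennreal_plus[symmetric] mult_nonneg_nonneg add_nonneg_nonneg add_ac)
  qed
  also have "\<dots> \<le> ennreal ((42 * D + 51) * \<delta>)"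
    using n \<alpha> \<delta> mb(1) by (intro ennreal_leI stability_constants) (auto simp: D_def)
  finally show ?thesis
    using int_\<Phi> unfolding g_def y_def D_def \<delta>_def by simp
qed

text \<open>The maximum with 1 covers k = \<alpha> = 1, where both logarithms vanish.\<close>

theorem theorem3p9:
  "\<exists>K>0. \<forall>(n::nat) (k::nat) (\<alpha>::real) (A::map_distr) (t::btree).
     n \<ge> 1 \<longrightarrow> k \<ge> 1 \<longrightarrow> \<alpha> > 0 \<longrightarrow>
     correlated_sampling n k A \<longrightarrow> stretch n k \<alpha> A \<longrightarrow>
     sampling_tree (num_slots k \<alpha>) t \<longrightarrow>
     (\<forall>x\<in>Delta n k. \<forall>y\<in>Delta n k.
        integrable (shared_randomness n k \<alpha> A t)
          (\<lambda>\<omega>. real (card (sym_diff (ALG n k \<alpha> t \<omega> x) (ALG n k \<alpha> t \<omega> y)))) \<and>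
        (\<integral>\<omega>. real (card (sym_diff (ALG n k \<alpha> t \<omega> x) (ALG n k \<alpha> t \<omega> y)))
            \<partial>shared_randomness n k \<alpha> A t)
          \<le> K * max 1 (log 2 (real k) + log 2 \<alpha>) * l1_dist n x y)"
proof -
  have bound: "integrable (shared_randomness n k \<alpha> A t)
          (\<lambda>\<omega>. real (card (sym_diff (ALG n k \<alpha> t \<omega> x) (ALG n k \<alpha> t \<omega> y)))) \<and>
        (\<integral>\<omega>. real (card (sym_diff (ALG n k \<alpha> t \<omega> x) (ALG n k \<alpha> t \<omega> y))) \<partial>shared_randomness n k \<alpha> A t)
          \<le> 3000 * max 1 (log 2 (real k) + log 2 \<alpha>) * l1_dist n x y"
    if n: "1 \<le> n" "1 \<le> k" and A: "correlated_sampling n k A" "stretch n k \<alpha> A"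
      and t: "sampling_tree (num_slots k \<alpha>) t" and xy: "x \<in> Delta n k" "y \<in> Delta n k"
    for n k :: nat and \<alpha> :: real and A t x y
  proof -
    let ?M = "shared_randomness n k \<alpha> A t"
    define c where "c = 42 * (2 * real (depth t) + 1) + 51"
    have c0: "0 \<le> c" by (simp add: c_def)
    have \<alpha>: "1 \<le> \<alpha>" by (rule stretch_ge_1[OF n A])
    have tl: "distinct (leaves t)" using t by (simp add: sampling_tree_def)
    define \<rho> :: "(nat \<Rightarrow> real) \<Rightarrow> (nat \<Rightarrow> real) \<Rightarrow> ennreal" where
      "\<rho> x y = (\<integral>\<^sup>+\<omega>. of_nat (card (sym_diff (ALG n k \<alpha> t \<omega> x) (ALG n k \<alpha> t \<omega> y))) \<partial>?M)" for x y
    have meas: "(\<lambda>\<omega>. h (ALG n k \<alpha> t \<omega> x) (ALG n k \<alpha> t \<omega> y)) \<in> measurable ?M (count_space UNIV)"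
      if "x \<in> Delta n k" "y \<in> Delta n k" for x y and h :: "nat set \<Rightarrow> nat set \<Rightarrow> 'c"
      by (rule measurable_pair_finite_range[where F = "\<lambda>\<omega>. ALG n k \<alpha> t \<omega> x" and G = "\<lambda>\<omega>. ALG n k \<alpha> t \<omega> y"
            and h = h and P = "Pow {1..n}" and Q = "Pow {1..n}"])
         (use measurable_ALG[OF A(1) tl] that in auto)
    have meas': "(\<lambda>\<omega>. of_nat (card (sym_diff (ALG n k \<alpha> t \<omega> x) (ALG n k \<alpha> t \<omega> y)))) \<in> borel_measurable ?M"
      if "x \<in> Delta n k" "y \<in> Delta n k" for x y
      using measurable_compose[OF meas[OF that, of "\<lambda>X Y. of_nat (card (sym_diff X Y))"], of "\<lambda>x. x" borel] by simp
    have sym: "\<rho> x y = \<rho> y x" for x y by (simp add: \<rho>_def Un_commute)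
    have tri: "\<rho> x z \<le> \<rho> x y + \<rho> y z" if "x \<in> Delta n k" "y \<in> Delta n k" "z \<in> Delta n k" for x y z
    proof -
      have "\<rho> x z \<le> (\<integral>\<^sup>+\<omega>. of_nat (card (sym_diff (ALG n k \<alpha> t \<omega> x) (ALG n k \<alpha> t \<omega> y)))
          + of_nat (card (sym_diff (ALG n k \<alpha> t \<omega> y) (ALG n k \<alpha> t \<omega> z))) \<partial>?M)"
        unfolding \<rho>_def
      proof (intro nn_integral_mono)
        fix \<omega> assume "\<omega> \<in> space ?M"
        then have fin: "finite (ALG n k \<alpha> t \<omega> w)" if "w \<in> Delta n k" for w
          by (intro finite_subset[OF measurable_ALG(2)[OF A(1) tl that]]) auto
        have "card (sym_diff (ALG n k \<alpha> t \<omega> x) (ALG n k \<alpha> t \<omega> z))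
          \<le> card (sym_diff (ALG n k \<alpha> t \<omega> x) (ALG n k \<alpha> t \<omega> y) \<union> sym_diff (ALG n k \<alpha> t \<omega> y) (ALG n k \<alpha> t \<omega> z))"
          using fin that by (intro card_mono) auto
        also have "\<dots> \<le> card (sym_diff (ALG n k \<alpha> t \<omega> x) (ALG n k \<alpha> t \<omega> y)) + card (sym_diff (ALG n k \<alpha> t \<omega> y) (ALG n k \<alpha> t \<omega> z))"
          by (rule card_Un_le)
        finally show "of_nat (card (sym_diff (ALG n k \<alpha> t \<omega> x) (ALG n k \<alpha> t \<omega> z)))
          \<le> (of_nat (card (sym_diff (ALG n k \<alpha> t \<omega> x) (ALG n k \<alpha> t \<omega> y)))
          + of_nat (card (sym_diff (ALG n k \<alpha> t \<omega> y) (ALG n k \<alpha> t \<omega> z))) :: ennreal)"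
          by (simp only: of_nat_add[symmetric] of_nat_le_iff)
      qed
      also have "\<dots> = \<rho> x y + \<rho> y z"
        unfolding \<rho>_def using meas' that by (intro nn_integral_add) auto
      finally show ?thesis .
    qed
    have step: "\<rho> (x(j := v)) x \<le> ennreal (c * \<bar>v - x j\<bar>)"
      if "x \<in> Delta n k" "x(j := v) \<in> Delta n k" "j \<in> {1..n}" "v \<le> x j" for x j v
    proof (cases "v = x j")
      case True
      then show ?thesis by (simp add: \<rho>_def)
    next
      case False
      then have "\<rho> (x(j := v)) ((x(j := v))(j := x j)) \<le> ennreal (c * (x j - (x(j := v)) j))"
        unfolding \<rho>_def c_def using that
        by (intro ALG_stability_coordinate[OF n A t]) auto
      then show ?thesis using that by simp
    qed
    have down: "\<rho> w x \<le> ennreal (c * (\<Sum>i\<in>{1..n}. x i - w i))"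
      if w: "w \<in> Delta n k" and x: "x \<in> Delta n k" and le: "\<And>i. w i \<le> x i" for w x
    proof -
      \<comment> \<open>Coordinates are lowered from \<open>x\<close> to \<open>w\<close> one at a
        time. Lowering never increases the norm, so every intermediate vector stays in
        \<open>Delta n k\<close>.\<close>
      define u where "u J = (\<lambda>i. if i \<in> J then w i else x i)" for J
      have uD: "u J \<in> Delta n k" if "J \<subseteq> {1..n}" for J
      proof -
        have "u J \<in> {1..n} \<rightarrow>\<^sub>E {0..1}"
          using w x that by (auto simp: Delta_def u_def PiE_def extensional_def Pi_def)
        moreover have "l1_norm n (u J) \<le> l1_norm n x"
          unfolding l1_norm_def
        proof (rule sum_mono)
          fix i assume "i \<in> {1..n}"
          then have "0 \<le> w i" "0 \<le> x i" using Delta_range[OF w] Delta_range[OF x] by auto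
          then show "\<bar>u J i\<bar> \<le> \<bar>x i\<bar>" using le[of i] by (auto simp: u_def)
        qed
        ultimately show ?thesis using x by (auto simp: Delta_def)
      qed
      have "\<rho> (u J) x \<le> ennreal (c * (\<Sum>i\<in>J. x i - w i))" if "finite J" "J \<subseteq> {1..n}" for J
        using that
      proof (induction J rule: finite_induct)
        case empty
        then show ?case by (simp add: \<rho>_def u_def)
      next
        case (insert j J)
        have eq: "u (insert j J) = (u J)(j := w j)" by (auto simp: u_def)
        have uj: "u J j = x j" using insert by (simp add: u_def)
        have "\<rho> (u (insert j J)) x \<le> \<rho> (u (insert j J)) (u J) + \<rho> (u J) x"
          using insert.prems uD[of "insert j J"] uD[of J] x by (intro tri) auto
        also have "\<dots> \<le> ennreal (c * (x j - w j)) + ennreal (c * (\<Sum>i\<in>J. x i - w i))"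
        proof (rule add_mono)
          have "\<rho> ((u J)(j := w j)) (u J) \<le> ennreal (c * \<bar>w j - u J j\<bar>)"
            using insert.prems uD[of "insert j J"] uD[of J] le[of j] uj unfolding eq by (intro step) auto
          then show "\<rho> (u (insert j J)) (u J) \<le> ennreal (c * (x j - w j))"
            unfolding eq uj using le[of j] by simp
        qed (use insert in auto)
        also have "\<dots> = ennreal (c * (\<Sum>i\<in>insert j J. x i - w i))"
        proof -
          have "0 \<le> c * (x j - w j)" "0 \<le> c * (\<Sum>i\<in>J. x i - w i)"
            using c0 le by (auto intro!: mult_nonneg_nonneg sum_nonneg)
          then show ?thesis
            using insert.hyps by (simp add: distrib_left flip: ennreal_plus)
        qed
        finally show ?case .
      qed
      moreover have "u {1..n} = w"
        using w x by (auto simp: u_def Delta_def PiE_def extensional_def fun_eq_iff)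
      ultimately show ?thesis by (metis finite_atLeastAtMost order_refl)
    qed
    \<comment> \<open>A direct path from \<open>x\<close> to \<open>y\<close> could leave
      \<open>Delta n k\<close>, since the norm may exceed k on the way. Via the minimum this cannot
      happen, and the two distances add up to exactly \<open>l1_dist n x y\<close>.\<close>
    define w where "w = (\<lambda>i. min (x i) (y i))"
    have w: "w \<in> Delta n k"
    proof -
      have "w \<in> {1..n} \<rightarrow>\<^sub>E {0..1}"
        using xy by (auto simp: Delta_def w_def PiE_def extensional_def Pi_def min_def)
      moreover have "l1_norm n w \<le> l1_norm n x"
        unfolding l1_norm_def
      proof (rule sum_mono)
        fix i assume "i \<in> {1..n}"
        then have "0 \<le> x i" "0 \<le> y i" using Delta_range[OF xy(1)] Delta_range[OF xy(2)] by auto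
        then show "\<bar>w i\<bar> \<le> \<bar>x i\<bar>" by (auto simp: w_def min_def)
      qed
      ultimately show ?thesis using xy by (auto simp: Delta_def)
    qed
    have "\<rho> x y \<le> \<rho> w x + \<rho> w y"
      using tri[OF xy(1) w xy(2)] by (simp add: sym[of x w])
    also have "\<dots> \<le> ennreal (c * (\<Sum>i\<in>{1..n}. x i - w i)) + ennreal (c * (\<Sum>i\<in>{1..n}. y i - w i))"
      by (intro add_mono down w xy) (auto simp: w_def)
    also have "\<dots> = ennreal (c * (\<Sum>i\<in>{1..n}. x i - w i) + c * (\<Sum>i\<in>{1..n}. y i - w i))"
      using c0 by (intro ennreal_plus[symmetric] mult_nonneg_nonneg sum_nonneg) (auto simp: w_def)
    also have "c * (\<Sum>i\<in>{1..n}. x i - w i) + c * (\<Sum>i\<in>{1..n}. y i - w i) = c * l1_dist n x y"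
    proof -
      have "(\<Sum>i\<in>{1..n}. x i - w i) + (\<Sum>i\<in>{1..n}. y i - w i) = l1_dist n x y"
        unfolding sum.distrib[symmetric] l1_dist_def l1_norm_def by (intro sum.cong) (auto simp: w_def min_def)
      then show ?thesis by (metis distrib_left)
    qed
    finally have \<rho>_le: "\<rho> x y \<le> ennreal (c * l1_dist n x y)" .
    have l0: "0 \<le> l1_dist n x y" by (auto simp: l1_dist_def l1_norm_def intro: sum_nonneg)
    let ?g = "\<lambda>\<omega>. real (card (sym_diff (ALG n k \<alpha> t \<omega> x) (ALG n k \<alpha> t \<omega> y)))"
    have g_nn: "(\<integral>\<^sup>+\<omega>. ennreal (?g \<omega>) \<partial>?M) = \<rho> x y"
      by (simp add: \<rho>_def ennreal_of_nat_eq_real_of_nat)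
    have g_meas: "?g \<in> borel_measurable ?M"
      using measurable_compose[OF meas[OF xy, of "\<lambda>X Y. real (card (sym_diff X Y))"], of "\<lambda>x. x" borel] by simp
    have g_int: "integrable ?M ?g"
    proof (rule integrableI_nonneg[OF g_meas])
      show "(\<integral>\<^sup>+\<omega>. ennreal (?g \<omega>) \<partial>?M) < \<infinity>"
        unfolding g_nn using \<rho>_le by (rule le_less_trans) simp
    qed auto
    have "ennreal (\<integral>\<omega>. ?g \<omega> \<partial>?M) \<le> ennreal (c * l1_dist n x y)"
      using nn_integral_eq_integral[OF g_int] \<rho>_le unfolding g_nn by simp
    then have "(\<integral>\<omega>. ?g \<omega> \<partial>?M) \<le> c * l1_dist n x y"
      using c0 l0 by (subst (asm) ennreal_le_iff) auto
    also have "\<dots> \<le> 3000 * max 1 (log 2 (real k) + log 2 \<alpha>) * l1_dist n x y"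
    proof (rule mult_right_mono[OF _ l0])
      \<comment> \<open>With \<ell> = log k + log \<alpha>, c = 84 * depth + 93 is at most 1689 +
        1260 \<ell>, hence at most 2949 times the maximum of 1 and \<ell>.\<close>
      show "c \<le> 3000 * max 1 (log 2 (real k) + log 2 \<alpha>)"
        using depth_bound[OF n(2) \<alpha> t] by (simp add: c_def max_def)
    qed
    finally show ?thesis using g_int by blast
  qed
  show ?thesis
    by (rule exI[of _ 3000]) (use bound in auto)
qed



end
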